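(* Let $\Phi(z;y)=\sum_{i=1}^d\big[(Af(z))_i-y_i\ln (Af(z))_i\big]$ and $R(z)=\lambda\|z\|_{\mathrm{TV}}$ for $z\in X=H^1(\Omega)$, $y\in Y$, let $\mu_0=N(\xi,C_0)$ be a Gaussian measure on $X$, and let $\mu^y$ be given by $$\frac{d\mu^y}{d\mu_0}(z)\propto\exp\big(-\Phi(z;y)-R(z)\big),$$ with all objects as specified in the context. Then: (1) $\mu^y$ is a well-defined probability measure on $X$. (2) $\mu^y$ is Lipschitz in the data $y$ with respect to the Hellinger distance: for every $r>0$ there exists $C=C(r)$ such that, for all $y,y'\in Y$ with $\max\{\|y\|_2,\|y'\|_2\}<r$, $$d_{\mathrm{Hell}}(\mu^y,\mu^{y'})\le C\,\|y-y'\|_2 .$$ (3) For $N_1,N_2\in\mathbb{N}$ let $\Phi_{N_1}$ be an $N_1$-dimensional approximation of $\Phi$, let $R_{N_2}$ be an $N_2$-dimensional approximation of $R$, and let $\mu^y_{N_1,N_2}$ be the probability measure given by $$\frac{d\mu^y_{N_1,N_2}}{d\mu_0}(z)\propto\exp\big(-\Phi_{N_1}(z;y)-R_{N_2}(z)\big).$$ Assume that the $\Phi_{N_1}$ satisfy the following with constants independent of $N_1$: (a) for every $r>0$ there are $M(r)\in\mathbb{R}$, $N(r)>0$ with $M(r)\le\Phi_{N_1}(z;y)\le N(r)$ for all $z\in X$ and all $y\in Y$ with $\|y\|_2<r$; (b) for fixed $y$, for every $r>0$ there is $M(r)>0$ with $|\Phi_{N_1}(z;y)-\Phi_{N_1}(v;y)|\le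 M(r)\|z-v\|_X$ for all $z,v\in X$ with $\max\{\|z\|_X,\|v\|_X\}<r$; (c) there is $M>0$ with $|\Phi_{N_1}(z;y)-\Phi_{N_1}(z;y')|\le M\|y-y'\|_2$ for all $z\in X$ and $y,y'\in Y$. Assume that the $R_{N_2}$ satisfy the following with constants independent of $N_2$: (i) $R_{N_2}$ is bounded from below on $X$; (ii) for every $r>0$ there is $K(r)>0$ such that $R_{N_2}(z)\le K(r)$ for all $z\in X$ with $\|z\|_X<r$. Assume also that for any $\epsilon>0$ there exist two positive sequences $\{a_{N_1}(\epsilon)\}$ and $\{b_{N_2}(\epsilon)\}$ converging to zero such that $\mu_0(X_\epsilon)\ge 1-\epsilon$ for any $N_1,N_2\in\mathbb{N}$, where $$X_\epsilon=\{z\in X:\ |\Phi(z;y)-\Phi_{N_1}(z;y)|\le a_{N_1}(\epsilon),\ |R(z)-R_{N_2}(z)|\le b_{N_2}(\epsilon)\}.$$ Then $$d_{\mathrm{Hell}}(\mu^y,\mu^y_{N_1,N_2})\to 0\quad\text{as } N_1,N_2\to+\infty .$$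
   Context: $\Omega\subset\mathbb{R}^2$ is a bounded open set and $X=H^1(\Omega)$ is the Sobolev space with norm $\|z\|_X^2=\|z\|_{L_2(\Omega)}^2+\|\partial_{x_1}z\|_{L_2(\Omega)}^2+\|\partial_{x_2}z\|_{L_2(\Omega)}^2$. The data space is $Y\subseteq\mathbb{R}^d$, with the Euclidean norm $\|\cdot\|_2$. Positivity-preserving reparametrization: for constants $a>0$, $b>1$, $c>0$, $f(z)(x)=\frac a2\big(\mathrm{erf}(z(x)/c)+b\big)$, where $\mathrm{erf}(s)=\frac{2}{\sqrt\pi}\int_0^s e^{-t^2}\,dt$. (Thus $f(z)\in X$ and $f(z)$ is bounded between two positive constants.) Forward map: $A:X\to\mathbb{R}^d$ is a bounded linear operator (the motivating example is the Radon transform $(Au)_i=K\int_{L_i}u(x)\,|dx|$ along lines $L_1,\dots,L_d$ with $K>0$). It is positive: for each $i$, $(Au)_i\ge 0$ whenever $u\ge0$ almost everywhere, and $(A\mathbf 1_\Omega)_i>0$, where $\mathbf 1_\Omega$ is the constant function $1$. Hence $(Af(z))_i>0$ for all $z\in X$ and all $i$. Prior: $\mu_0=N(\xi,C_0)$ is a Gaussian measure on $X$ with mean $\xi$ and covariance operator $C_0$, symmetric, positive and of trace class. $\|z\|_{\mathrm{TV}}=\int_\Omega\|\nabla z\|_2\,dx$ is the total variation seminorm and $\lambda>0$ is a constant. The TV-Gaussian prior is $d\mu_{\mathrm{pr}}/d\mu_0\propto\exp(-R)$, and $\mu^y$ is the posterior for the Poisson likelihood $\propto\exp(-\Phi(z;y))$.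 "$\propto$" means equality up to the normalizing constant making the measure a probability measure. The approximations $\Phi_{N_1}(\cdot;y)$ and $R_{N_2}$ are real-valued measurable functionals on $X$. The Hellinger distance between probability measures $\mu,\mu'$ absolutely continuous with respect to $\mu_0$ is $d_{\mathrm{Hell}}(\mu,\mu')=\Big(\tfrac12\int_X\big(\sqrt{d\mu/d\mu_0}-\sqrt{d\mu'/d\mu_0}\big)^2d\mu_0\Big)^{1/2}$. *)

theory Defs
  imports "HOL-Probability.Probability"
begin

section \<open>The Sobolev space \<open>H\<^sup>1(\<Omega>)\<close>, \<open>\<Omega>\<close> an open subset of the plane\<close>

text \<open>Functions on \<open>\<Omega>\<close> are total functions on the plane whose values outside \<open>\<Omega>\<close> are ignored.\<close>

type_synonym plane_fun = "real^2 \<Rightarrow> real"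

definition partial_d :: "2 \<Rightarrow> plane_fun \<Rightarrow> plane_fun" where
  "partial_d i f = (\<lambda>x. frechet_derivative f (at x) (axis i 1))"

primrec C_k :: "nat \<Rightarrow> plane_fun \<Rightarrow> bool" where
  "C_k 0 f \<longleftrightarrow> continuous_on UNIV f"
| "C_k (Suc k) f \<longleftrightarrow> (\<forall>x. f differentiable (at x)) \<and> (\<forall>i. C_k k (partial_d i f))"

definition test_funs :: "(real^2) set \<Rightarrow> plane_fun set" where
  "test_funs \<Omega> = {\<phi>. (\<forall>k. C_k k \<phi>) \<and>
     compact (closure {x. \<phi> x \<noteq> 0}) \<and> closure {x. \<phi> x \<noteq> 0} \<subseteq> \<Omega>}"

definition L2_funs :: "(real^2) set \<Rightarrow> plane_fun set" where
  "L2_funs \<Omega> = {u. u \<in> borel_measurable (lebesgue_on \<Omega>) \<and>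
     integrable (lebesgue_on \<Omega>) (\<lambda>x. (u x)\<^sup>2)}"

definition is_weak_partial :: "(real^2) set \<Rightarrow> 2 \<Rightarrow> plane_fun \<Rightarrow> plane_fun \<Rightarrow> bool" where
  "is_weak_partial \<Omega> i u g \<longleftrightarrow> (\<forall>\<phi>\<in>test_funs \<Omega>.
     (LINT x|lebesgue_on \<Omega>. u x * partial_d i \<phi> x) = - (LINT x|lebesgue_on \<Omega>. g x * \<phi> x))"

definition H1_funs :: "(real^2) set \<Rightarrow> plane_fun set" where
  "H1_funs \<Omega> = {u \<in> L2_funs \<Omega>. \<forall>i. \<exists>g\<in>L2_funs \<Omega>. is_weak_partial \<Omega> i u g}"

text \<open>An element of \<open>H\<^sup>1(\<Omega>)\<close> is a class of functions modulo equality almost everywhere on \<open>\<Omega>\<close>.\<close>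

type_synonym ae_fun = "plane_fun set"

definition ae_class :: "(real^2) set \<Rightarrow> plane_fun \<Rightarrow> ae_fun" where
  "ae_class \<Omega> u = {v. AE x in lebesgue_on \<Omega>. v x = u x}"

definition H1 :: "(real^2) set \<Rightarrow> ae_fun set" where
  "H1 \<Omega> = ae_class \<Omega> ` H1_funs \<Omega>"

text \<open>A chosen representative and a chosen weak partial derivative; both are determined up to
  null sets, and everything below depends on them only up to null sets.\<close>

definition rep :: "ae_fun \<Rightarrow> plane_fun" where
  "rep z = (SOME u. u \<in> z)"

definition weak_partial :: "(real^2) set \<Rightarrow> 2 \<Rightarrow> ae_fun \<Rightarrow> plane_fun" where
  "weak_partial \<Omega> i z = (SOME g. g \<in> L2_funs \<Omega> \<and> is_weak_partial \<Omega> i (rep z) g)"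

definition H1_zero :: "(real^2) set \<Rightarrow> ae_fun" where
  "H1_zero \<Omega> = ae_class \<Omega> (\<lambda>x. 0)"

definition H1_add :: "(real^2) set \<Rightarrow> ae_fun \<Rightarrow> ae_fun \<Rightarrow> ae_fun" where
  "H1_add \<Omega> z w = ae_class \<Omega> (\<lambda>x. rep z x + rep w x)"

definition H1_diff :: "(real^2) set \<Rightarrow> ae_fun \<Rightarrow> ae_fun \<Rightarrow> ae_fun" where
  "H1_diff \<Omega> z w = ae_class \<Omega> (\<lambda>x. rep z x - rep w x)"

definition H1_scale :: "(real^2) set \<Rightarrow> real \<Rightarrow> ae_fun \<Rightarrow> ae_fun" where
  "H1_scale \<Omega> s z = ae_class \<Omega> (\<lambda>x. s * rep z x)"

definition H1_inner :: "(real^2) set \<Rightarrow> ae_fun \<Rightarrow> ae_fun \<Rightarrow> real" where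
  "H1_inner \<Omega> z w = (LINT x|lebesgue_on \<Omega>. rep z x * rep w x) +
     (\<Sum>i\<in>UNIV. LINT x|lebesgue_on \<Omega>. weak_partial \<Omega> i z x * weak_partial \<Omega> i w x)"

definition H1_norm :: "(real^2) set \<Rightarrow> ae_fun \<Rightarrow> real" where
  "H1_norm \<Omega> z = sqrt ((LINT x|lebesgue_on \<Omega>. (rep z x)\<^sup>2) +
     (LINT x|lebesgue_on \<Omega>. (weak_partial \<Omega> 1 z x)\<^sup>2) +
     (LINT x|lebesgue_on \<Omega>. (weak_partial \<Omega> 2 z x)\<^sup>2))"

definition H1_dist :: "(real^2) set \<Rightarrow> ae_fun \<Rightarrow> ae_fun \<Rightarrow> real" where
  "H1_dist \<Omega> z w = H1_norm \<Omega> (H1_diff \<Omega> z w)"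

definition H1_borel :: "(real^2) set \<Rightarrow> ae_fun measure" where
  "H1_borel \<Omega> = sigma (H1 \<Omega>) {U. openin (Metric_space.mtopology (H1 \<Omega>) (H1_dist \<Omega>)) U}"

text \<open>For \<open>z \<in> H\<^sup>1(\<Omega>)\<close> with \<open>\<Omega>\<close> bounded, the integrand is integrable, being square integrable.\<close>

definition TV :: "(real^2) set \<Rightarrow> ae_fun \<Rightarrow> real" where
  "TV \<Omega> z = (LINT x|lebesgue_on \<Omega>. norm ((\<chi> i. weak_partial \<Omega> i z x) :: real^2))"


section \<open>Operators on \<open>H\<^sup>1(\<Omega>)\<close> and Gaussian measures\<close>

definition H1_bounded_linear :: "(real^2) set \<Rightarrow> (ae_fun \<Rightarrow> real^'d) \<Rightarrow> bool" where
  "H1_bounded_linear \<Omega> A \<longleftrightarrow>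
     (\<forall>z\<in>H1 \<Omega>. \<forall>w\<in>H1 \<Omega>. A (H1_add \<Omega> z w) = A z + A w) \<and>
     (\<forall>s. \<forall>z\<in>H1 \<Omega>. A (H1_scale \<Omega> s z) = s *\<^sub>R A z) \<and>
     (\<exists>K. \<forall>z\<in>H1 \<Omega>. norm (A z) \<le> K * H1_norm \<Omega> z)"

definition H1_positive :: "(real^2) set \<Rightarrow> (ae_fun \<Rightarrow> real^'d) \<Rightarrow> bool" where
  "H1_positive \<Omega> A \<longleftrightarrow> (\<forall>i.
     (\<forall>u\<in>H1 \<Omega>. (AE x in lebesgue_on \<Omega>. 0 \<le> rep u x) \<longrightarrow> 0 \<le> A u $ i) \<and>
     0 < A (ae_class \<Omega> (\<lambda>x. 1)) $ i)"

definition H1_bounded_endo :: "(real^2) set \<Rightarrow> (ae_fun \<Rightarrow> ae_fun) \<Rightarrow> bool" where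
  "H1_bounded_endo \<Omega> T \<longleftrightarrow>
     (\<forall>z\<in>H1 \<Omega>. T z \<in> H1 \<Omega>) \<and>
     (\<forall>z\<in>H1 \<Omega>. \<forall>w\<in>H1 \<Omega>. T (H1_add \<Omega> z w) = H1_add \<Omega> (T z) (T w)) \<and>
     (\<forall>s. \<forall>z\<in>H1 \<Omega>. T (H1_scale \<Omega> s z) = H1_scale \<Omega> s (T z)) \<and>
     (\<exists>K. \<forall>z\<in>H1 \<Omega>. H1_norm \<Omega> (T z) \<le> K * H1_norm \<Omega> z)"

definition H1_orthonormal_basis :: "(real^2) set \<Rightarrow> ae_fun set \<Rightarrow> bool" where
  "H1_orthonormal_basis \<Omega> B \<longleftrightarrow> B \<subseteq> H1 \<Omega> \<and>
     (\<forall>e\<in>B. \<forall>e'\<in>B. H1_inner \<Omega> e e' = (if e = e' then 1 else 0)) \<and>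
     (\<forall>z\<in>H1 \<Omega>. (\<forall>e\<in>B. H1_inner \<Omega> z e = 0) \<longrightarrow> z = H1_zero \<Omega>)"

text \<open>For a positive operator \<open>T\<close> one has \<open>|T| = T\<close>, so the trace norm is \<open>\<Sum>\<^sub>e \<langle>T e, e\<rangle>\<close>, which does
  not depend on the orthonormal basis.\<close>

definition H1_covariance_operator :: "(real^2) set \<Rightarrow> (ae_fun \<Rightarrow> ae_fun) \<Rightarrow> bool" where
  "H1_covariance_operator \<Omega> T \<longleftrightarrow> H1_bounded_endo \<Omega> T \<and>
     (\<forall>h\<in>H1 \<Omega>. \<forall>k\<in>H1 \<Omega>. H1_inner \<Omega> (T h) k = H1_inner \<Omega> h (T k)) \<and>
     (\<forall>h\<in>H1 \<Omega>. 0 \<le> H1_inner \<Omega> (T h) h) \<and>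
     (\<exists>B. H1_orthonormal_basis \<Omega> B \<and> (\<lambda>e. H1_inner \<Omega> (T e) e) summable_on B)"

text \<open>Gaussian laws on the line include the point masses.\<close>

definition real_gaussian :: "real \<Rightarrow> real \<Rightarrow> real measure" where
  "real_gaussian m v = (if v = 0 then return borel m
     else density lborel (\<lambda>x. ennreal (normal_density m (sqrt v) x)))"

text \<open>\<open>\<mu> = N(\<xi>, C\<^sub>0)\<close>: every continuous linear functional, that is every \<open>\<langle>h, \<cdot>\<rangle>\<close>, has a Gaussian law
  under \<open>\<mu>\<close>, and \<open>\<xi>\<close> and \<open>C\<^sub>0\<close> are the (weak) mean and the covariance operator.\<close>

definition H1_gaussian ::
    "(real^2) set \<Rightarrow> ae_fun measure \<Rightarrow> ae_fun \<Rightarrow> (ae_fun \<Rightarrow> ae_fun) \<Rightarrow> bool" where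
  "H1_gaussian \<Omega> \<mu> \<xi> C0 \<longleftrightarrow>
     space \<mu> = H1 \<Omega> \<and> sets \<mu> = sets (H1_borel \<Omega>) \<and> prob_space \<mu> \<and>
     \<xi> \<in> H1 \<Omega> \<and> H1_covariance_operator \<Omega> C0 \<and>
     (\<forall>h\<in>H1 \<Omega>. \<exists>m v. 0 \<le> v \<and> distr \<mu> borel (H1_inner \<Omega> h) = real_gaussian m v) \<and>
     (\<forall>h\<in>H1 \<Omega>. (LINT z|\<mu>. H1_inner \<Omega> h z) = H1_inner \<Omega> h \<xi>) \<and>
     (\<forall>h\<in>H1 \<Omega>. \<forall>k\<in>H1 \<Omega>.
        (LINT z|\<mu>. H1_inner \<Omega> h (H1_diff \<Omega> z \<xi>) * H1_inner \<Omega> k (H1_diff \<Omega> z \<xi>)) =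
        H1_inner \<Omega> (C0 h) k)"


section \<open>The Bayesian inverse problem\<close>

definition erf :: "real \<Rightarrow> real" where
  "erf s = 2 / sqrt pi * (LBINT t=ereal 0..ereal s. exp (- (t\<^sup>2)))"

definition reparam :: "(real^2) set \<Rightarrow> real \<Rightarrow> real \<Rightarrow> real \<Rightarrow> ae_fun \<Rightarrow> ae_fun" where
  "reparam \<Omega> a b c z = ae_class \<Omega> (\<lambda>x. a / 2 * (erf (rep z x / c) + b))"

definition poisson_potential ::
    "(ae_fun \<Rightarrow> real^'d) \<Rightarrow> (ae_fun \<Rightarrow> ae_fun) \<Rightarrow> ae_fun \<Rightarrow> real^'d \<Rightarrow> real" where
  "poisson_potential A f z y = (\<Sum>i\<in>UNIV. A (f z) $ i - y $ i * ln (A (f z) $ i))"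

text \<open>The measure with density proportional to \<open>exp (- V)\<close>. The normalizing constant is taken in
  \<open>[0, \<infinity>]\<close>; the construction is meaningful when it is neither \<open>0\<close> nor \<open>\<infinity>\<close> and \<open>V\<close> is measurable.\<close>

definition gibbs_const :: "'a measure \<Rightarrow> ('a \<Rightarrow> real) \<Rightarrow> ennreal" where
  "gibbs_const \<mu>0 V = (\<integral>\<^sup>+ z. ennreal (exp (- V z)) \<partial>\<mu>0)"

definition gibbs :: "'a measure \<Rightarrow> ('a \<Rightarrow> real) \<Rightarrow> 'a measure" where
  "gibbs \<mu>0 V = density \<mu>0 (\<lambda>z. ennreal (exp (- V z)) / gibbs_const \<mu>0 V)"

definition hellinger :: "'a measure \<Rightarrow> 'a measure \<Rightarrow> 'a measure \<Rightarrow> real" where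
  "hellinger \<mu>0 \<mu> \<nu> = sqrt (1 / 2 * (LINT z|\<mu>0.
     (sqrt (enn2real (RN_deriv \<mu>0 \<mu> z)) - sqrt (enn2real (RN_deriv \<mu>0 \<nu> z)))\<^sup>2))"

end

theory Submission
  imports Defs "HOL-Computational_Algebra.Polynomial" "HOL-Real_Asymp.Real_Asymp"
begin

text \<open>Write \<open>f z = F \<circ> z\<close>, where \<open>F\<close> is bounded with bounded Lipschitz derivative. The chain rule makes
  \<open>f\<close> a continuous map of \<open>H\<^sup>1\<close> into itself with values between the constants \<open>a (b - 1) / 2 > 0\<close> and
  \<open>a (b + 1) / 2\<close>, so positivity of \<open>A\<close> confines every \<open>(A f(z))\<^sub>i\<close> to a fixed compact subset of
  \<open>(0, \<infinity>)\<close>. Hence \<open>\<Phi>\<close> is measurable in \<open>z\<close>, bounded below, and Lipschitz in \<open>y\<close> uniformly in \<open>z\<close>; and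
  \<open>R \<ge> 0\<close> is continuous. The rest is about potentials: if \<open>\<bar>V - W\<bar> \<le> \<delta>\<close> everywhere, then the square
  roots of the normalized densities have logarithms at distance at most \<open>\<delta>\<close>, so the Hellinger
  distance is at most \<open>\<delta>\<close>; and in general its square is at most \<open>\<integral> \<bar>exp (- V) - exp (- W)\<bar> \<partial>\<mu>\<^sub>0 / Z\<^sub>V\<close>,
  which is small when \<open>V\<close> and \<open>W\<close> are close outside a set of small measure.

  The chain rule does not use mollification. If \<open>g\<close> is the weak derivative of \<open>u\<close> in the direction \<open>e\<close>, then
  \<open>u (x - h e) - u x\<close> is almost everywhere minus the integral of \<open>g (x - t e)\<close> over \<open>0 \<le> t \<le> h\<close>, so the
  error of the linear approximation of \<open>F\<close> along this increment is \<open>O(h\<^sup>2)\<close> in \<open>L\<^sup>1\<close>.\<close>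

section \<open>Test functions\<close>

text \<open>Uniqueness of weak derivatives needs concrete members of \<open>test_funs\<close>,
  smooth in the sense of the recursive predicate \<open>C_k\<close>; these come from exp (- 1/t).
  Uniqueness makes the choices \<open>rep\<close> and \<open>weak_partial\<close> harmless: each is
  identified almost everywhere with any other candidate. The square in O(h^2) is where g in L^2
  enters: the Taylor remainder is quadratic in the increment of u, and the L^2 norm of this
  increment is at most h times that of g. What is compared with h^2 is an integral over [0, h] of a
  function of t that is continuous at 0, so its value there must vanish; the continuity is that of
  translations in L^1. Although F' is Lipschitz, the product of F'(z) with a derivative of z depends
  on z in a merely continuous way here: the derivative need not be bounded, and the modulus of
  continuity at z is governed by its tails. Continuity is what Borel measurability of \<Phi> asks
  for. The last Hellinger estimate divides by the normalizing constant of V alone. This makes it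
  uniform over the approximating potentials W, whose own constants never have to be bounded from
  below.\<close>

lemma partial_d_eq:
  assumes "(f has_derivative f') (at x)"
  shows "partial_d i f x = f' (axis i 1)"
  using frechet_derivative_at[OF assms] by (simp add: partial_d_def)

lemma C_k_Suc_imp: "C_k (Suc k) f \<Longrightarrow> C_k k f"
proof (induction k arbitrary: f)
  case 0
  then have "\<forall>x. f differentiable (at x)" by simp
  then show ?case
    by (simp add: continuous_at_imp_continuous_on differentiable_imp_continuous_within)
next
  case (Suc k)
  then show ?case by (metis C_k.simps(2))
qed

lemma C_k_add: "C_k k f \<Longrightarrow> C_k k g \<Longrightarrow> C_k k (\<lambda>x. f x + g x)"
proof (induction k arbitrary: f g)
  case 0 then show ?case by (simp add: continuous_on_add)
next
  case (Suc k)
  have d: "f differentiable (at x)" "g differentiable (at x)" for x using Suc.prems by auto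
  have "partial_d i (\<lambda>x. f x + g x) = (\<lambda>x. partial_d i f x + partial_d i g x)" for i
    by (rule ext, subst partial_d_eq)
       (auto simp: partial_d_def intro!: derivative_intros frechet_derivative_works[THEN iffD1] d)
  with Suc d show ?case by simp
qed

lemma C_k_mult: "C_k k f \<Longrightarrow> C_k k g \<Longrightarrow> C_k k (\<lambda>x. f x * g x)"
proof (induction k arbitrary: f g)
  case 0 then show ?case by (simp add: continuous_on_mult)
next
  case (Suc k)
  have d: "f differentiable (at x)" "g differentiable (at x)" for x using Suc.prems by auto
  have "partial_d i (\<lambda>x. f x * g x) = (\<lambda>x. f x * partial_d i g x + partial_d i f x * g x)" for i
    by (rule ext, subst partial_d_eq)
       (auto simp: partial_d_def intro!: derivative_intros frechet_derivative_works[THEN iffD1] d)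
  \<comment> \<open>In the Leibniz rule one factor of each product stays undifferentiated, so its
    order is lowered from \<open>Suc k\<close> to \<open>k\<close> before the induction hypothesis
    applies.\<close>
  moreover have "C_k k f" "C_k k g" using Suc.prems C_k_Suc_imp by blast+
  ultimately show ?case using Suc d by (simp add: C_k_add)
qed

lemma C_k_translate: "C_k k f \<Longrightarrow> C_k k (\<lambda>x. f (x + v))"
proof (induction k arbitrary: f)
  case 0
  then have "continuous_on UNIV f" by simp
  then show ?case by (auto intro!: continuous_intros continuous_on_compose2[of UNIV f])
next
  case (Suc k)
  have d: "f differentiable (at x)" for x using Suc.prems by auto
  have D: "((\<lambda>x. f (x + v)) has_derivative frechet_derivative f (at (x + v))) (at x)" for x
  proof -
    have "((\<lambda>x. x + v) has_derivative (\<lambda>y. y)) (at x)"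
      by (auto intro!: derivative_eq_intros)
    from has_derivative_compose[OF this, of f] d[of "x+v", unfolded frechet_derivative_works]
    show ?thesis by simp
  qed
  have "partial_d i (\<lambda>x. f (x + v)) = (\<lambda>x. partial_d i f (x + v))" for i
    by (rule ext, subst partial_d_eq[OF D]) (simp add: partial_d_def)
  with Suc D show ?case by (auto simp: differentiable_def)
qed

lemma partial_d_translate:
  assumes "C_k 1 f"
  shows "partial_d i (\<lambda>x. f (x + v)) x = partial_d i f (x + v)"
proof -
  have d: "f differentiable (at (x + v))" using assms by (simp add: One_nat_def)
  have "((\<lambda>x. x + v) has_derivative (\<lambda>y. y)) (at x)"
    by (auto intro!: derivative_eq_intros)
  from partial_d_eq[OF has_derivative_compose[OF this d[unfolded frechet_derivative_works]]]
  show ?thesis by (simp add: partial_d_def)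
qed

section \<open>Smooth bump functions on boxes\<close>

definition flat_exp :: "real poly \<Rightarrow> real \<Rightarrow> real" where
  "flat_exp p t = (if t > 0 then poly p (1 / t) * exp (- (1 / t)) else 0)"

lemma poly_mult_exp_minus_tendsto_0: "((\<lambda>s. poly p s * exp (- s)) \<longlongrightarrow> (0::real)) at_top"
proof -
  have "((\<lambda>s. \<Sum>i\<le>degree p. coeff p i * (s ^ i / exp s)) \<longlongrightarrow> (\<Sum>i\<le>degree p. coeff p i * 0)) at_top"
    by (intro tendsto_intros tendsto_power_div_exp_0)
  then show ?thesis
    by (simp add: poly_altdef exp_minus sum_distrib_right divide_inverse mult.assoc)
qed

lemma flat_exp_tendsto_0: "(flat_exp p \<longlongrightarrow> 0) (at 0)"
proof -
  have "((\<lambda>t. poly p (inverse t) * exp (- inverse t)) \<longlongrightarrow> (0::real)) (at_right 0)"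
    using filterlim_compose[OF poly_mult_exp_minus_tendsto_0 filterlim_inverse_at_top_right] .
  moreover have "eventually (\<lambda>t. flat_exp p t = poly p (inverse t) * exp (- inverse t)) (at_right 0)"
    by (auto simp: eventually_at_right_field flat_exp_def inverse_eq_divide intro: exI[of _ 1])
  ultimately have "(flat_exp p \<longlongrightarrow> 0) (at_right 0)" by (simp add: tendsto_cong)
  moreover have "eventually (\<lambda>t. flat_exp p t = 0) (at_left 0)"
    by (auto simp: eventually_at_left_field flat_exp_def intro: exI[of _ "-1"])
  then have "(flat_exp p \<longlongrightarrow> 0) (at_left 0)" by (simp add: tendsto_cong)
  ultimately show ?thesis by (simp add: filterlim_split_at_real)
qed

text \<open>In the variable s = 1/t one has d/dt = - s^2 d/ds, so P(s) exp (- s) becomes s^2 (P(s) -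
  P'(s)) exp (- s). The polynomial is a parameter of \<open>flat_exp\<close> so that the family is
  closed under differentiation.\<close>

lemma flat_exp_has_derivative:
  "(flat_exp p has_real_derivative flat_exp (monom 1 2 * (p - pderiv p)) t) (at t)"
proof (cases t "0::real" rule: linorder_cases)
  case less
  have "((\<lambda>_. 0) has_real_derivative 0) (at t)" by simp
  moreover have "eventually (\<lambda>s. flat_exp p s = 0) (nhds t)"
    using eventually_nhds_in_open[of "{..<0::real}" t] less
    by (auto elim!: eventually_mono simp: flat_exp_def)
  ultimately show ?thesis using less
    by (subst DERIV_cong_ev[OF refl _ refl]) (auto simp: flat_exp_def)
next
  case equal
  \<comment> \<open>Division by h multiplies the polynomial by s = 1/h, so the difference quotient
    at 0 is again in the family. At h = 0 both sides are 0, since division by zero gives 0.\<close>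
  have "(\<lambda>h. (flat_exp p (0 + h) - flat_exp p 0) / h) = flat_exp (pCons 0 p)"
    by (auto simp: flat_exp_def fun_eq_iff)
  then show ?thesis using flat_exp_tendsto_0[of "pCons 0 p"] equal
    by (simp add: DERIV_def) (simp add: flat_exp_def)
next
  case greater
  have "((\<lambda>s. poly p (1 / s) * exp (- (1 / s))) has_real_derivative
     flat_exp (monom 1 2 * (p - pderiv p)) t) (at t)"
    using greater
    by (auto intro!: derivative_eq_intros poly_DERIV[THEN DERIV_chain2]
        simp: flat_exp_def poly_monom field_simps power2_eq_square)
  moreover have "eventually (\<lambda>s. flat_exp p s = poly p (1 / s) * exp (- (1 / s))) (nhds t)"
    using eventually_nhds_in_open[of "{0::real<..}" t] greater
    by (auto elim!: eventually_mono simp: flat_exp_def)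
  ultimately show ?thesis 
    by (subst DERIV_cong_ev[OF refl _ refl]) auto
qed

lemma flat_exp_comp_has_derivative:
  "((\<lambda>x. flat_exp p (\<alpha> * x $ j + \<beta>)) has_derivative
    (\<lambda>v. flat_exp (monom 1 2 * (p - pderiv p)) (\<alpha> * x $ j + \<beta>) * (\<alpha> * v $ j))) (at (x::real^2))"
proof -
  have "((\<lambda>x. \<alpha> * x $ j + \<beta>) has_derivative (\<lambda>v. \<alpha> * v $ j)) (at x)"
    by (auto intro!: derivative_eq_intros bounded_linear.has_derivative[OF bounded_linear_vec_nth])
  from has_derivative_compose[OF this flat_exp_has_derivative[THEN has_field_derivative_imp_has_derivative]]
  show ?thesis by (simp add: mult_ac)
qed

lemma C_k_const: "C_k k (\<lambda>x. r)"
proof (induction k arbitrary: r)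
  case (Suc k)
  have "partial_d i (\<lambda>x. r) = (\<lambda>x. 0)" for i by (rule ext, subst partial_d_eq) auto
  with Suc show ?case by simp
qed simp

text \<open>Each partial derivative is a constant times another member of the family, hence the
  induction over an arbitrary polynomial.\<close>

lemma C_k_flat_exp_comp: "C_k k (\<lambda>x. flat_exp p (\<alpha> * x $ j + \<beta>))"
proof (induction k arbitrary: p)
  case 0
  have "(\<lambda>x::real^2. flat_exp p (\<alpha> * x $ j + \<beta>)) differentiable (at x)" for x
    unfolding differentiable_def by (intro exI, rule flat_exp_comp_has_derivative)
  then show ?case
    by (simp add: continuous_at_imp_continuous_on differentiable_imp_continuous_within)
next
  case (Suc k)
  have "partial_d i (\<lambda>x. flat_exp p (\<alpha> * x $ j + \<beta>)) =
    (\<lambda>x. flat_exp (monom 1 2 * (p - pderiv p)) (\<alpha> * x $ j + \<beta>) * (\<alpha> * (axis i 1 :: real^2) $ j))" for i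
    by (rule ext, subst partial_d_eq[OF flat_exp_comp_has_derivative]) simp
  moreover have "(\<lambda>x::real^2. flat_exp p (\<alpha> * x $ j + \<beta>)) differentiable (at x)" for x
    unfolding differentiable_def by (intro exI, rule flat_exp_comp_has_derivative)
  ultimately show ?case using Suc by (simp add: C_k_mult C_k_const)
qed

text \<open>Since \<open>exp (- 1 / (n * t)) \<longlonglongrightarrow> 1\<close> for \<open>t > 0\<close>, these functions increase to the indicator
  function of the box.\<close>

definition box_fun :: "real^2 \<Rightarrow> real^2 \<Rightarrow> nat \<Rightarrow> plane_fun" where
  "box_fun l u n x = flat_exp 1 (real n * x $ 1 + - real n * l $ 1) * flat_exp 1 (- real n * x $ 1 + real n * u $ 1) *
     (flat_exp 1 (real n * x $ 2 + - real n * l $ 2) * flat_exp 1 (- real n * x $ 2 + real n * u $ 2))"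

lemma flat_exp_1_bounds: "0 \<le> flat_exp 1 t" "flat_exp 1 t \<le> 1"
  by (auto simp: flat_exp_def)

lemma box_fun_bounds: "\<bar>box_fun l u n x\<bar> \<le> 1"
  unfolding box_fun_def abs_mult by (intro mult_le_one) (auto simp: flat_exp_1_bounds mult_le_one)

lemma box_fun_outside: "x \<notin> box l u \<Longrightarrow> box_fun l u n x = 0"
proof -
  assume "x \<notin> box l u"
  then obtain i where "x $ i \<le> l $ i \<or> u $ i \<le> x $ i" by (auto simp: mem_box_cart not_less)
  then have "real n * x $ i + - real n * l $ i \<le> 0 \<or> - real n * x $ i + real n * u $ i \<le> 0"
    by (auto simp: mult_left_mono)
  then show ?thesis using exhaust_2[of i] by (auto simp: box_fun_def flat_exp_def)
qed

lemma flat_exp_1_scale_tendsto: "t > 0 \<Longrightarrow> (\<lambda>n. flat_exp 1 (real n * t)) \<longlonglongrightarrow> 1"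
proof -
  assume t: "t > 0"
  have "(\<lambda>n. exp (- (1 / (real n * t)))) \<longlonglongrightarrow> 1" using t by real_asymp
  moreover have "eventually (\<lambda>n. flat_exp 1 (real n * t) = exp (- (1 / (real n * t)))) sequentially"
    using eventually_gt_at_top[of 0] by eventually_elim (use t in \<open>auto simp: flat_exp_def\<close>)
  ultimately show ?thesis by (simp add: tendsto_cong)
qed

lemma box_fun_tendsto: "(\<lambda>n. box_fun l u n x) \<longlonglongrightarrow> indicator (box l u) x"
proof (cases "x \<in> box l u")
  case True
  then have "\<forall>i. x $ i - l $ i > 0 \<and> u $ i - x $ i > 0" by (auto simp: mem_box_cart)
  then have "(\<lambda>n. flat_exp 1 (real n * (x $ 1 - l $ 1)) * flat_exp 1 (real n * (u $ 1 - x $ 1)) *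
     (flat_exp 1 (real n * (x $ 2 - l $ 2)) * flat_exp 1 (real n * (u $ 2 - x $ 2)))) \<longlonglongrightarrow> 1 * 1 * (1 * 1)"
    by (intro tendsto_mult flat_exp_1_scale_tendsto) auto
  then show ?thesis using True by (simp add: box_fun_def algebra_simps)
next
  case False then show ?thesis by (simp add: box_fun_outside)
qed

lemma test_funsD:
  assumes "\<phi> \<in> test_funs \<Omega>"
  shows "C_k k \<phi>" "compact (closure {x. \<phi> x \<noteq> 0})" "closure {x. \<phi> x \<noteq> 0} \<subseteq> \<Omega>"
  using assms by (auto simp: test_funs_def)

text \<open>The function lives on the open box, but its support is only known to lie in the closed
  one; hence the assumption on \<open>cbox\<close>.\<close>

lemma box_fun_test:
  assumes "cbox l u \<subseteq> \<Omega>"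
  shows "box_fun l u n \<in> test_funs \<Omega>"
proof -
  have "C_k k (box_fun l u n)" for k
    unfolding box_fun_def[abs_def] by (intro C_k_mult C_k_flat_exp_comp)
  moreover have "closure {x. box_fun l u n x \<noteq> 0} \<subseteq> cbox l u"
    using box_fun_outside[of _ l u n] box_subset_cbox[of l u] by (intro closure_minimal) auto
  moreover from this have "compact (closure {x. box_fun l u n x \<noteq> 0})"
    by (meson bounded_cbox bounded_subset compact_eq_bounded_closed closed_closure)
  ultimately show ?thesis using assms by (auto simp: test_funs_def)
qed

section \<open>The fundamental lemma of the calculus of variations\<close>

text \<open>The positive and the negative part of g are densities of two measures that agree on open
  boxes. These form an intersection-stable generator on which the measures are finite, so the
  measures agree, and so do the two parts almost everywhere.\<close>

lemma AE_zero_if_box_integrals_zero: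
  fixes g :: "'a::euclidean_space \<Rightarrow> real"
  assumes g: "integrable lborel g"
    and zero: "\<And>l u. (\<integral>x. indicator (box l u) x * g x \<partial>lborel) = 0"
  shows "AE x in lborel. g x = 0"
proof -
  have [measurable]: "g \<in> borel_measurable lborel" using g by auto
  have em: "emeasure (density lborel (\<lambda>x. ennreal (h x))) X = ennreal (\<integral>x. indicator X x * max 0 (h x) \<partial>lborel)"
    if "integrable lborel h" "X \<in> sets borel" for h :: "'a \<Rightarrow> real" and X
  proof -
    have [measurable]: "h \<in> borel_measurable lborel" using that by auto
    have "integrable lborel (\<lambda>x. max 0 (h x))" using that by auto
    from integrable_mult_indicator[OF _ this, of X]
    have "integrable lborel (\<lambda>x. indicator X x * max 0 (h x))" using that by auto
    then have "(\<integral>\<^sup>+x. ennreal (indicator X x * max 0 (h x)) \<partial>lborel) = ennreal (\<integral>x. indicator X x * max 0 (h x) \<partial>lborel)"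
      by (intro nn_integral_eq_integral) auto
    moreover have "emeasure (density lborel (\<lambda>x. ennreal (h x))) X = (\<integral>\<^sup>+x. ennreal (indicator X x * max 0 (h x)) \<partial>lborel)"
      using that by (subst emeasure_density)
        (auto intro!: nn_integral_cong simp: indicator_def max_def ennreal_neg)
    ultimately show ?thesis by simp
  qed
  \<comment> \<open>\<open>ennreal\<close> sends negative numbers to 0, so the two densities are the
    positive and the negative part of g.\<close>
  have "density lborel (\<lambda>x. ennreal (g x)) = density lborel (\<lambda>x. ennreal (- g x))"
  proof (rule measure_eqI_generator_eq[where E="range (\<lambda>(a, b). box a b)"
        and \<Omega>=UNIV and A="\<lambda>n::nat. box (- real n *\<^sub>R One) (real n *\<^sub>R One)"])
    show "Int_stable (range (\<lambda>(a, b). box a b :: 'a set))"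
      by (auto simp: Int_stable_def box_Int_box)
    show "(\<Union>i. box (- real i *\<^sub>R One) (real i *\<^sub>R One)) = (UNIV :: 'a set)"
      using UN_box_eq_UNIV by simp
    show "sets (density lborel (\<lambda>x. ennreal (g x))) = sigma_sets UNIV (range (\<lambda>(a, b). box a b :: 'a set))"
      "sets (density lborel (\<lambda>x. ennreal (- g x))) = sigma_sets UNIV (range (\<lambda>(a, b). box a b :: 'a set))"
      by (simp_all add: borel_eq_box)
  next
    fix X :: "'a set" assume "X \<in> range (\<lambda>(a, b). box a b)"
    then obtain a b where X: "X = box a b" by auto
    have i: "integrable lborel (\<lambda>x. indicator X x * max 0 (g x))" "integrable lborel (\<lambda>x. indicator X x * max 0 (- g x))"
      using integrable_mult_indicator[of X lborel "\<lambda>x. max 0 (g x)"]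
        integrable_mult_indicator[of X lborel "\<lambda>x. max 0 (- g x)"] g X by auto
    have "(\<integral>x. indicator X x * max 0 (g x) \<partial>lborel) - (\<integral>x. indicator X x * max 0 (- g x) \<partial>lborel)
       = (\<integral>x. indicator X x * g x \<partial>lborel)"
      by (subst Bochner_Integration.integral_diff[OF i, symmetric])
         (auto intro!: Bochner_Integration.integral_cong simp: max_def indicator_def)
    then show "emeasure (density lborel (\<lambda>x. ennreal (g x))) X = emeasure (density lborel (\<lambda>x. ennreal (- g x))) X"
      using g zero[of a b] X by (simp add: em)
  next
    fix n
    show "emeasure (density lborel (\<lambda>x. ennreal (g x))) (box (- real n *\<^sub>R One) (real n *\<^sub>R One)) \<noteq> \<infinity>"
      using g by (subst em) auto
  qed auto
  then have "AE x in lborel. ennreal (g x) = ennreal (- g x)"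
    by (subst (asm) sigma_finite_measure.density_unique_iff[OF sigma_finite_lborel]) auto
  then show ?thesis
  proof eventually_elim
    case (elim x)
    have "\<not> g x > 0" "\<not> g x < 0"
      using elim ennreal_neg[of "- g x"] ennreal_neg[of "g x"] ennreal_eq_0_iff[of "g x"] ennreal_eq_0_iff[of "- g x"]
      by auto
    then show ?case by simp
  qed
qed

lemma borel_measurable_C_k: "C_k k f \<Longrightarrow> f \<in> borel_measurable borel"
proof -
  have "C_k k f \<Longrightarrow> C_k 0 f" by (induction k) (use C_k_Suc_imp in blast)+
  then show "C_k k f \<Longrightarrow> f \<in> borel_measurable borel"
    by (simp add: borel_measurable_continuous_onI)
qed

text \<open>Dominated convergence along \<open>box_fun\<close> gives vanishing integrals over every
  open box whose closed box lies in \<Omega>. Since \<Omega> is a countable union of closed boxes,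
  it suffices to treat g cut off to one of them, whose boundary is a null set.\<close>

lemma fundamental_lemma:
  assumes "open \<Omega>" and g: "integrable lborel g"
    and zero: "\<And>\<phi>. \<phi> \<in> test_funs \<Omega> \<Longrightarrow> (\<integral>x. g x * \<phi> x \<partial>lborel) = 0"
  shows "AE x in lborel. x \<in> \<Omega> \<longrightarrow> g x = 0"
proof -
  have [measurable]: "g \<in> borel_measurable lborel" using g by auto
  have box0: "(\<integral>x. g x * indicator (box l u) x \<partial>lborel) = 0" if "cbox l u \<subseteq> \<Omega>" for l u
  proof -
    have test: "box_fun l u n \<in> test_funs \<Omega>" for n using box_fun_test[OF that] .
    have [measurable]: "box_fun l u n \<in> borel_measurable borel" for n
      using borel_measurable_C_k test_funsD(1)[OF test] by blast
    have "(\<lambda>n. \<integral>x. g x * box_fun l u n x \<partial>lborel) \<longlonglongrightarrow> (\<integral>x. g x * indicator (box l u) x \<partial>lborel)"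
    proof (rule integral_dominated_convergence[where w="\<lambda>x. \<bar>g x\<bar>"])
      show "AE x in lborel. (\<lambda>n. g x * box_fun l u n x) \<longlonglongrightarrow> g x * indicator (box l u) x"
        by (intro AE_I2 tendsto_intros box_fun_tendsto)
      show "AE x in lborel. norm (g x * box_fun l u n x) \<le> \<bar>g x\<bar>" for n
        by (intro AE_I2) (simp add: abs_mult mult_left_le box_fun_bounds)
    qed (use g in auto)
    then show ?thesis using zero[OF test] by (simp add: LIMSEQ_const_iff)
  qed
  obtain D where D: "countable D" "D \<subseteq> Pow \<Omega>" "\<And>X. X \<in> D \<Longrightarrow> \<exists>a b. X = cbox a b" "\<Union>D = \<Omega>"
    using open_countable_Union_open_cbox[OF \<open>open \<Omega>\<close>] by metis
  have "AE x in lborel. x \<in> X \<longrightarrow> g x = 0" if X: "X \<in> D" for X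
  proof -
    obtain a b where ab: "X = cbox a b" using D(3)[OF X] by auto
    have sub: "cbox a b \<subseteq> \<Omega>" using D(2) X ab by auto
    have "AE x in lborel. indicator (box a b) x * g x = 0"
    proof (rule AE_zero_if_box_integrals_zero)
      show "integrable lborel (\<lambda>x. indicator (box a b) x * g x)"
        using integrable_mult_indicator[OF _ g, of "box a b"] by simp
      fix l u :: "real^2"
      \<comment> \<open>The cut-off turns an arbitrary box into its intersection with
        \<open>box a b\<close>, again a box. Its closure is the closed box only if it is non-empty,
        whence the case distinction.\<close>
      obtain l' u' where lu: "box l u \<inter> box a b = box l' u'" using box_Int_box by blast
      have "(\<integral>x. g x * indicator (box l' u') x \<partial>lborel) = 0"
      proof (cases "box l' u' = {}")
        case False
        have "closure (box l' u') \<subseteq> closure (box a b)" using lu by (intro closure_mono) auto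
        also have "closure (box a b) \<subseteq> cbox a b" using box_subset_cbox[of a b] by (intro closure_minimal) auto
        finally show ?thesis using sub False by (intro box0) (simp add: closure_box)
      qed simp
      moreover have "(\<lambda>x. indicator (box l u) x * (indicator (box a b) x * g x)) = (\<lambda>x. g x * indicator (box l' u') x)"
        unfolding lu[symmetric] by (auto simp: indicator_def)
      ultimately show "(\<integral>x. indicator (box l u) x * (indicator (box a b) x * g x) \<partial>lborel) = 0"
        by simp
    qed
    moreover have "AE x in lborel. x \<notin> cbox a b - box a b"
      using AE_not_in[of "cbox a b - box a b" lborel] by (simp add: null_sets_def emeasure_lborel_cbox_eq emeasure_lborel_box_eq emeasure_Diff box_subset_cbox)
    ultimately show ?thesis by eventually_elim (auto simp: ab indicator_def)
  qed
  then have "AE x in lborel. \<forall>X\<in>D. x \<in> X \<longrightarrow> g x = 0"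
    using D(1) by (subst AE_ball_countable) auto
  then show ?thesis by eventually_elim (use D(4) in blast)
qed

section \<open>Continuity of translations in \<open>L\<^sup>1\<close>\<close>

lemma lborel_eq_distr_translate: "lborel = distr lborel lborel (\<lambda>x::'a::euclidean_space. x + v)"
proof -
  have "distr lborel lborel (\<lambda>x::'a. x + v) = distr lborel borel ((+) v)"
    by (intro distr_cong) auto
  then show ?thesis by (simp add: lborel_distr_plus)
qed

lemma nn_integral_lborel_translate:
  fixes v :: "'a::euclidean_space"
  assumes "f \<in> borel_measurable borel"
  shows "(\<integral>\<^sup>+x. f (x + v) \<partial>lborel) = (\<integral>\<^sup>+x. f x \<partial>lborel)"
  using nn_integral_distr[of "\<lambda>x. x + v" lborel lborel f] assms
  by (simp add: lborel_eq_distr_translate[symmetric])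

lemma integrable_lborel_translate:
  fixes v :: "'a::euclidean_space" and f :: "'a \<Rightarrow> real"
  assumes "integrable lborel f"
  shows "integrable lborel (\<lambda>x. f (x + v))"
  using integrable_distr_eq[of "\<lambda>x. x + v" lborel lborel f] assms
  by (simp add: lborel_eq_distr_translate[symmetric])

lemma integral_lborel_translate:
  fixes v :: "'a::euclidean_space" and f :: "'a \<Rightarrow> real"
  assumes "f \<in> borel_measurable borel"
  shows "(\<integral>x. f (x + v) \<partial>lborel) = (\<integral>x. f x \<partial>lborel)"
  using integral_distr[of "\<lambda>x. x + v" lborel lborel f] assms
  by (simp add: lborel_eq_distr_translate[symmetric])

text \<open>For an open set \<open>U\<close> of finite measure the indicators of the translates converge pointwise
  from below on \<open>U\<close>, and the part of the translate outside \<open>U\<close> has the same measure as the part of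
  \<open>U\<close> outside the translate.\<close>

lemma L1_translate_open:
  fixes s :: "nat \<Rightarrow> 'a::euclidean_space"
  assumes "open U" "emeasure lborel U < \<infinity>" "s \<longlonglongrightarrow> 0"
  shows "(\<lambda>n. \<integral>x. \<bar>indicat_real U (x + s n) - indicator U x\<bar> \<partial>lborel) \<longlonglongrightarrow> 0"
proof -
  have [measurable]: "U \<in> sets borel" using assms by auto
  have i: "integrable lborel (indicator U :: 'a \<Rightarrow> real)" using assms by simp
  have it: "integrable lborel (\<lambda>x. indicator U (x + v) :: real)" for v
    using integrable_lborel_translate[OF i] by simp
  have "(\<lambda>n. \<integral>x. max 0 (indicator U x - indicator U (x + s n) :: real) \<partial>lborel) \<longlonglongrightarrow> (\<integral>x. (0::real) \<partial>(lborel :: 'a measure))"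
  proof (rule integral_dominated_convergence[where w="indicator U"])
    show "AE x in lborel. (\<lambda>n. max 0 (indicator U x - indicator U (x + s n) :: real)) \<longlonglongrightarrow> 0"
    proof (intro AE_I2)
      fix x
      show "(\<lambda>n. max 0 (indicator U x - indicator U (x + s n) :: real)) \<longlonglongrightarrow> 0"
      proof (cases "x \<in> U")
        case True
        have "(\<lambda>n. x + s n) \<longlonglongrightarrow> x" using assms(3) by (auto intro!: tendsto_eq_intros)
        then have "eventually (\<lambda>n. x + s n \<in> U) sequentially" using True assms(1) by (simp add: topological_tendstoD)
        then have "eventually (\<lambda>n. max 0 (indicator U x - indicator U (x + s n) :: real) = 0) sequentially"
          by eventually_elim (auto simp: True)
        then show ?thesis by (simp add: tendsto_cong)
      qed (simp add: max_absorb1)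
    qed
  qed (use i in \<open>auto simp: indicator_def\<close>)
  then have lim: "(\<lambda>n. 2 * (\<integral>x. max 0 (indicator U x - indicator U (x + s n) :: real) \<partial>lborel)) \<longlonglongrightarrow> 0"
    by (auto intro: tendsto_mult_right_zero)
  have "(\<integral>x. \<bar>indicator U (x + v) - indicator U x\<bar> \<partial>lborel) = 2 * (\<integral>x. max 0 (indicator U x - indicator U (x + v) :: real) \<partial>lborel)" for v
  proof -
    have "(\<integral>x. \<bar>indicator U (x + v) - indicator U x\<bar> \<partial>lborel)
      = (\<integral>x. 2 * max 0 (indicator U x - indicator U (x + v) :: real) + (indicator U (x + v) - indicator U x) \<partial>lborel)"
      by (intro Bochner_Integration.integral_cong) (auto simp: max_def)
    also have "\<dots> = 2 * (\<integral>x. max 0 (indicator U x - indicator U (x + v) :: real) \<partial>lborel) +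
       ((\<integral>x. indicator U (x + v) \<partial>lborel) - (\<integral>x. indicator U x \<partial>lborel))"
      using i it[of v] by simp
    finally show ?thesis by (simp add: integral_lborel_translate[of "indicator U"])
  qed
  with lim show ?thesis by simp
qed

text \<open>The three-epsilon argument: translation preserves the distance between f and g, which
  therefore counts twice. It closes both the indicator case and the limit case of the induction
  below.\<close>

lemma L1_translate_approx:
  fixes f :: "'a::euclidean_space \<Rightarrow> real" and s :: "nat \<Rightarrow> 'a"
  assumes f: "integrable lborel f"
    and approx: "\<And>e. e > 0 \<Longrightarrow> \<exists>g. integrable lborel g \<and> (\<integral>x. \<bar>f x - g x\<bar> \<partial>lborel) \<le> e \<and>
        (\<lambda>n. \<integral>x. \<bar>g (x + s n) - g x\<bar> \<partial>lborel) \<longlonglongrightarrow> 0"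
  shows "(\<lambda>n. \<integral>x. \<bar>f (x + s n) - f x\<bar> \<partial>lborel) \<longlonglongrightarrow> 0"
proof (rule LIMSEQ_I)
  fix r :: real assume "r > 0"
  then obtain g where g: "integrable lborel g" "(\<integral>x. \<bar>f x - g x\<bar> \<partial>lborel) \<le> r / 3"
    "(\<lambda>n. \<integral>x. \<bar>g (x + s n) - g x\<bar> \<partial>lborel) \<longlonglongrightarrow> 0"
    using approx[of "r / 3"] by auto
  obtain N where N: "\<And>n. n \<ge> N \<Longrightarrow> \<bar>\<integral>x. \<bar>g (x + s n) - g x\<bar> \<partial>lborel\<bar> < r / 3"
    using LIMSEQ_D[OF g(3), of "r / 3"] \<open>r > 0\<close> by auto
  have [measurable]: "f \<in> borel_measurable borel" "g \<in> borel_measurable borel"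
    using f g(1) borel_measurable_integrable by force+
  have i: "integrable lborel (\<lambda>x. \<bar>f x - g x\<bar>)" using f g(1) by auto
  have "norm ((\<integral>x. \<bar>f (x + s n) - f x\<bar> \<partial>lborel) - 0) < r" if "n \<ge> N" for n
  proof -
    note it = integrable_lborel_translate[OF f, of "s n"] integrable_lborel_translate[OF g(1), of "s n"]
      integrable_lborel_translate[OF i, of "s n"]
    have "(\<integral>x. \<bar>f (x + s n) - f x\<bar> \<partial>lborel) \<le>
       (\<integral>x. \<bar>f (x + s n) - g (x + s n)\<bar> + \<bar>g (x + s n) - g x\<bar> + \<bar>f x - g x\<bar> \<partial>lborel)"
      using it i f g(1) by (intro integral_mono) auto
    also have "\<dots> = (\<integral>x. \<bar>f (x + s n) - g (x + s n)\<bar> \<partial>lborel) + (\<integral>x. \<bar>g (x + s n) - g x\<bar> \<partial>lborel) + (\<integral>x. \<bar>f x - g x\<bar> \<partial>lborel)"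
      using it i g(1) by simp
    also have "(\<integral>x. \<bar>f (x + s n) - g (x + s n)\<bar> \<partial>lborel) = (\<integral>x. \<bar>f x - g x\<bar> \<partial>lborel)"
      by (rule integral_lborel_translate[of "\<lambda>x. \<bar>f x - g x\<bar>"]) auto
    finally show ?thesis using N[OF that] g(2) by simp
  qed
  then show "\<exists>no. \<forall>n\<ge>no. norm ((\<integral>x. \<bar>f (x + s n) - f x\<bar> \<partial>lborel) - 0) < r" by blast
qed

text \<open>Induction over integrable functions. By outer regularity the indicator of a set of
  finite measure is close in L^1 to that of an open set of finite measure, for which the claim is
  known; sums use the triangle inequality and limits use approximation.\<close>

lemma L1_translate_tendsto:
  fixes f :: "'a::euclidean_space \<Rightarrow> real" and s :: "nat \<Rightarrow> 'a"
  assumes f: "integrable lborel f" and s: "s \<longlonglongrightarrow> 0"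
  shows "(\<lambda>n. \<integral>x. \<bar>f (x + s n) - f x\<bar> \<partial>lborel) \<longlonglongrightarrow> 0"
  using f
proof (induction rule: integrable_induct)
  case (base A c)
  then have [measurable]: "A \<in> sets borel" by simp
  show ?case
  proof (rule L1_translate_approx)
    fix e :: real assume "e > 0"
    \<comment> \<open>The summand 1 covers the case c = 0.\<close>
    then have "e / (\<bar>c\<bar> + 1) > 0" by simp
    then obtain U where U: "open U" "A \<subseteq> U" "emeasure lborel (U - A) < e / (\<bar>c\<bar> + 1)"
      using outer_regular_lborel[of A "e / (\<bar>c\<bar> + 1)"] by auto
    then have [measurable]: "U \<in> sets borel" by auto
    have "emeasure lborel U = emeasure lborel A + emeasure lborel (U - A)"
      using U(2) by (subst plus_emeasure) (auto simp: Un_absorb1)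
    also have "\<dots> < \<infinity>" using base(2) order.strict_trans[OF U(3) ennreal_less_top] by simp
    finally have fin: "emeasure lborel U < \<infinity>" .
    have "measure lborel (U - A) \<le> e / (\<bar>c\<bar> + 1)"
      using U(3) \<open>e > 0\<close> by (auto simp: measure_def intro!: enn2real_leI)
    moreover have "(\<integral>x. \<bar>indicator A x *\<^sub>R c - indicator U x *\<^sub>R c\<bar> \<partial>lborel) = (\<integral>x. \<bar>c\<bar> * indicator (U - A) x \<partial>lborel)"
      using U(2) by (intro Bochner_Integration.integral_cong) (auto simp: indicator_def)
    ultimately have "(\<integral>x. \<bar>indicator A x *\<^sub>R c - indicator U x *\<^sub>R c\<bar> \<partial>lborel) \<le> \<bar>c\<bar> * (e / (\<bar>c\<bar> + 1))"
      by (simp add: mult_left_mono del: times_divide_eq_right)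
    also have "\<dots> \<le> e" using \<open>e > 0\<close> by (simp add: field_simps)
    finally have 1: "(\<integral>x. \<bar>indicator A x *\<^sub>R c - indicator U x *\<^sub>R c\<bar> \<partial>lborel) \<le> e" .
    have "(\<lambda>n. \<bar>c\<bar> * (\<integral>x. \<bar>indicator U (x + s n) - indicator U x\<bar> \<partial>lborel)) \<longlonglongrightarrow> 0"
      using tendsto_mult_right_zero[OF L1_translate_open[OF U(1) fin s]] .
    moreover have "(\<integral>x. \<bar>indicator U (x + s n) *\<^sub>R c - indicator U x *\<^sub>R c\<bar> \<partial>lborel) =
      \<bar>c\<bar> * (\<integral>x. \<bar>indicator U (x + s n) - indicator U x\<bar> \<partial>lborel)" for n
      by (subst integral_mult_right_zero[symmetric], intro Bochner_Integration.integral_cong)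
         (auto simp: indicator_def)
    ultimately have 2: "(\<lambda>n. \<integral>x. \<bar>indicator U (x + s n) *\<^sub>R c - indicator U x *\<^sub>R c\<bar> \<partial>lborel) \<longlonglongrightarrow> 0" by simp
    have 3: "integrable lborel (\<lambda>x. indicator U x *\<^sub>R c)" using fin by simp
    show "\<exists>g. integrable lborel g \<and> (\<integral>x. \<bar>indicator A x *\<^sub>R c - g x\<bar> \<partial>lborel) \<le> e \<and>
        (\<lambda>n. \<integral>x. \<bar>g (x + s n) - g x\<bar> \<partial>lborel) \<longlonglongrightarrow> 0"
      using 1 2 3 by blast
  qed (use base in simp)
next
  case (add f g)
  show ?case
  proof (rule tendsto_sandwich[OF _ _ tendsto_const])
    show "(\<lambda>n. (\<integral>x. \<bar>f (x + s n) - f x\<bar> \<partial>lborel) + (\<integral>x. \<bar>g (x + s n) - g x\<bar> \<partial>lborel)) \<longlonglongrightarrow> 0"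
      using tendsto_add[OF add(3,4)] by simp
    have "(\<integral>x. \<bar>f (x + s n) + g (x + s n) - (f x + g x)\<bar> \<partial>lborel) \<le>
      (\<integral>x. \<bar>f (x + s n) - f x\<bar> \<partial>lborel) + (\<integral>x. \<bar>g (x + s n) - g x\<bar> \<partial>lborel)" for n
    proof -
      note i = add(1,2) integrable_lborel_translate[OF add(1), of "s n"] integrable_lborel_translate[OF add(2), of "s n"]
      have "(\<integral>x. \<bar>f (x + s n) + g (x + s n) - (f x + g x)\<bar> \<partial>lborel) \<le>
        (\<integral>x. \<bar>f (x + s n) - f x\<bar> + \<bar>g (x + s n) - g x\<bar> \<partial>lborel)"
        using i by (intro integral_mono) auto
      also have "\<dots> = (\<integral>x. \<bar>f (x + s n) - f x\<bar> \<partial>lborel) + (\<integral>x. \<bar>g (x + s n) - g x\<bar> \<partial>lborel)"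
        using i by simp
      finally show ?thesis .
    qed
    then show "\<forall>\<^sub>F n in sequentially. (\<integral>x. \<bar>f (x + s n) + g (x + s n) - (f x + g x)\<bar> \<partial>lborel) \<le>
      (\<integral>x. \<bar>f (x + s n) - f x\<bar> \<partial>lborel) + (\<integral>x. \<bar>g (x + s n) - g x\<bar> \<partial>lborel)" by simp
  qed auto
next
  case (lim f F)
  show ?case
  proof (rule L1_translate_approx)
    fix e :: real assume "e > 0"
    have "(\<lambda>i. \<integral>x. \<bar>f x - F i x\<bar> \<partial>lborel) \<longlonglongrightarrow> (\<integral>x. (0::real) \<partial>(lborel :: 'a measure))"
    \<comment> \<open>The induction rule supplies approximations bounded by twice \<bar>f\<bar>,
      hence the factor 3.\<close>
    proof (rule integral_dominated_convergence[where w="\<lambda>x. 3 * \<bar>f x\<bar>"])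
      show "AE x in lborel. (\<lambda>i. \<bar>f x - F i x\<bar>) \<longlonglongrightarrow> 0"
      proof (rule AE_I2)
        fix x
        have "(\<lambda>i. \<bar>f x - F i x\<bar>) \<longlonglongrightarrow> \<bar>f x - f x\<bar>" by (intro tendsto_intros lim(2)) simp
        then show "(\<lambda>i. \<bar>f x - F i x\<bar>) \<longlonglongrightarrow> 0" by simp
      qed
      show "AE x in lborel. norm \<bar>f x - F i x\<bar> \<le> 3 * \<bar>f x\<bar>" for i
      proof (rule AE_I2)
        fix x
        have "\<bar>F i x\<bar> \<le> 2 * \<bar>f x\<bar>" using lim(3)[of x i] by simp
        then show "norm \<bar>f x - F i x\<bar> \<le> 3 * \<bar>f x\<bar>" by simp
      qed
    qed (use lim in auto)
    then obtain i where "(\<integral>x. \<bar>f x - F i x\<bar> \<partial>lborel) < e"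
      using LIMSEQ_D[of _ 0 e] \<open>e > 0\<close> by fastforce
    then show "\<exists>g. integrable lborel g \<and> (\<integral>x. \<bar>f x - g x\<bar> \<partial>lborel) \<le> e \<and>
        (\<lambda>n. \<integral>x. \<bar>g (x + s n) - g x\<bar> \<partial>lborel) \<longlonglongrightarrow> 0"
      using lim(1,5) by (intro exI[of _ "F i"]) auto
  qed fact
qed

section \<open>The chain rule for weak derivatives\<close>

lemma test_funs_zero: "\<phi> \<in> test_funs \<Omega> \<Longrightarrow> x \<notin> closure {x. \<phi> x \<noteq> 0} \<Longrightarrow> \<phi> x = 0"
  using closure_subset[of "{x. \<phi> x \<noteq> 0}"] by auto

lemma test_funs_measurable: "\<phi> \<in> test_funs \<Omega> \<Longrightarrow> \<phi> \<in> borel_measurable borel"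
  using test_funsD(1)[of \<phi> \<Omega> 0] borel_measurable_C_k[of 0 \<phi>] by simp

lemma test_funs_bounded:
  assumes "\<phi> \<in> test_funs \<Omega>"
  obtains B where "B > 0" "\<And>x. \<bar>\<phi> x\<bar> \<le> B"
proof -
  let ?K = "closure {x. \<phi> x \<noteq> 0}"
  have "continuous_on UNIV \<phi>" using test_funsD(1)[OF assms, of 0] by simp
  then have "compact (\<phi> ` ?K)"
    using test_funsD(2)[OF assms] by (meson compact_continuous_image continuous_on_subset subset_UNIV)
  then obtain B where B: "B > 0" "\<forall>y\<in>\<phi> ` ?K. norm y \<le> B"
    using compact_imp_bounded bounded_pos by blast
  have "\<bar>\<phi> x\<bar> \<le> B" for x
    using B test_funs_zero[OF assms, of x] by (cases "x \<in> ?K") auto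
  with B(1) show ?thesis by (rule that)
qed

lemma integrable_mult_bounded:
  fixes f k :: "'a \<Rightarrow> real"
  assumes f: "integrable M f" and k: "k \<in> borel_measurable M" "\<And>x. \<bar>k x\<bar> \<le> B"
  shows "integrable M (\<lambda>x. f x * k x)"
proof (rule Bochner_Integration.integrable_bound)
  show "integrable M (\<lambda>x. B * f x)" using f by simp
  show "(\<lambda>x. f x * k x) \<in> borel_measurable M" using f k by measurable
  have "\<bar>f x * k x\<bar> \<le> \<bar>B * f x\<bar>" for x
    using mult_right_mono[OF order_trans[OF k(2) abs_ge_self], of "\<bar>f x\<bar>"] by (simp add: abs_mult mult.commute)
  then show "AE x in M. norm (f x * k x) \<le> norm (B * f x)" by simp
qed

lemma test_funs_integrable:
  assumes "\<phi> \<in> test_funs \<Omega>"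
  shows "integrable lborel \<phi>"
proof -
  let ?K = "closure {x. \<phi> x \<noteq> 0}"
  obtain B where B: "\<And>x. \<bar>\<phi> x\<bar> \<le> B" using test_funs_bounded[OF assms] by auto
  have [measurable]: "\<phi> \<in> borel_measurable borel" by (rule test_funs_measurable[OF assms])
  have "emeasure lborel ?K < \<infinity>"
    using test_funsD(2)[OF assms] emeasure_bounded_finite compact_imp_bounded by blast
  then have "integrable lborel (\<lambda>x. B * indicator ?K x)" by simp
  then show ?thesis
  proof (rule Bochner_Integration.integrable_bound)
    show "AE x in lborel. norm (\<phi> x) \<le> norm (B * indicator ?K x)"
    proof (rule AE_I2)
      fix x
      show "norm (\<phi> x) \<le> norm (B * indicator ?K x)"
        using order_trans[OF B abs_ge_self] test_funs_zero[OF assms, of x]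
        by (cases "x \<in> ?K") auto
    qed
  qed simp
qed

lemma test_funs_partial_d:
  assumes "\<phi> \<in> test_funs \<Omega>"
  shows "partial_d i \<phi> \<in> test_funs \<Omega>"
proof -
  let ?K = "closure {x. \<phi> x \<noteq> 0}"
  have "C_k k (partial_d i \<phi>)" for k using test_funsD(1)[OF assms, of "Suc k"] by simp
  moreover have "partial_d i \<phi> x = 0" if "x \<notin> ?K" for x
  proof -
    have "((\<lambda>_. 0) has_derivative (\<lambda>_. 0)) (at x)" by simp
    then have "(\<phi> has_derivative (\<lambda>_. 0)) (at x)"
    proof (rule has_derivative_transform_within_open)
      show "open (- ?K)" "x \<in> - ?K" using that by auto
      show "0 = \<phi> y" if "y \<in> - ?K" for y using test_funs_zero[OF assms, of y] that by simp
    qed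
    from partial_d_eq[OF this] show ?thesis .
  qed
  then have sub: "closure {x. partial_d i \<phi> x \<noteq> 0} \<subseteq> ?K"
    by (intro closure_minimal) auto
  moreover have "compact (closure {x. partial_d i \<phi> x \<noteq> 0})"
    using sub test_funsD(2)[OF assms] by (meson compact_eq_bounded_closed bounded_subset closed_closure)
  ultimately show ?thesis using test_funsD(3)[OF assms] by (auto simp: test_funs_def)
qed

lemma test_funs_translate:
  assumes \<phi>: "\<phi> \<in> test_funs \<Omega>'" and sub: "\<And>y. y \<in> \<Omega>' \<Longrightarrow> y - v \<in> \<Omega>"
  shows "(\<lambda>x. \<phi> (x + v)) \<in> test_funs \<Omega>"
proof -
  let ?K = "closure {x. \<phi> x \<noteq> 0}"
  have "{x. \<phi> (x + v) \<noteq> 0} = (\<lambda>x. - v + x) ` {x. \<phi> x \<noteq> 0}"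
    by (auto simp: image_iff intro!: exI[of _ "_ + v"])
  then have K: "closure {x. \<phi> (x + v) \<noteq> 0} = (\<lambda>x. - v + x) ` ?K"
    by (simp only: closure_translation)
  have "compact ((\<lambda>x. - v + x) ` ?K)" using test_funsD(2)[OF \<phi>] by (rule compact_translation)
  moreover have "(\<lambda>x. - v + x) ` ?K \<subseteq> \<Omega>" using test_funsD(3)[OF \<phi>] sub by auto
  ultimately show ?thesis
    unfolding test_funs_def mem_Collect_eq K using test_funsD(1)[OF \<phi>] C_k_translate by auto
qed

text \<open>Fubini over the plane and the interval [0, h]: a bound on the inner integral that is
  uniform in t makes the product integrable. The hypothesis \<open>fin\<close> covers both uses, w
  bounded with k integrable and w integrable with k bounded; the next two lemmas supply it.\<close>

lemma translate_integral_swap: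
  fixes w k :: "'a::euclidean_space \<Rightarrow> real"
  assumes [measurable]: "w \<in> borel_measurable borel" "k \<in> borel_measurable borel"
    and fin: "\<And>t. (\<integral>\<^sup>+x. ennreal \<bar>w x * k (x + t *\<^sub>R v)\<bar> \<partial>lborel) \<le> ennreal C"
    and h: "0 \<le> h"
  shows "integrable lborel (\<lambda>x. w x * (\<integral>t. indicator {0..h} t * k (x + t *\<^sub>R v) \<partial>lborel))"
    and "integrable lborel (\<lambda>t. indicator {0..h} t * (\<integral>x. w x * k (x + t *\<^sub>R v) \<partial>lborel))"
    and "(\<integral>x. w x * (\<integral>t. indicator {0..h} t * k (x + t *\<^sub>R v) \<partial>lborel) \<partial>lborel) =
      (\<integral>t. indicator {0..h} t * (\<integral>x. w x * k (x + t *\<^sub>R v) \<partial>lborel) \<partial>lborel)"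
proof -
  let ?f = "\<lambda>x t. w x * (indicator {0..h} t * k (x + t *\<^sub>R v))"
  have int: "integrable (lborel \<Otimes>\<^sub>M lborel) (case_prod ?f)"
    unfolding integrable_iff_bounded
  proof
    have "(\<integral>\<^sup>+z. ennreal (norm (case_prod ?f z)) \<partial>(lborel \<Otimes>\<^sub>M lborel)) =
      (\<integral>\<^sup>+t. \<integral>\<^sup>+x. ennreal (norm (?f x t)) \<partial>lborel \<partial>lborel)"
      by (subst lborel_pair.nn_integral_snd[symmetric]) auto
    also have "\<dots> = (\<integral>\<^sup>+t. indicator {0..h} t * (\<integral>\<^sup>+x. ennreal \<bar>w x * k (x + t *\<^sub>R v)\<bar> \<partial>lborel) \<partial>lborel)"
      by (intro nn_integral_cong) (auto simp: indicator_def)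
    also have "\<dots> \<le> (\<integral>\<^sup>+t. ennreal C * indicator {0..h} t \<partial>lborel)"
      using fin by (intro nn_integral_mono) (auto simp: indicator_def)
    also have "\<dots> < \<infinity>" using h by (simp add: nn_integral_cmult ennreal_mult_less_top)
    finally show "(\<integral>\<^sup>+z. ennreal (norm (case_prod ?f z)) \<partial>(lborel \<Otimes>\<^sub>M lborel)) < \<infinity>" .
  qed measurable
  have eq: "(\<integral>x. ?f x t \<partial>lborel) = indicator {0..h} t * (\<integral>x. w x * k (x + t *\<^sub>R v) \<partial>lborel)" for t
    by (subst integral_mult_right_zero[symmetric]) (simp add: mult_ac)
  show "integrable lborel (\<lambda>x. w x * (\<integral>t. indicator {0..h} t * k (x + t *\<^sub>R v) \<partial>lborel))"
    using lborel_pair.integrable_fst[OF int] by simp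
  show "integrable lborel (\<lambda>t. indicator {0..h} t * (\<integral>x. w x * k (x + t *\<^sub>R v) \<partial>lborel))"
    using lborel_pair.integrable_snd[OF int] unfolding eq .
  show "(\<integral>x. w x * (\<integral>t. indicator {0..h} t * k (x + t *\<^sub>R v) \<partial>lborel) \<partial>lborel) =
      (\<integral>t. indicator {0..h} t * (\<integral>x. w x * k (x + t *\<^sub>R v) \<partial>lborel) \<partial>lborel)"
    using lborel_pair.Fubini_integral[OF int] unfolding eq by simp
qed

lemma nn_integral_translate_bounded1:
  fixes w k :: "'a::euclidean_space \<Rightarrow> real"
  assumes [measurable]: "w \<in> borel_measurable borel" and k: "integrable lborel k" and B: "B \<ge> 0" "\<And>x. \<bar>w x\<bar> \<le> B"
  shows "(\<integral>\<^sup>+x. ennreal \<bar>w x * k (x + v)\<bar> \<partial>lborel) \<le> ennreal (B * (\<integral>x. \<bar>k x\<bar> \<partial>lborel))"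
proof -
  have [measurable]: "k \<in> borel_measurable borel" using k by auto
  have "(\<integral>\<^sup>+x. ennreal \<bar>w x * k (x + v)\<bar> \<partial>lborel) \<le> (\<integral>\<^sup>+x. ennreal B * ennreal \<bar>k (x + v)\<bar> \<partial>lborel)"
    using B by (intro nn_integral_mono) (auto simp: abs_mult ennreal_mult[symmetric] intro!: ennreal_leI mult_right_mono)
  also have "\<dots> = ennreal B * (\<integral>\<^sup>+x. ennreal \<bar>k x\<bar> \<partial>lborel)"
    by (simp add: nn_integral_cmult nn_integral_lborel_translate[of "\<lambda>x. ennreal \<bar>k x\<bar>"])
  also have "\<dots> = ennreal (B * (\<integral>x. \<bar>k x\<bar> \<partial>lborel))"
    using k B by (subst nn_integral_eq_integral) (auto simp: ennreal_mult)
  finally show ?thesis .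
qed

lemma nn_integral_translate_bounded2:
  fixes w k :: "'a::euclidean_space \<Rightarrow> real"
  assumes w: "integrable lborel w" and [measurable]: "k \<in> borel_measurable borel" and B: "B \<ge> 0" "\<And>x. \<bar>k x\<bar> \<le> B"
  shows "(\<integral>\<^sup>+x. ennreal \<bar>w x * k (x + v)\<bar> \<partial>lborel) \<le> ennreal (B * (\<integral>x. \<bar>w x\<bar> \<partial>lborel))"
  \<comment> \<open>The roles are exchanged: the translated factor is now the bounded one, and the
    integrable one is shifted by 0.\<close>
  using nn_integral_translate_bounded1[of "\<lambda>x. k (x + v)" w B 0] assms by (simp add: mult.commute)

lemma test_fun_increment:
  assumes \<psi>: "\<psi> \<in> test_funs \<Omega>" and h: "0 \<le> h"
  shows "\<psi> (x + h *\<^sub>R axis i 1) - \<psi> x = (\<integral>t. indicator {0..h} t * partial_d i \<psi> (x + t *\<^sub>R axis i 1) \<partial>lborel)"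
proof -
  let ?e = "axis i 1 :: real^2"
  have d: "\<psi> differentiable (at y)" for y using test_funsD(1)[OF \<psi>, of 1] by (simp add: One_nat_def)
  have "((\<lambda>t. \<psi> (x + t *\<^sub>R ?e)) has_real_derivative partial_d i \<psi> (x + t *\<^sub>R ?e)) (at t)" for t
  proof -
    have 1: "((\<lambda>t. x + t *\<^sub>R ?e) has_derivative (\<lambda>s. s *\<^sub>R ?e)) (at t)"
      by (auto intro!: derivative_eq_intros)
    have 2: "(\<psi> has_derivative frechet_derivative \<psi> (at (x + t *\<^sub>R ?e))) (at (x + t *\<^sub>R ?e))"
      using d frechet_derivative_works by blast
    from has_derivative_compose[OF 1 2] show ?thesis
      unfolding has_field_derivative_def partial_d_def
      using linear_frechet_derivative[OF d[of "x + t *\<^sub>R ?e"]]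
      by (simp add: linear_cmul mult.commute[of _ "frechet_derivative _ _ _"] fun_eq_iff linear_scale)
  qed
  moreover have "continuous_on UNIV (partial_d i \<psi>)"
    using test_funsD(1)[OF test_funs_partial_d[OF \<psi>], of 0] by simp
  then have "isCont (\<lambda>t. partial_d i \<psi> (x + t *\<^sub>R ?e)) t" for t
    by (intro continuous_at_compose[unfolded o_def, of t "\<lambda>t. x + t *\<^sub>R ?e" "partial_d i \<psi>"])
       (auto simp: continuous_on_eq_continuous_at intro!: continuous_intros)
  ultimately have "(\<integral>t. partial_d i \<psi> (x + t *\<^sub>R ?e) * indicator {0..h} t \<partial>lborel) = \<psi> (x + h *\<^sub>R ?e) - \<psi> (x + 0 *\<^sub>R ?e)"
    using h by (intro integral_FTC_Icc_real) auto
  then show ?thesis by (simp add: mult.commute)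
qed

text \<open>Against a test function on \<Omega>', the shift of u is moved to the test function,
  whose increment is an integral of its derivative. For each t the weak derivative can be used,
  because the translated test function still has its support in \<Omega>; a second exchange of
  integrals puts the translation on g. The smaller set \<Omega>' leaves room for shifts up to
  h.\<close>

lemma weak_increment:
  fixes u g :: plane_fun
  assumes "open \<Omega>'" and u: "integrable lborel u" and g: "integrable lborel g"
    and weak: "\<And>\<phi>. \<phi> \<in> test_funs \<Omega> \<Longrightarrow> (\<integral>x. u x * partial_d i \<phi> x \<partial>lborel) = - (\<integral>x. g x * \<phi> x \<partial>lborel)"
    and sub: "\<And>y t. y \<in> \<Omega>' \<Longrightarrow> 0 \<le> t \<Longrightarrow> t \<le> h \<Longrightarrow> y - t *\<^sub>R axis i 1 \<in> \<Omega>" and h: "0 \<le> h"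
  shows "AE x in lborel. x \<in> \<Omega>' \<longrightarrow> u (x - h *\<^sub>R axis i 1) - u x =
    - (\<integral>t. indicator {0..h} t * g (x + t *\<^sub>R (- axis i 1)) \<partial>lborel)"
proof -
  let ?e = "axis i 1 :: real^2"
  let ?G = "\<lambda>x. \<integral>t. indicator {0..h} t * g (x + t *\<^sub>R (- ?e)) \<partial>lborel"
  have [measurable]: "u \<in> borel_measurable borel" "g \<in> borel_measurable borel"
    using u g by auto
  have uh: "integrable lborel (\<lambda>x. u (x + (- h *\<^sub>R ?e)))" using integrable_lborel_translate[OF u] .
  have G: "integrable lborel ?G"
    using translate_integral_swap(1)[OF _ _ nn_integral_translate_bounded1[OF _ g, of "\<lambda>_. 1" 1] h, where v="- ?e"]
    by simp
  have "AE x in lborel. x \<in> \<Omega>' \<longrightarrow> u (x + (- h *\<^sub>R ?e)) - u x + ?G x = 0"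
  proof (rule fundamental_lemma[OF \<open>open \<Omega>'\<close>])
    show "integrable lborel (\<lambda>x. u (x + (- h *\<^sub>R ?e)) - u x + ?G x)" by (intro Bochner_Integration.integrable_add Bochner_Integration.integrable_diff uh u G)
    fix \<psi> assume \<psi>: "\<psi> \<in> test_funs \<Omega>'"
    have [measurable]: "\<psi> \<in> borel_measurable borel" "partial_d i \<psi> \<in> borel_measurable borel"
      using test_funs_measurable[OF \<psi>] test_funs_measurable[OF test_funs_partial_d[OF \<psi>]] by auto
    obtain B where B: "B > 0" "\<And>x. \<bar>\<psi> x\<bar> \<le> B" using test_funs_bounded[OF \<psi>] by blast
    obtain B' where B': "B' > 0" "\<And>x. \<bar>partial_d i \<psi> x\<bar> \<le> B'" using test_funs_bounded[OF test_funs_partial_d[OF \<psi>]] by blast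
    have bi: "integrable lborel (\<lambda>x. f x * \<psi> (x + v))" if "integrable lborel f" for f :: plane_fun and v
      using that B(2) by (intro integrable_mult_bounded[where B=B]) auto
    note bi0 = bi[where v=0, simplified]
    have "(\<integral>x. (u (x + (- h *\<^sub>R ?e)) - u x) * \<psi> x \<partial>lborel) =
      (\<integral>x. u (x + (- h *\<^sub>R ?e)) * \<psi> x \<partial>lborel) - (\<integral>x. u x * \<psi> x \<partial>lborel)"
      using bi0[OF uh] bi0[OF u] by (simp add: left_diff_distrib)
    \<comment> \<open>Substitution x + h e for x: a backward shift of u is a forward shift of the
      test function.\<close>
    also have "(\<integral>x. u (x + (- h *\<^sub>R ?e)) * \<psi> x \<partial>lborel) = (\<integral>x. u x * \<psi> (x + h *\<^sub>R ?e) \<partial>lborel)"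
      using integral_lborel_translate[of "\<lambda>x. u (x + (- h *\<^sub>R ?e)) * \<psi> x" "h *\<^sub>R ?e"] by simp
    also have "\<dots> - (\<integral>x. u x * \<psi> x \<partial>lborel) = (\<integral>x. u x * (\<psi> (x + h *\<^sub>R ?e) - \<psi> x) \<partial>lborel)"
      using bi[OF u] bi0[OF u] by (simp add: right_diff_distrib)
    also have "\<dots> = (\<integral>x. u x * (\<integral>t. indicator {0..h} t * partial_d i \<psi> (x + t *\<^sub>R ?e) \<partial>lborel) \<partial>lborel)"
      by (simp add: test_fun_increment[OF \<psi> h])
    also have "\<dots> = (\<integral>t. indicator {0..h} t * (\<integral>x. u x * partial_d i \<psi> (x + t *\<^sub>R ?e) \<partial>lborel) \<partial>lborel)"
      using B' by (intro translate_integral_swap(3)[OF _ _ nn_integral_translate_bounded2[OF u, where B=B'] h]) auto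
    \<comment> \<open>The weak derivative is available only for t in [0, h], where
      \<open>sub\<close> keeps the support inside \<Omega>; elsewhere the indicator kills both
      sides.\<close>
    also have "\<dots> = (\<integral>t. indicator {0..h} t * (- (\<integral>x. \<psi> x * g (x + t *\<^sub>R (- ?e)) \<partial>lborel)) \<partial>lborel)"
    proof (rule Bochner_Integration.integral_cong[OF refl])
      fix t
      show "indicator {0..h} t * (\<integral>x. u x * partial_d i \<psi> (x + t *\<^sub>R ?e) \<partial>lborel) =
        indicator {0..h} t * (- (\<integral>x. \<psi> x * g (x + t *\<^sub>R (- ?e)) \<partial>lborel))"
      proof (cases "t \<in> {0..h}")
        case True
        have test: "(\<lambda>x. \<psi> (x + t *\<^sub>R ?e)) \<in> test_funs \<Omega>"
          using test_funs_translate[OF \<psi>] sub True by auto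
        have "(\<integral>x. u x * partial_d i \<psi> (x + t *\<^sub>R ?e) \<partial>lborel) = - (\<integral>x. g x * \<psi> (x + t *\<^sub>R ?e) \<partial>lborel)"
          using weak[OF test] partial_d_translate[OF test_funsD(1)[OF \<psi>], of i "t *\<^sub>R ?e"] by simp
        also have "(\<integral>x. g x * \<psi> (x + t *\<^sub>R ?e) \<partial>lborel) = (\<integral>x. \<psi> x * g (x + t *\<^sub>R (- ?e)) \<partial>lborel)"
          using integral_lborel_translate[of "\<lambda>x. \<psi> x * g (x + t *\<^sub>R (- ?e))" "t *\<^sub>R ?e"] by (simp add: mult.commute)
        finally show ?thesis by simp
      qed simp
    qed
    also have "\<dots> = - (\<integral>x. \<psi> x * ?G x \<partial>lborel)"
      using B by (subst translate_integral_swap(3)[OF _ _ nn_integral_translate_bounded1[OF _ g, of \<psi> B] h]) auto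
    finally have "(\<integral>x. (u (x + (- h *\<^sub>R ?e)) - u x) * \<psi> x \<partial>lborel) + (\<integral>x. ?G x * \<psi> x \<partial>lborel) = 0"
      by (simp add: mult.commute)
    moreover have "integrable lborel (\<lambda>x. (u (x + (- h *\<^sub>R ?e)) - u x) * \<psi> x)"
      by (intro bi0 Bochner_Integration.integrable_diff uh u)
    ultimately show "(\<integral>x. (u (x + (- h *\<^sub>R ?e)) - u x + ?G x) * \<psi> x \<partial>lborel) = 0"
      using bi0[OF G] by (simp add: distrib_right)
  qed
  then show ?thesis by eventually_elim auto
qed

text \<open>Cauchy-Schwarz in t on an interval of length h gives one factor h; integrating the
  translates of g^2 over t gives the other, by translation invariance.\<close>

lemma nn_integral_average_square:
  fixes g :: "'a::euclidean_space \<Rightarrow> real"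
  assumes [measurable]: "g \<in> borel_measurable borel" and h: "0 \<le> h"
  shows "(\<integral>\<^sup>+x. ennreal ((\<integral>t. indicator {0..h} t * g (x + t *\<^sub>R v) \<partial>lborel)\<^sup>2) \<partial>lborel)
    \<le> ennreal (h\<^sup>2) * (\<integral>\<^sup>+x. ennreal ((g x)\<^sup>2) \<partial>lborel)"
proof -
  have pointwise: "ennreal ((\<integral>t. indicator {0..h} t * g (x + t *\<^sub>R v) \<partial>lborel)\<^sup>2) \<le>
    ennreal h * (\<integral>\<^sup>+t. indicator {0..h} t * ennreal ((g (x + t *\<^sub>R v))\<^sup>2) \<partial>lborel)" for x
  proof -
    let ?k = "\<lambda>t. indicator {0..h} t * g (x + t *\<^sub>R v)"
    have "ennreal \<bar>integral\<^sup>L lborel ?k\<bar> \<le> (\<integral>\<^sup>+t. ennreal \<bar>?k t\<bar> \<partial>lborel)"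
    \<comment> \<open>A section that is not integrable has integral 0 by convention, so no
      exceptional set of x arises.\<close>
    proof (cases "integrable lborel ?k")
      case True
      from integral_norm_bound_ennreal[OF this] show ?thesis by simp
    qed (simp add: not_integrable_integral_eq)
    then have "(ennreal \<bar>integral\<^sup>L lborel ?k\<bar>)\<^sup>2 \<le> (\<integral>\<^sup>+t. ennreal \<bar>?k t\<bar> \<partial>lborel)\<^sup>2"
      by (rule power_mono) simp
    \<comment> \<open>The indicator is idempotent; the second copy is the factor 1 on [0, h] for
      Cauchy-Schwarz.\<close>
    also have "(\<integral>\<^sup>+t. ennreal \<bar>?k t\<bar> \<partial>lborel) = (\<integral>\<^sup>+t. indicator {0..h} t * ennreal \<bar>?k t\<bar> \<partial>lborel)"
      by (intro nn_integral_cong) (auto simp: indicator_def)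
    also have "\<dots>\<^sup>2 \<le> (\<integral>\<^sup>+t. (indicator {0..h} t)\<^sup>2 \<partial>lborel) * (\<integral>\<^sup>+t. (ennreal \<bar>?k t\<bar>)\<^sup>2 \<partial>lborel)"
      by (rule Cauchy_Schwarz_nn_integral) measurable
    also have "(\<integral>\<^sup>+t. (indicator {0..h} t)\<^sup>2 \<partial>lborel) = (\<integral>\<^sup>+t. indicator {0..h} t \<partial>lborel)"
      by (intro nn_integral_cong) (auto simp: indicator_def)
    also have "\<dots> = ennreal h" using h by simp
    also have "(\<integral>\<^sup>+t. (ennreal \<bar>?k t\<bar>)\<^sup>2 \<partial>lborel) = (\<integral>\<^sup>+t. indicator {0..h} t * ennreal ((g (x + t *\<^sub>R v))\<^sup>2) \<partial>lborel)"
      by (intro nn_integral_cong) (auto simp: indicator_def ennreal_power)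
    finally show ?thesis by (simp add: ennreal_power)
  qed
  have "(\<integral>\<^sup>+x. ennreal ((\<integral>t. indicator {0..h} t * g (x + t *\<^sub>R v) \<partial>lborel)\<^sup>2) \<partial>lborel) \<le>
    (\<integral>\<^sup>+x. ennreal h * (\<integral>\<^sup>+t. indicator {0..h} t * ennreal ((g (x + t *\<^sub>R v))\<^sup>2) \<partial>lborel) \<partial>lborel)"
    by (intro nn_integral_mono pointwise)
  also have "\<dots> = ennreal h * (\<integral>\<^sup>+x. (\<integral>\<^sup>+t. indicator {0..h} t * ennreal ((g (x + t *\<^sub>R v))\<^sup>2) \<partial>lborel) \<partial>lborel)"
    by (rule nn_integral_cmult) measurable
  also have "(\<integral>\<^sup>+x. (\<integral>\<^sup>+t. indicator {0..h} t * ennreal ((g (x + t *\<^sub>R v))\<^sup>2) \<partial>lborel) \<partial>lborel) =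
    (\<integral>\<^sup>+t. (\<integral>\<^sup>+x. indicator {0..h} t * ennreal ((g (x + t *\<^sub>R v))\<^sup>2) \<partial>lborel) \<partial>lborel)"
    by (rule lborel_pair.Fubini'[symmetric]) measurable
  also have "\<dots> = (\<integral>\<^sup>+t. (\<integral>\<^sup>+x. ennreal ((g x)\<^sup>2) \<partial>lborel) * indicator {0..h} t \<partial>lborel)"
    by (simp add: nn_integral_cmult nn_integral_lborel_translate[of "\<lambda>x. ennreal ((g x)\<^sup>2)"] mult.commute)
  also have "\<dots> = (\<integral>\<^sup>+x. ennreal ((g x)\<^sup>2) \<partial>lborel) * ennreal h"
    using h by (simp add: nn_integral_cmult)
  finally show ?thesis using h by (simp add: power2_eq_square ennreal_mult mult_ac)
qed

text \<open>The change of the integral is at most B times the L^1 distance between k and its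
  translate.\<close>

lemma translate_integral_isCont:
  fixes w k :: "'a::euclidean_space \<Rightarrow> real"
  assumes w: "w \<in> borel_measurable borel" "\<And>x. \<bar>w x\<bar> \<le> B" and k: "integrable lborel k"
  shows "isCont (\<lambda>t. \<integral>x. w x * k (x + t *\<^sub>R v) \<partial>lborel) 0"
  unfolding continuous_at_sequentially o_def
proof (intro allI impI)
  fix s :: "nat \<Rightarrow> real" assume s: "s \<longlonglongrightarrow> 0"
  have B: "B \<ge> 0" using w(2)[of undefined] by simp
  have it: "integrable lborel (\<lambda>x. w x * k (x + c))" for c
    using integrable_mult_bounded[OF integrable_lborel_translate[OF k] , of w B c] w by (simp add: mult.commute)
  have sv: "(\<lambda>n. s n *\<^sub>R v) \<longlonglongrightarrow> 0" using tendsto_scaleR[OF s tendsto_const, of v] by simp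
  have lim: "(\<lambda>n. B * (\<integral>x. \<bar>k (x + s n *\<^sub>R v) - k x\<bar> \<partial>lborel)) \<longlonglongrightarrow> 0"
    using tendsto_mult_right_zero[OF L1_translate_tendsto[OF k sv]] .
  have bd: "\<bar>(\<integral>x. w x * k (x + c) \<partial>lborel) - (\<integral>x. w x * k (x + 0 *\<^sub>R v) \<partial>lborel)\<bar>
     \<le> B * (\<integral>x. \<bar>k (x + c) - k x\<bar> \<partial>lborel)" for c
  proof -
    have "(\<integral>x. w x * k (x + c) \<partial>lborel) - (\<integral>x. w x * k (x + 0 *\<^sub>R v) \<partial>lborel) = (\<integral>x. w x * k (x + c) - w x * k x \<partial>lborel)"
      using it[of c] it[of 0] by simp
    also have "\<bar>\<dots>\<bar> \<le> (\<integral>x. \<bar>w x * k (x + c) - w x * k x\<bar> \<partial>lborel)" by (rule integral_abs_bound)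
    also have "\<dots> \<le> (\<integral>x. B * \<bar>k (x + c) - k x\<bar> \<partial>lborel)"
    proof (rule integral_mono)
      show "\<bar>w x * k (x + c) - w x * k x\<bar> \<le> B * \<bar>k (x + c) - k x\<bar>" for x
        using mult_right_mono[OF w(2)[of x], of "\<bar>k (x + c) - k x\<bar>"]
        by (simp add: abs_mult[symmetric] right_diff_distrib)
    qed (use it[of c] it[of 0] k integrable_lborel_translate[OF k, of c] in simp_all)
    finally show ?thesis by simp
  qed
  have "(\<lambda>n. (\<integral>x. w x * k (x + s n *\<^sub>R v) \<partial>lborel) - (\<integral>x. w x * k (x + 0 *\<^sub>R v) \<partial>lborel)) \<longlonglongrightarrow> 0"
    using bd by (intro Lim_null_comparison[OF always_eventually lim] allI) (simp only: real_norm_def)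
  then show "(\<lambda>n. \<integral>x. w x * k (x + s n *\<^sub>R v) \<partial>lborel) \<longlonglongrightarrow> (\<integral>x. w x * k (x + 0 *\<^sub>R v) \<partial>lborel)"
    by (rule LIM_zero_cancel)
qed

text \<open>If S 0 were not 0, the integral over [0, h] would grow like h times S 0, which no
  multiple of h^2 dominates near 0. Working with integrals replaces dividing by h and passing to the
  limit.\<close>

lemma zero_if_integral_quadratic:
  fixes S :: "real \<Rightarrow> real"
  assumes cont: "isCont S 0" and \<delta>: "\<delta> > 0"
    and int: "\<And>h. 0 < h \<Longrightarrow> h < \<delta> \<Longrightarrow> integrable lborel (\<lambda>t. indicator {0..h} t * S t)"
    and le: "\<And>h. 0 < h \<Longrightarrow> h < \<delta> \<Longrightarrow> \<bar>\<integral>t. indicator {0..h} t * S t \<partial>lborel\<bar> \<le> C * h\<^sup>2"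
  shows "S 0 = 0"
proof (rule ccontr)
  assume "S 0 \<noteq> 0"
  define \<epsilon> where "\<epsilon> = \<bar>S 0\<bar> / 2"
  have "\<epsilon> > 0" using \<open>S 0 \<noteq> 0\<close> by (simp add: \<epsilon>_def)
  then obtain d where d: "d > 0" "\<And>t. \<bar>t\<bar> < d \<Longrightarrow> \<bar>S t - S 0\<bar> < \<epsilon>"
    using cont unfolding continuous_at_eps_delta dist_real_def by (metis diff_zero)
  \<comment> \<open>Halving makes all three bounds strict. The third forces C h < \<epsilon>, so
    that \<bar>S 0\<bar> \<le> \<epsilon> + C h < 2 \<epsilon> = \<bar>S 0\<bar>.\<close>
  define h where "h = min (min \<delta> d) (\<epsilon> / (\<bar>C\<bar> + 1)) / 2"
  have "\<epsilon> / (\<bar>C\<bar> + 1) > 0" using \<open>\<epsilon> > 0\<close> by simp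
  then have m: "0 < min (min \<delta> d) (\<epsilon> / (\<bar>C\<bar> + 1))" using \<delta> d(1) by simp
  then have "0 < h" "h < min (min \<delta> d) (\<epsilon> / (\<bar>C\<bar> + 1))" 
    unfolding h_def by (auto simp del: min_less_iff_conj)
  then have h: "0 < h" "h < \<delta>" "h < d" and "h < \<epsilon> / (\<bar>C\<bar> + 1)" by simp_all
  then have Ch: "(\<bar>C\<bar> + 1) * h < \<epsilon>" by (simp add: field_simps)
  have i0: "integrable lborel (\<lambda>t. indicator {0..h} t * r)" for r :: real
    by (intro integrable_mult_left integrable_real_indicator) (use h(1) in auto)
  have "h * S 0 - (\<integral>t. indicator {0..h} t * S t \<partial>lborel) = (\<integral>t. indicator {0..h} t * (S 0 - S t) \<partial>lborel)"
    using int[OF h(1,2)] i0 h(1) by (simp add: right_diff_distrib)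
  also have "\<bar>\<dots>\<bar> \<le> (\<integral>t. indicator {0..h} t * \<epsilon> \<partial>lborel)"
  proof (rule order_trans[OF integral_abs_bound integral_mono])
    show "integrable lborel (\<lambda>t. \<bar>indicator {0..h} t * (S 0 - S t)\<bar>)"
      using int[OF h(1,2)] i0[of "S 0"] by (simp add: right_diff_distrib)
    show "\<bar>indicator {0..h} t * (S 0 - S t)\<bar> \<le> indicator {0..h} t * \<epsilon>" for t
      using d(2)[of t] h by (auto simp: indicator_def abs_minus_commute)
  qed (rule i0)
  also have "\<dots> = h * \<epsilon>" using h by simp
  finally have "\<bar>h * S 0\<bar> \<le> h * \<epsilon> + C * h\<^sup>2" using le[OF h(1,2)] by linarith
  then have "h * \<bar>S 0\<bar> \<le> h * (\<epsilon> + C * h)" using h(1) by (simp add: abs_mult power2_eq_square algebra_simps)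
  then have "\<bar>S 0\<bar> \<le> \<epsilon> + C * h" using h(1) by simp
  also have "C * h \<le> (\<bar>C\<bar> + 1) * h" using h(1) by (intro mult_right_mono) auto
  finally show False using Ch by (simp add: \<epsilon>_def)
qed

text \<open>Let P t and H t be the two sides of the claim, up to sign, with the derivative of the
  test function shifted by t e and g shifted by - t e. Integration over [0, h] turns P into an
  increment of F(u) and H into F'(u) times the averaged g, which is minus the increment of u. Their
  sum is a Taylor remainder, of order h^2, so P 0 + H 0 = 0.\<close>

lemma weak_chain_rule:
  fixes u g :: plane_fun and F F' :: "real \<Rightarrow> real"
  assumes "open \<Omega>" and u: "integrable lborel u" and g: "integrable lborel g"
    and g2: "integrable lborel (\<lambda>x. (g x)\<^sup>2)"
    and weak: "\<And>\<phi>. \<phi> \<in> test_funs \<Omega> \<Longrightarrow> (\<integral>x. u x * partial_d i \<phi> x \<partial>lborel) = - (\<integral>x. g x * \<phi> x \<partial>lborel)"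
    and F: "F \<in> borel_measurable borel" "F' \<in> borel_measurable borel"
    and FB: "\<And>s. \<bar>F s\<bar> \<le> B" "\<And>s. \<bar>F' s\<bar> \<le> B"
    and L: "L \<ge> 0" "\<And>s t. \<bar>F s - F t - F' t * (s - t)\<bar> \<le> L * (s - t)\<^sup>2"
    and \<phi>: "\<phi> \<in> test_funs \<Omega>"
  shows "(\<integral>x. F (u x) * partial_d i \<phi> x \<partial>lborel) = - (\<integral>x. F' (u x) * g x * \<phi> x \<partial>lborel)"
proof -
  let ?e = "axis i 1 :: real^2"
  let ?K = "closure {x. \<phi> x \<noteq> 0}"
  note [measurable] = F test_funs_measurable[OF \<phi>] test_funs_measurable[OF test_funs_partial_d[OF \<phi>]]
  have [measurable]: "u \<in> borel_measurable borel" "g \<in> borel_measurable borel" using u g by auto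
  have B: "B \<ge> 0" using FB(1)[of 0] by simp
  obtain B\<phi> where B\<phi>: "B\<phi> > 0" "\<And>x. \<bar>\<phi> x\<bar> \<le> B\<phi>" using test_funs_bounded[OF \<phi>] by blast
  obtain \<delta> where \<delta>: "\<delta> > 0" "(\<Union>x\<in>?K. ball x \<delta>) \<subseteq> \<Omega>"
    using compact_subset_open_imp_ball_epsilon_subset[OF test_funsD(2)[OF \<phi>] \<open>open \<Omega>\<close> test_funsD(3)[OF \<phi>]] by blast
  \<comment> \<open>Half of the distance \<delta> is spent on a neighbourhood of the support, the
    other half on the shifts by less than \<delta> / 2.\<close>
  define \<Omega>' where "\<Omega>' = (\<Union>x\<in>?K. ball x (\<delta> / 2))"
  have "open \<Omega>'" by (auto simp: \<Omega>'_def)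
  have sub: "y - t *\<^sub>R ?e \<in> \<Omega>" if y: "y \<in> \<Omega>'" and "0 \<le> t" "t \<le> h" "h < \<delta> / 2" for y t h
  proof -
    obtain x where x: "x \<in> ?K" "dist x y < \<delta> / 2" using y unfolding \<Omega>'_def UN_iff mem_ball by blast
    have "dist x (y - t *\<^sub>R ?e) \<le> dist x y + dist y (y - t *\<^sub>R ?e)" by (rule dist_triangle)
    also have "dist y (y - t *\<^sub>R ?e) = t" using that by (simp add: dist_norm)
    finally have "dist x (y - t *\<^sub>R ?e) < \<delta>" using x(2) that by simp
    then have "y - t *\<^sub>R ?e \<in> ball x \<delta>" by simp
    then show ?thesis using \<delta>(2) x(1) by blast
  qed
  have supp: "x \<in> \<Omega>'" if "\<phi> x \<noteq> 0" for x
    using that test_funs_zero[OF \<phi>, of x] \<delta>(1) centre_in_ball[of x "\<delta> / 2"] unfolding \<Omega>'_def by (metis UN_I half_gt_zero)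
  define P where "P t = (\<integral>x. F (u x) * partial_d i \<phi> (x + t *\<^sub>R ?e) \<partial>lborel)" for t
  define H where "H t = (\<integral>x. (F' (u x) * \<phi> x) * g (x + t *\<^sub>R (- ?e)) \<partial>lborel)" for t
  \<comment> \<open>Bound of the test function, constant of the Taylor remainder, and the squared
    L^2 norm left by \<open>nn_integral_average_square\<close>.\<close>
  define C where "C = B\<phi> * L * (\<integral>x. (g x)\<^sup>2 \<partial>lborel)"
  have w1: "\<bar>F' (u x) * \<phi> x\<bar> \<le> B * B\<phi>" for x
    using FB(2) B\<phi>(2) B unfolding abs_mult by (intro mult_mono) auto
  have BB: "B * B\<phi> \<ge> 0" using B B\<phi>(1) by simp
  note \<phi>i = test_funs_integrable[OF \<phi>] and d\<phi>i = test_funs_integrable[OF test_funs_partial_d[OF \<phi>, of i]]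
  note nnP = nn_integral_translate_bounded1[of "\<lambda>x. F (u x)", OF _ d\<phi>i B FB(1), simplified]
  note nnH = nn_integral_translate_bounded1[of "\<lambda>x. F' (u x) * \<phi> x", OF _ g BB w1, simplified]
  have quad: "integrable lborel (\<lambda>t. indicator {0..h} t * (P t + H t))"
    "\<bar>\<integral>t. indicator {0..h} t * (P t + H t) \<partial>lborel\<bar> \<le> C * h\<^sup>2" if h: "0 < h" "h < \<delta> / 2" for h
  proof -
    have h0: "0 \<le> h" using h by simp
    define G where "G x = (\<integral>t. indicator {0..h} t * g (x + t *\<^sub>R (- ?e)) \<partial>lborel)" for x
    define T where "T x = (F (u (x + (- h *\<^sub>R ?e))) - F (u x)) * \<phi> x + F' (u x) * \<phi> x * G x" for x
    have iP: "integrable lborel (\<lambda>t. indicator {0..h} t * P t)"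
      unfolding P_def by (rule translate_integral_swap(2)[OF _ _ nnP h0]) measurable
    have iH: "integrable lborel (\<lambda>t. indicator {0..h} t * H t)"
      unfolding H_def by (rule translate_integral_swap(2)[OF _ _ nnH h0]) measurable
    show "integrable lborel (\<lambda>t. indicator {0..h} t * (P t + H t))"
      using iP iH by (simp add: distrib_left)
    have Fi: "integrable lborel (\<lambda>x. F (u (x + a)) * \<phi> (x + b))" for a b
      using integrable_mult_bounded[OF integrable_lborel_translate[OF \<phi>i], of "\<lambda>x. F (u (x + a))" B b] FB(1)
      by (simp add: mult.commute)
    \<comment> \<open>The increment of the test function is undone by translation, which leaves a
      backward increment of F(u). No derivative of F(u) is involved.\<close>
    have "(\<integral>t. indicator {0..h} t * P t \<partial>lborel) = (\<integral>x. F (u x) * (\<phi> (x + h *\<^sub>R ?e) - \<phi> x) \<partial>lborel)"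
      unfolding P_def test_fun_increment[OF \<phi> h0]
      by (rule translate_integral_swap(3)[OF _ _ nnP h0, symmetric]) measurable
    also have "\<dots> = (\<integral>x. F (u x) * \<phi> (x + h *\<^sub>R ?e) \<partial>lborel) - (\<integral>x. F (u x) * \<phi> x \<partial>lborel)"
      using Fi[of 0 "h *\<^sub>R ?e"] Fi[of 0 0] by (simp add: right_diff_distrib)
    also have "(\<integral>x. F (u x) * \<phi> (x + h *\<^sub>R ?e) \<partial>lborel) = (\<integral>x. F (u (x + (- h *\<^sub>R ?e))) * \<phi> x \<partial>lborel)"
      using integral_lborel_translate[of "\<lambda>x. F (u (x + (- h *\<^sub>R ?e))) * \<phi> x" "h *\<^sub>R ?e"] by simp
    also have "\<dots> - (\<integral>x. F (u x) * \<phi> x \<partial>lborel) = (\<integral>x. (F (u (x + (- h *\<^sub>R ?e))) - F (u x)) * \<phi> x \<partial>lborel)"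
      using Fi[of "- h *\<^sub>R ?e" 0] Fi[of 0 0] by (simp add: left_diff_distrib)
    finally have eqP: "(\<integral>t. indicator {0..h} t * P t \<partial>lborel) = (\<integral>x. (F (u (x + (- h *\<^sub>R ?e))) - F (u x)) * \<phi> x \<partial>lborel)" .
    have eqH: "(\<integral>t. indicator {0..h} t * H t \<partial>lborel) = (\<integral>x. F' (u x) * \<phi> x * G x \<partial>lborel)"
      unfolding H_def G_def by (rule translate_integral_swap(3)[OF _ _ nnH h0, symmetric]) measurable
    have T1: "integrable lborel (\<lambda>x. (F (u (x + (- h *\<^sub>R ?e))) - F (u x)) * \<phi> x)"
      using Fi[of "- h *\<^sub>R ?e" 0] Fi[of 0 0] by (simp add: left_diff_distrib)
    have T2: "integrable lborel (\<lambda>x. F' (u x) * \<phi> x * G x)"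
      unfolding G_def by (rule translate_integral_swap(1)[OF _ _ nnH h0]) measurable
    have Ti: "integrable lborel T" unfolding T_def[abs_def] using T1 T2 by simp
    have "(\<integral>t. indicator {0..h} t * (P t + H t) \<partial>lborel) = (\<integral>t. indicator {0..h} t * P t \<partial>lborel) + (\<integral>t. indicator {0..h} t * H t \<partial>lborel)"
      using iP iH by (simp add: distrib_left)
    also have "\<dots> = (\<integral>x. T x \<partial>lborel)" unfolding eqP eqH T_def using T1 T2 by simp
    finally have eqT: "(\<integral>t. indicator {0..h} t * (P t + H t) \<partial>lborel) = (\<integral>x. T x \<partial>lborel)" .
    have "AE x in lborel. x \<in> \<Omega>' \<longrightarrow> u (x - h *\<^sub>R ?e) - u x = - G x"
      unfolding G_def by (rule weak_increment[OF \<open>open \<Omega>'\<close> u g weak sub[OF _ _ _ h(2)] h0])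
    then have "AE x in lborel. ennreal \<bar>T x\<bar> \<le> ennreal (B\<phi> * L) * ennreal ((G x)\<^sup>2)"
    proof eventually_elim
      case (elim x)
      have "\<bar>T x\<bar> \<le> B\<phi> * L * (G x)\<^sup>2"
      \<comment> \<open>The identity for the increment of u holds only on \<Omega>', which contains
        every point where the test function is not 0; elsewhere T vanishes.\<close>
      proof (cases "\<phi> x = 0")
        case False
        then have uG: "u (x - h *\<^sub>R ?e) - u x = - G x" using elim supp by blast
        have "T x = \<phi> x * (F (u (x - h *\<^sub>R ?e)) - F (u x) - F' (u x) * (u (x - h *\<^sub>R ?e) - u x))"
          unfolding uG by (simp add: T_def algebra_simps)
        then have "\<bar>T x\<bar> \<le> B\<phi> * (L * (u (x - h *\<^sub>R ?e) - u x)\<^sup>2)"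
          using B\<phi> L(2) by (auto simp: abs_mult intro!: mult_mono)
        then show ?thesis unfolding uG by simp
      qed (use B\<phi> L in \<open>simp add: T_def\<close>)
      then show ?case using B\<phi> L by (simp add: ennreal_mult[symmetric] ennreal_leI)
    qed
    then have "(\<integral>\<^sup>+x. ennreal \<bar>T x\<bar> \<partial>lborel) \<le> (\<integral>\<^sup>+x. ennreal (B\<phi> * L) * ennreal ((G x)\<^sup>2) \<partial>lborel)"
      by (rule nn_integral_mono_AE)
    also have "\<dots> = ennreal (B\<phi> * L) * (\<integral>\<^sup>+x. ennreal ((G x)\<^sup>2) \<partial>lborel)"
      unfolding G_def by (rule nn_integral_cmult) measurable
    also have "\<dots> \<le> ennreal (B\<phi> * L) * (ennreal (h\<^sup>2) * (\<integral>\<^sup>+x. ennreal ((g x)\<^sup>2) \<partial>lborel))"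
      unfolding G_def by (intro mult_left_mono nn_integral_average_square h0) auto
    also have "(\<integral>\<^sup>+x. ennreal ((g x)\<^sup>2) \<partial>lborel) = ennreal (\<integral>x. (g x)\<^sup>2 \<partial>lborel)"
      by (rule nn_integral_eq_integral[OF g2]) simp
    finally have "(\<integral>\<^sup>+x. ennreal \<bar>T x\<bar> \<partial>lborel) \<le> ennreal (C * h\<^sup>2)"
      using B\<phi> L by (simp add: ennreal_mult[symmetric] C_def mult_ac)
    then have "ennreal \<bar>\<integral>x. T x \<partial>lborel\<bar> \<le> ennreal (C * h\<^sup>2)"
      using integral_norm_bound_ennreal[OF Ti] by (simp add: order_trans)
    then show "\<bar>\<integral>t. indicator {0..h} t * (P t + H t) \<partial>lborel\<bar> \<le> C * h\<^sup>2"
      unfolding eqT using B\<phi> L by (subst (asm) ennreal_le_iff) (auto simp: C_def)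
  qed
  have cont: "isCont (\<lambda>t. P t + H t) 0"
    unfolding P_def H_def
    by (intro continuous_add translate_integral_isCont[where B=B] translate_integral_isCont[where B="B * B\<phi>"] d\<phi>i g w1 FB) auto
  have "P 0 + H 0 = 0"
    using zero_if_integral_quadratic[of "\<lambda>t. P t + H t" "\<delta> / 2" C, OF cont _ quad] \<delta>(1) by simp
  then show ?thesis by (simp add: P_def H_def mult_ac)
qed

section \<open>\<open>H\<^sup>1\<close> as a metric space\<close>

text \<open>Applied to the squared norm of f + t g, with b the inner product, this is Cauchy-Schwarz
  and the triangle inequality at once; a, b, c may be sums over several components.\<close>

lemma sqrt_quadratic_form_triangle:
  fixes a b c :: real
  assumes nonneg: "\<And>t. 0 \<le> a + 2 * b * t + c * t\<^sup>2" and a: "0 \<le> a" and c: "0 \<le> c"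
  shows "b\<^sup>2 \<le> a * c" "sqrt (a + 2 * b + c) \<le> sqrt a + sqrt c"
proof -
  show bac: "b\<^sup>2 \<le> a * c"
  proof (cases "c = 0")
    case True
    have "b = 0"
    proof (rule ccontr)
      assume "b \<noteq> 0"
      \<comment> \<open>With c = 0 this value of t gives a + 2 b t = - 1.\<close>
      then show False using nonneg[of "- (a + 1) / (2 * b)"] True by simp
    qed
    then show ?thesis using True by simp
  next
    case False
    then have "c > 0" using c by simp
    \<comment> \<open>Evaluation at the minimizer of the quadratic polynomial.\<close>
    then show ?thesis using nonneg[of "- b / c"] by (simp add: field_simps power2_eq_square)
  qed
  have "b \<le> sqrt a * sqrt c"
    using real_le_rsqrt[OF bac] by (simp add: real_sqrt_mult)
  then have "a + 2 * b + c \<le> (sqrt a + sqrt c)\<^sup>2"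
    using a c by (simp add: power2_sum)
  then have "sqrt (a + 2 * b + c) \<le> sqrt ((sqrt a + sqrt c)\<^sup>2)" by (rule real_sqrt_le_mono)
  then show "sqrt (a + 2 * b + c) \<le> sqrt a + sqrt c"
    using a c by simp
qed

locale bounded_open =
  fixes \<Omega> :: "(real^2) set"
  assumes open_\<Omega>: "open \<Omega>" and bounded_\<Omega>: "bounded \<Omega>"
begin

abbreviation "M \<equiv> lebesgue_on \<Omega>"

section \<open>Lebesgue measure on \<Omega> and Borel functions on the plane\<close>

lemma sets_\<Omega>_borel [measurable]: "\<Omega> \<in> sets borel"
  and sets_\<Omega> [simp, intro]: "\<Omega> \<in> sets lebesgue"
  using open_\<Omega> by auto

sublocale finite_measure M
proof
  have "emeasure lebesgue \<Omega> < \<infinity>" using emeasure_bounded_finite[OF bounded_\<Omega>] by simp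
  then show "emeasure M (space M) \<noteq> \<infinity>" by (simp add: emeasure_restrict_space)
qed

lemma AE_M: "(AE x in M. P x) \<longleftrightarrow> (AE x in lborel. x \<in> \<Omega> \<longrightarrow> P x)"
  by (subst AE_restrict_space_iff) (auto simp: AE_completion_iff)

lemma borel_imp_M: "f \<in> borel_measurable borel \<Longrightarrow> f \<in> borel_measurable M"
  by (intro measurable_restrict_space1 measurable_completion) simp

lemma integrable_M_borel:
  fixes f :: plane_fun
  assumes "f \<in> borel_measurable borel"
  shows "integrable M f \<longleftrightarrow> integrable lborel (\<lambda>x. indicator \<Omega> x * f x)"
proof -
  note [measurable] = assms
  have "(\<lambda>x. indicator \<Omega> x * f x) \<in> borel_measurable lborel" by measurable
  then show ?thesis by (simp add: integrable_restrict_space integrable_completion)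
qed

lemma integral_M_borel:
  fixes f :: plane_fun
  assumes "f \<in> borel_measurable borel"
  shows "(\<integral>x. f x \<partial>M) = (\<integral>x. indicator \<Omega> x * f x \<partial>lborel)"
proof -
  note [measurable] = assms
  have "(\<lambda>x. indicator \<Omega> x * f x) \<in> borel_measurable lborel" by measurable
  then show ?thesis by (simp add: integral_restrict_space integral_completion)
qed

text \<open>Completeness of Lebesgue measure. \<open>ae_class\<close> contains all functions equal
  almost everywhere, without a measurability condition, so a chosen representative is measurable for
  this reason.\<close>

lemma measurable_M_AE:
  fixes f g :: plane_fun
  assumes f: "f \<in> borel_measurable M" and ae: "AE x in M. f x = g x"
  shows "g \<in> borel_measurable M"
proof -
  have "(\<lambda>x. if x \<in> \<Omega> then f x else 0) \<in> borel_measurable lebesgue"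
    using f by (simp add: borel_measurable_if)
  moreover have "AE x in lebesgue. (if x \<in> \<Omega> then f x else 0) = (if x \<in> \<Omega> then g x else 0)"
    using ae by (simp add: AE_restrict_space_iff) 
  ultimately have "(\<lambda>x. if x \<in> \<Omega> then g x else 0) \<in> borel_measurable lebesgue"
    by (rule borel_measurable_AE)
  then show ?thesis by (simp add: borel_measurable_if)
qed

section \<open>Square integrable functions on \<Omega>\<close>

lemma L2_measurable: "u \<in> L2_funs \<Omega> \<Longrightarrow> u \<in> borel_measurable M"
  and L2_integrable_square: "u \<in> L2_funs \<Omega> \<Longrightarrow> integrable M (\<lambda>x. (u x)\<^sup>2)"
  by (auto simp: L2_funs_def)

lemma L2_AE:
  assumes "u \<in> L2_funs \<Omega>" "AE x in M. u x = v x"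
  shows "v \<in> L2_funs \<Omega>"
proof -
  have v: "v \<in> borel_measurable M" using measurable_M_AE[OF L2_measurable] assms by blast
  moreover have "AE x in M. (u x)\<^sup>2 = (v x)\<^sup>2" using assms(2) by eventually_elim simp
  then have "integrable M (\<lambda>x. (v x)\<^sup>2)"
    using integrable_cong_AE[of "\<lambda>x. (u x)\<^sup>2" M "\<lambda>x. (v x)\<^sup>2"] v assms(1) by (auto simp: L2_funs_def)
  ultimately show ?thesis by (simp add: L2_funs_def)
qed

lemma L2_mult_integrable:
  assumes "u \<in> L2_funs \<Omega>" "v \<in> L2_funs \<Omega>"
  shows "integrable M (\<lambda>x. u x * v x)"
proof (rule Bochner_Integration.integrable_bound)
  show "integrable M (\<lambda>x. (u x)\<^sup>2 + (v x)\<^sup>2)" using assms by (simp add: L2_integrable_square)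
  show "(\<lambda>x. u x * v x) \<in> borel_measurable M" using assms[THEN L2_measurable] by measurable
  have "\<bar>u x * v x\<bar> \<le> (u x)\<^sup>2 + (v x)\<^sup>2" for x
  proof -
    have "2 * \<bar>u x * v x\<bar> \<le> (u x)\<^sup>2 + (v x)\<^sup>2"
      using sum_squares_bound[of "\<bar>u x\<bar>" "\<bar>v x\<bar>"] by (simp add: abs_mult mult.assoc)
    then show ?thesis by linarith
  qed
  then show "AE x in M. norm (u x * v x) \<le> norm ((u x)\<^sup>2 + (v x)\<^sup>2)" by (simp add: abs_of_nonneg)
qed

lemma L2_add: "u \<in> L2_funs \<Omega> \<Longrightarrow> v \<in> L2_funs \<Omega> \<Longrightarrow> (\<lambda>x. u x + v x) \<in> L2_funs \<Omega>"
  using L2_mult_integrable[of u v] by (auto simp: L2_funs_def power2_sum mult.assoc)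

lemma L2_scale: "u \<in> L2_funs \<Omega> \<Longrightarrow> (\<lambda>x. s * u x) \<in> L2_funs \<Omega>"
  by (auto simp: L2_funs_def power_mult_distrib)

lemma L2_diff: "u \<in> L2_funs \<Omega> \<Longrightarrow> v \<in> L2_funs \<Omega> \<Longrightarrow> (\<lambda>x. u x - v x) \<in> L2_funs \<Omega>"
  using L2_mult_integrable[of u v] by (auto simp: L2_funs_def power2_diff mult.assoc)

lemma L2_bounded_mult:
  assumes u: "u \<in> L2_funs \<Omega>" and k: "k \<in> borel_measurable M" "\<And>x. \<bar>k x\<bar> \<le> B"
  shows "(\<lambda>x. k x * u x) \<in> L2_funs \<Omega>"
proof -
  have "\<bar>(k x)\<^sup>2\<bar> \<le> B\<^sup>2" for x using k(2)[of x] by (simp add: abs_le_square_iff[symmetric])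
  then have "integrable M (\<lambda>x. (u x)\<^sup>2 * (k x)\<^sup>2)"
    using k(1) by (intro integrable_mult_bounded[OF L2_integrable_square[OF u], where B="B\<^sup>2"]) measurable
  then show ?thesis using L2_measurable[OF u] k(1) by (auto simp: L2_funs_def power_mult_distrib mult.commute)
qed

lemma L2_const: "(\<lambda>x. s) \<in> L2_funs \<Omega>"
  by (simp add: L2_funs_def)

lemma L2_bounded: "k \<in> borel_measurable M \<Longrightarrow> (\<And>x. \<bar>k x\<bar> \<le> B) \<Longrightarrow> k \<in> L2_funs \<Omega>"
  using L2_bounded_mult[OF L2_const[of 1], of k B] by simp

lemma L2_integrable: "u \<in> L2_funs \<Omega> \<Longrightarrow> integrable M u"
  by (rule square_integrable_imp_integrable[OF L2_measurable L2_integrable_square])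

text \<open>The results on translations and the chain rule concern Borel functions on the whole
  plane. A Borel version that vanishes outside \<Omega> makes them available; integrability of u'
  itself rests on the finite measure of \<Omega>.\<close>

lemma L2_borel:
  assumes "u \<in> L2_funs \<Omega>"
  obtains u' where "AE x in M. u x = u' x" "integrable lborel u'" "integrable lborel (\<lambda>x. (u' x)\<^sup>2)"
    "\<forall>x. x \<notin> \<Omega> \<longrightarrow> u' x = 0"
proof -
  have "(\<lambda>x. if x \<in> \<Omega> then u x else 0) \<in> borel_measurable lebesgue"
    using assms by (simp add: borel_measurable_if L2_measurable)
  then obtain v where v: "v \<in> borel_measurable lborel" "AE x in lborel. (if x \<in> \<Omega> then u x else 0) = v x"
    using completion_ex_borel_measurable_real by blast
  have [measurable]: "v \<in> borel_measurable borel" using v(1) by simp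
  define u' where "u' x = indicator \<Omega> x * v x" for x
  have [measurable]: "u' \<in> borel_measurable borel" unfolding u'_def[abs_def] by measurable
  have ae: "AE x in M. u x = u' x" unfolding AE_M using v(2) by eventually_elim (auto simp: u'_def)
  have L2: "u' \<in> L2_funs \<Omega>" using L2_AE[OF assms ae] .
  have eq: "(\<lambda>x. indicator \<Omega> x * u' x) = u'" "(\<lambda>x. indicator \<Omega> x * (u' x)\<^sup>2) = (\<lambda>x. (u' x)\<^sup>2)"
    by (auto simp: u'_def indicator_def)
  show ?thesis
  proof (rule that[OF ae])
    show "integrable lborel u'" using L2_integrable[OF L2] by (simp add: integrable_M_borel eq)
    show "integrable lborel (\<lambda>x. (u' x)\<^sup>2)" using L2_integrable_square[OF L2] by (simp add: integrable_M_borel eq)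
  qed (auto simp: u'_def)
qed

lemma test_fun_M:
  assumes "\<phi> \<in> test_funs \<Omega>"
  shows "\<phi> \<in> borel_measurable M" "\<exists>B. \<forall>x. \<bar>\<phi> x\<bar> \<le> B"
proof -
  show "\<phi> \<in> borel_measurable M" by (rule borel_imp_M[OF test_funs_measurable[OF assms]])
  obtain B where "\<And>x. \<bar>\<phi> x\<bar> \<le> B" using test_funs_bounded[OF assms] by blast
  then show "\<exists>B. \<forall>x. \<bar>\<phi> x\<bar> \<le> B" by auto
qed

lemma L2_mult_test_integrable:
  assumes u: "u \<in> L2_funs \<Omega>" and \<phi>: "\<phi> \<in> test_funs \<Omega>"
  shows "integrable M (\<lambda>x. u x * \<phi> x)"
proof -
  obtain B where "\<forall>x. \<bar>\<phi> x\<bar> \<le> B" using test_fun_M(2)[OF \<phi>] by auto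
  then show ?thesis by (intro integrable_mult_bounded[OF L2_integrable[OF u] test_fun_M(1)[OF \<phi>], of B]) simp
qed

lemma integral_M_AE_mult:
  assumes u: "u \<in> borel_measurable M" and ae: "AE x in M. u x = u' x" and \<phi>: "\<phi> \<in> test_funs \<Omega>"
  shows "(\<integral>x. u x * \<phi> x \<partial>M) = (\<integral>x. u' x * \<phi> x \<partial>M)"
proof (rule integral_cong_AE)
  note [measurable] = u measurable_M_AE[OF u ae] test_fun_M(1)[OF \<phi>]
  show "(\<lambda>x. u x * \<phi> x) \<in> borel_measurable M" "(\<lambda>x. u' x * \<phi> x) \<in> borel_measurable M" by measurable
  show "AE x in M. u x * \<phi> x = u' x * \<phi> x" using ae by eventually_elim simp
qed

section \<open>Weak derivatives up to null sets\<close>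

lemma weak_partial_AE:
  assumes u: "u \<in> L2_funs \<Omega>" and g: "g \<in> L2_funs \<Omega>"
    and ae: "AE x in M. u x = u' x" "AE x in M. g x = g' x"
    and weak: "is_weak_partial \<Omega> i u g"
  shows "is_weak_partial \<Omega> i u' g'"
  unfolding is_weak_partial_def
proof
  fix \<phi> assume \<phi>: "\<phi> \<in> test_funs \<Omega>"
  have "(\<integral>x. u x * partial_d i \<phi> x \<partial>M) = - (\<integral>x. g x * \<phi> x \<partial>M)"
    using weak \<phi> by (simp add: is_weak_partial_def)
  then show "(\<integral>x. u' x * partial_d i \<phi> x \<partial>M) = - (\<integral>x. g' x * \<phi> x \<partial>M)"
    unfolding integral_M_AE_mult[OF L2_measurable[OF u] ae(1) test_funs_partial_d[OF \<phi>]]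
      integral_M_AE_mult[OF L2_measurable[OF g] ae(2) \<phi>] .
qed

lemma integral_M_lborel:
  fixes u \<phi> :: plane_fun
  assumes "integrable lborel u" "\<forall>x. x \<notin> \<Omega> \<longrightarrow> u x = 0" "\<phi> \<in> borel_measurable borel"
  shows "(\<integral>x. u x * \<phi> x \<partial>M) = (\<integral>x. u x * \<phi> x \<partial>lborel)"
proof -
  have "(\<lambda>x. indicator \<Omega> x * (u x * \<phi> x)) = (\<lambda>x. u x * \<phi> x)"
    using assms(2) by (auto simp: indicator_def fun_eq_iff)
  moreover have "(\<lambda>x. u x * \<phi> x) \<in> borel_measurable borel"
    using assms(3) borel_measurable_integrable[OF assms(1)] by simp
  ultimately show ?thesis by (simp add: integral_M_borel)
qed

lemma weak_partial_lborel:
  assumes weak: "is_weak_partial \<Omega> i u g" and \<phi>: "\<phi> \<in> test_funs \<Omega>"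
    and u: "integrable lborel u" "\<forall>x. x \<notin> \<Omega> \<longrightarrow> u x = 0"
    and g: "integrable lborel g" "\<forall>x. x \<notin> \<Omega> \<longrightarrow> g x = 0"
  shows "(\<integral>x. u x * partial_d i \<phi> x \<partial>lborel) = - (\<integral>x. g x * \<phi> x \<partial>lborel)"
proof -
  have "(\<integral>x. u x * partial_d i \<phi> x \<partial>M) = - (\<integral>x. g x * \<phi> x \<partial>M)"
    using weak \<phi> by (simp add: is_weak_partial_def)
  then show ?thesis
    unfolding integral_M_lborel[OF u test_funs_measurable[OF test_funs_partial_d[OF \<phi>, of i]]]
      integral_M_lborel[OF g test_funs_measurable[OF \<phi>]] .
qed

lemma weak_partial_unique:
  assumes g: "g \<in> L2_funs \<Omega>" "is_weak_partial \<Omega> i u g" and h: "h \<in> L2_funs \<Omega>" "is_weak_partial \<Omega> i u h"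
  shows "AE x in M. g x = h x"
proof -
  obtain d where d: "AE x in M. g x - h x = d x" "integrable lborel d" "\<forall>x. x \<notin> \<Omega> \<longrightarrow> d x = 0"
    using L2_borel[OF L2_diff[OF g(1) h(1)]] by blast
  have "AE x in lborel. x \<in> \<Omega> \<longrightarrow> d x = 0"
  proof (rule fundamental_lemma[OF open_\<Omega> d(2)])
    fix \<phi> assume \<phi>: "\<phi> \<in> test_funs \<Omega>"
    have "(\<integral>x. d x * \<phi> x \<partial>lborel) = (\<integral>x. (g x - h x) * \<phi> x \<partial>M)"
      using integral_M_lborel[OF d(2,3) test_funs_measurable[OF \<phi>]]
        integral_M_AE_mult[OF L2_measurable[OF L2_diff[OF g(1) h(1)]] d(1) \<phi>] by simp
    also have "\<dots> = (\<integral>x. g x * \<phi> x \<partial>M) - (\<integral>x. h x * \<phi> x \<partial>M)"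
      using L2_mult_test_integrable[OF _ \<phi>] g(1) h(1) by (simp add: left_diff_distrib)
    also have "\<dots> = 0" using g(2) h(2) \<phi> by (simp add: is_weak_partial_def)
    finally show "(\<integral>x. d x * \<phi> x \<partial>lborel) = 0" .
  qed
  then have "AE x in M. d x = 0" by (simp add: AE_M)
  with d(1) show ?thesis by eventually_elim simp
qed

lemma weak_partial_add:
  assumes "u \<in> L2_funs \<Omega>" "v \<in> L2_funs \<Omega>" "g \<in> L2_funs \<Omega>" "h \<in> L2_funs \<Omega>"
    "is_weak_partial \<Omega> i u g" "is_weak_partial \<Omega> i v h"
  shows "is_weak_partial \<Omega> i (\<lambda>x. u x + v x) (\<lambda>x. g x + h x)"
  using assms L2_mult_test_integrable L2_mult_test_integrable[OF _ test_funs_partial_d]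
  by (simp add: is_weak_partial_def distrib_right)

lemma weak_partial_scale:
  assumes "is_weak_partial \<Omega> i u g"
  shows "is_weak_partial \<Omega> i (\<lambda>x. s * u x) (\<lambda>x. s * g x)"
  using assms by (simp add: is_weak_partial_def mult.assoc)

section \<open>Equivalence classes and their representatives\<close>

lemma ae_class_self: "u \<in> ae_class \<Omega> u"
  by (simp add: ae_class_def)

lemma ae_class_cong: "AE x in M. u x = v x \<Longrightarrow> ae_class \<Omega> u = ae_class \<Omega> v"
proof -
  assume ae: "AE x in M. u x = v x"
  have "(AE x in M. w x = u x) \<longleftrightarrow> (AE x in M. w x = v x)" for w
    by (rule eventually_cong[OF eventually_mono[OF ae]]) auto
  then show ?thesis by (simp add: ae_class_def)
qed

lemma rep_ae_class: "AE x in M. rep (ae_class \<Omega> u) x = u x"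
proof -
  have "rep (ae_class \<Omega> u) \<in> ae_class \<Omega> u" 
    using someI[of "\<lambda>v. v \<in> ae_class \<Omega> u", OF ae_class_self] by (simp add: rep_def)
  then show ?thesis by (simp add: ae_class_def)
qed

lemma H1_D:
  assumes "z \<in> H1 \<Omega>"
  shows "rep z \<in> L2_funs \<Omega>" "ae_class \<Omega> (rep z) = z"
    "weak_partial \<Omega> i z \<in> L2_funs \<Omega>" "is_weak_partial \<Omega> i (rep z) (weak_partial \<Omega> i z)"
proof -
  obtain u where u: "u \<in> H1_funs \<Omega>" "z = ae_class \<Omega> u" using assms by (auto simp: H1_def)
  have ae: "AE x in M. u x = rep z x" using rep_ae_class[of u] unfolding u(2) by eventually_elim simp
  have uL2: "u \<in> L2_funs \<Omega>" using u(1) by (simp add: H1_funs_def)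
  show "rep z \<in> L2_funs \<Omega>" by (rule L2_AE[OF uL2 ae])
  show "ae_class \<Omega> (rep z) = z" using ae_class_cong[OF ae] unfolding u(2)[symmetric] by (rule sym)
  obtain g where g: "g \<in> L2_funs \<Omega>" "is_weak_partial \<Omega> i u g" using u(1) by (auto simp: H1_funs_def)
  have w: "is_weak_partial \<Omega> i (rep z) g" using weak_partial_AE[OF uL2 g(1) ae _ g(2)] by simp
  have "weak_partial \<Omega> i z \<in> L2_funs \<Omega> \<and> is_weak_partial \<Omega> i (rep z) (weak_partial \<Omega> i z)"
    unfolding weak_partial_def
    by (rule someI[of "\<lambda>g. g \<in> L2_funs \<Omega> \<and> is_weak_partial \<Omega> i (rep z) g", OF conjI[OF g(1) w]])
  then show "weak_partial \<Omega> i z \<in> L2_funs \<Omega>" "is_weak_partial \<Omega> i (rep z) (weak_partial \<Omega> i z)" by auto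
qed

text \<open>The way to compute in \<open>H1\<close>: candidates g that satisfy the defining identity
  give membership, and uniqueness identifies the derivative picked by \<open>weak_partial\<close>
  with them.\<close>

lemma H1_I:
  assumes u: "u \<in> L2_funs \<Omega>" and g: "\<And>i. g i \<in> L2_funs \<Omega>" "\<And>i. is_weak_partial \<Omega> i u (g i)"
  shows "ae_class \<Omega> u \<in> H1 \<Omega>" "AE x in M. weak_partial \<Omega> i (ae_class \<Omega> u) x = g i x"
proof -
  show z: "ae_class \<Omega> u \<in> H1 \<Omega>" using assms by (auto simp: H1_def H1_funs_def)
  have "AE x in M. u x = rep (ae_class \<Omega> u) x" using rep_ae_class[of u] by eventually_elim simp
  from weak_partial_AE[OF u g(1) this _ g(2)] have "is_weak_partial \<Omega> i (rep (ae_class \<Omega> u)) (g i)" by simp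
  then show "AE x in M. weak_partial \<Omega> i (ae_class \<Omega> u) x = g i x"
    by (rule weak_partial_unique[OF H1_D(3,4)[OF z] g(1)])
qed

lemma H1_scale:
  assumes z: "z \<in> H1 \<Omega>"
  shows "H1_scale \<Omega> s z \<in> H1 \<Omega>"
  unfolding H1_scale_def using z
  by (intro H1_I(1)[where g="\<lambda>i x. s * weak_partial \<Omega> i z x"] L2_scale weak_partial_scale H1_D)

lemma H1_add:
  assumes z: "z \<in> H1 \<Omega>" and w: "w \<in> H1 \<Omega>"
  shows "H1_add \<Omega> z w \<in> H1 \<Omega>"
  unfolding H1_add_def using z w
  by (intro H1_I(1)[where g="\<lambda>i x. weak_partial \<Omega> i z x + weak_partial \<Omega> i w x"] L2_add weak_partial_add H1_D)

text \<open>Linearity of operators is stated for \<open>H1_add\<close> and \<open>H1_scale\<close>;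
  this carries it over to differences.\<close>

lemma H1_diff_eq: "H1_diff \<Omega> z w = H1_add \<Omega> z (H1_scale \<Omega> (- 1) w)"
proof -
  have "AE x in M. rep z x - rep w x = rep z x + rep (H1_scale \<Omega> (- 1) w) x"
    using rep_ae_class[of "\<lambda>x. - 1 * rep w x"] unfolding H1_scale_def by eventually_elim simp
  then show ?thesis unfolding H1_diff_def H1_add_def by (rule ae_class_cong)
qed

lemma H1_diff:
  assumes z: "z \<in> H1 \<Omega>" and w: "w \<in> H1 \<Omega>"
  shows "H1_diff \<Omega> z w \<in> H1 \<Omega>"
    "AE x in M. rep (H1_diff \<Omega> z w) x = rep z x - rep w x"
    "AE x in M. weak_partial \<Omega> i (H1_diff \<Omega> z w) x = weak_partial \<Omega> i z x - weak_partial \<Omega> i w x"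
proof -
  show "H1_diff \<Omega> z w \<in> H1 \<Omega>" using assms by (simp add: H1_diff_eq H1_add H1_scale)
  show "AE x in M. rep (H1_diff \<Omega> z w) x = rep z x - rep w x"
    unfolding H1_diff_def by (rule rep_ae_class)
  have weak: "is_weak_partial \<Omega> j (\<lambda>x. rep z x - rep w x) (\<lambda>x. weak_partial \<Omega> j z x - weak_partial \<Omega> j w x)" for j
  proof -
    have "is_weak_partial \<Omega> j (\<lambda>x. rep z x + (- 1) * rep w x) (\<lambda>x. weak_partial \<Omega> j z x + (- 1) * weak_partial \<Omega> j w x)"
      by (intro weak_partial_add weak_partial_scale L2_scale H1_D z w)
    then show ?thesis by simp
  qed
  show "AE x in M. weak_partial \<Omega> i (H1_diff \<Omega> z w) x = weak_partial \<Omega> i z x - weak_partial \<Omega> i w x"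
    unfolding H1_diff_def
    by (rule H1_I(2)[where g="\<lambda>i x. weak_partial \<Omega> i z x - weak_partial \<Omega> i w x", OF _ _ weak])
       (intro L2_diff H1_D z w)+
qed

end

context bounded_open
begin

text \<open>No measurability is assumed: if one of the functions is not measurable, neither is the
  other, by completeness, and both integrals are 0 by convention.\<close>

lemma integral_M_cong_AE:
  fixes f g :: plane_fun
  assumes ae: "AE x in M. f x = g x"
  shows "(\<integral>x. f x \<partial>M) = (\<integral>x. g x \<partial>M)"
proof (cases "f \<in> borel_measurable M")
  case True
  then show ?thesis using measurable_M_AE[OF True ae] ae by (intro integral_cong_AE) auto
next
  case False
  have ae': "AE x in M. g x = f x" using ae by eventually_elim simp
  have "g \<notin> borel_measurable M" using measurable_M_AE[OF _ ae'] False by blast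
  then have "\<not> integrable M f" "\<not> integrable M g" using False borel_measurable_integrable by blast+
  then show ?thesis by (simp add: not_integrable_integral_eq)
qed

lemma weak_partial_uminus:
  "is_weak_partial \<Omega> i (\<lambda>x. - u x) (\<lambda>x. - g x) \<longleftrightarrow> is_weak_partial \<Omega> i u g"
  unfolding is_weak_partial_def by (intro ball_cong refl) auto

lemma is_weak_partial_cong_AE:
  assumes ae: "AE x in M. u x = v x"
  shows "is_weak_partial \<Omega> i u g \<longleftrightarrow> is_weak_partial \<Omega> i v g"
proof -
  have "(\<integral>x. u x * partial_d i \<phi> x \<partial>M) = (\<integral>x. v x * partial_d i \<phi> x \<partial>M)" for \<phi>
    by (rule integral_M_cong_AE) (use ae in eventually_elim, simp)
  then show ?thesis by (simp add: is_weak_partial_def)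
qed

text \<open>\<open>Metric_space\<close> asks for a distance that is symmetric for all arguments,
  also outside \<open>H1\<close>, where weak derivatives may fail to exist. If one exists, the two
  differences have opposite derivatives almost everywhere.\<close>

lemma integral_weak_partial_square_commute:
  "(\<integral>x. (weak_partial \<Omega> i (H1_diff \<Omega> z w) x)\<^sup>2 \<partial>M) = (\<integral>x. (weak_partial \<Omega> i (H1_diff \<Omega> w z) x)\<^sup>2 \<partial>M)"
proof -
  let ?p = "H1_diff \<Omega> z w" and ?q = "H1_diff \<Omega> w z"
  let ?P = "\<lambda>g. g \<in> L2_funs \<Omega> \<and> is_weak_partial \<Omega> i (rep ?p) g"
  let ?Q = "\<lambda>g. g \<in> L2_funs \<Omega> \<and> is_weak_partial \<Omega> i (rep ?q) g"
  have ae: "AE x in M. rep ?q x = - rep ?p x"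
    using rep_ae_class[of "\<lambda>x. rep z x - rep w x"] rep_ae_class[of "\<lambda>x. rep w x - rep z x"]
    unfolding H1_diff_def by eventually_elim simp
  have neg: "(\<lambda>x. - g x) \<in> L2_funs \<Omega> \<longleftrightarrow> g \<in> L2_funs \<Omega>" for g
    by (simp add: L2_funs_def)
  have QP: "?Q g \<longleftrightarrow> ?P (\<lambda>x. - g x)" for g
    using is_weak_partial_cong_AE[OF ae, of i g] weak_partial_uminus[of i "rep ?p" "\<lambda>x. - g x"] neg[of g] by simp
  show ?thesis
  proof (cases "\<exists>g. ?P g")
    case True
    then obtain g where "?P g" by blast
    then have P: "?P (weak_partial \<Omega> i ?p)" unfolding weak_partial_def by (rule someI[of ?P])
    have "?Q (\<lambda>x. - weak_partial \<Omega> i ?p x)" using P QP[of "\<lambda>x. - weak_partial \<Omega> i ?p x"] by simp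
    then have "?Q (weak_partial \<Omega> i ?q)" unfolding weak_partial_def[of \<Omega> i ?q] by (rule someI[of ?Q])
    then have "?P (\<lambda>x. - weak_partial \<Omega> i ?q x)" using QP by blast
    then have "AE x in M. weak_partial \<Omega> i ?p x = - weak_partial \<Omega> i ?q x"
      using P weak_partial_unique by blast
    then have "AE x in M. (weak_partial \<Omega> i ?p x)\<^sup>2 = (weak_partial \<Omega> i ?q x)\<^sup>2" by eventually_elim simp
    then show ?thesis by (rule integral_M_cong_AE)
  next
    case False
    \<comment> \<open>Without a weak derivative both choices are made from the empty predicate, so
      they return the same function.\<close>
    then have "?P = (\<lambda>_. False)" by auto
    moreover have "?Q = (\<lambda>_. False)" using False QP by blast
    ultimately have "weak_partial \<Omega> i ?p = weak_partial \<Omega> i ?q" by (simp only: weak_partial_def)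
    then show ?thesis by simp
  qed
qed

lemma H1_dist_commute: "H1_dist \<Omega> z w = H1_dist \<Omega> w z"
proof -
  have "AE x in M. (rep (H1_diff \<Omega> z w) x)\<^sup>2 = (rep (H1_diff \<Omega> w z) x)\<^sup>2"
    using rep_ae_class[of "\<lambda>x. rep z x - rep w x"] rep_ae_class[of "\<lambda>x. rep w x - rep z x"]
    unfolding H1_diff_def by eventually_elim (simp add: power2_commute)
  from integral_M_cong_AE[OF this] show ?thesis
    unfolding H1_dist_def H1_norm_def integral_weak_partial_square_commute[of _ z w] by simp
qed

section \<open>The metric, as the L^2 distance of function and partial derivatives\<close>

lemma H1_dist_eq:
  assumes "z \<in> H1 \<Omega>" "w \<in> H1 \<Omega>"
  shows "H1_dist \<Omega> z w = sqrt ((\<integral>x. (rep z x - rep w x)\<^sup>2 \<partial>M) +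
    (\<integral>x. (weak_partial \<Omega> 1 z x - weak_partial \<Omega> 1 w x)\<^sup>2 \<partial>M) +
    (\<integral>x. (weak_partial \<Omega> 2 z x - weak_partial \<Omega> 2 w x)\<^sup>2 \<partial>M))"
proof -
  have "(\<integral>x. (rep (H1_diff \<Omega> z w) x)\<^sup>2 \<partial>M) = (\<integral>x. (rep z x - rep w x)\<^sup>2 \<partial>M)"
    by (rule integral_M_cong_AE) (use H1_diff(2)[OF assms] in eventually_elim, simp)
  moreover have "(\<integral>x. (weak_partial \<Omega> i (H1_diff \<Omega> z w) x)\<^sup>2 \<partial>M) =
    (\<integral>x. (weak_partial \<Omega> i z x - weak_partial \<Omega> i w x)\<^sup>2 \<partial>M)" for i
    by (rule integral_M_cong_AE) (use H1_diff(3)[OF assms, of i] in eventually_elim, simp)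
  ultimately show ?thesis by (simp add: H1_dist_def H1_norm_def)
qed

lemma integral_square_add:
  assumes f: "f \<in> L2_funs \<Omega>" and g: "g \<in> L2_funs \<Omega>"
  shows "(\<integral>x. (f x + t * g x)\<^sup>2 \<partial>M) = (\<integral>x. (f x)\<^sup>2 \<partial>M) + 2 * (\<integral>x. f x * g x \<partial>M) * t + (\<integral>x. (g x)\<^sup>2 \<partial>M) * t\<^sup>2"
proof -
  have "(\<integral>x. (f x + t * g x)\<^sup>2 \<partial>M) = (\<integral>x. (f x)\<^sup>2 + (2 * t) * (f x * g x) + t\<^sup>2 * (g x)\<^sup>2 \<partial>M)"
    by (intro Bochner_Integration.integral_cong refl) (simp add: power2_sum power_mult_distrib algebra_simps)
  also have "\<dots> = (\<integral>x. (f x)\<^sup>2 \<partial>M) + (2 * t) * (\<integral>x. f x * g x \<partial>M) + t\<^sup>2 * (\<integral>x. (g x)\<^sup>2 \<partial>M)"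
    using L2_integrable_square[OF f] L2_integrable_square[OF g] L2_mult_integrable[OF f g] by simp
  finally show ?thesis by (simp add: mult_ac)
qed

lemma L2_Cauchy_Schwarz:
  assumes f: "f \<in> L2_funs \<Omega>" and g: "g \<in> L2_funs \<Omega>"
  shows "(\<integral>x. f x * g x \<partial>M)\<^sup>2 \<le> (\<integral>x. (f x)\<^sup>2 \<partial>M) * (\<integral>x. (g x)\<^sup>2 \<partial>M)"
proof (rule sqrt_quadratic_form_triangle(1))
  fix t
  have "0 \<le> (\<integral>x. (f x + t * g x)\<^sup>2 \<partial>M)" by simp
  then show "0 \<le> (\<integral>x. (f x)\<^sup>2 \<partial>M) + 2 * (\<integral>x. f x * g x \<partial>M) * t + (\<integral>x. (g x)\<^sup>2 \<partial>M) * t\<^sup>2"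
    by (simp only: integral_square_add[OF f g])
qed auto

text \<open>Minkowski's inequality in the threefold product of L^2, where an element of
  \<open>H1\<close> is represented by itself and its two derivatives.\<close>

lemma L2_triangle3:
  assumes f: "f1 \<in> L2_funs \<Omega>" "f2 \<in> L2_funs \<Omega>" "f3 \<in> L2_funs \<Omega>"
    and g: "g1 \<in> L2_funs \<Omega>" "g2 \<in> L2_funs \<Omega>" "g3 \<in> L2_funs \<Omega>"
  shows "sqrt ((\<integral>x. (f1 x + g1 x)\<^sup>2 \<partial>M) + (\<integral>x. (f2 x + g2 x)\<^sup>2 \<partial>M) + (\<integral>x. (f3 x + g3 x)\<^sup>2 \<partial>M))
    \<le> sqrt ((\<integral>x. (f1 x)\<^sup>2 \<partial>M) + (\<integral>x. (f2 x)\<^sup>2 \<partial>M) + (\<integral>x. (f3 x)\<^sup>2 \<partial>M)) +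
      sqrt ((\<integral>x. (g1 x)\<^sup>2 \<partial>M) + (\<integral>x. (g2 x)\<^sup>2 \<partial>M) + (\<integral>x. (g3 x)\<^sup>2 \<partial>M))"
proof -
  define a where "a = (\<integral>x. (f1 x)\<^sup>2 \<partial>M) + (\<integral>x. (f2 x)\<^sup>2 \<partial>M) + (\<integral>x. (f3 x)\<^sup>2 \<partial>M)"
  define b where "b = (\<integral>x. f1 x * g1 x \<partial>M) + (\<integral>x. f2 x * g2 x \<partial>M) + (\<integral>x. f3 x * g3 x \<partial>M)"
  define c where "c = (\<integral>x. (g1 x)\<^sup>2 \<partial>M) + (\<integral>x. (g2 x)\<^sup>2 \<partial>M) + (\<integral>x. (g3 x)\<^sup>2 \<partial>M)"
  have eq: "(\<integral>x. (f1 x + t * g1 x)\<^sup>2 \<partial>M) + (\<integral>x. (f2 x + t * g2 x)\<^sup>2 \<partial>M) + (\<integral>x. (f3 x + t * g3 x)\<^sup>2 \<partial>M)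
    = a + 2 * b * t + c * t\<^sup>2" for t
    unfolding integral_square_add[OF f(1) g(1)] integral_square_add[OF f(2) g(2)] integral_square_add[OF f(3) g(3)]
    by (simp add: a_def b_def c_def algebra_simps)
  have "sqrt (a + 2 * b + c) \<le> sqrt a + sqrt c"
  proof (rule sqrt_quadratic_form_triangle(2))
    show "0 \<le> a + 2 * b * t + c * t\<^sup>2" for t unfolding eq[symmetric] by (intro add_nonneg_nonneg) auto
  qed (auto simp: a_def c_def)
  then show ?thesis using eq[of 1] by (simp add: a_def c_def)
qed

lemma H1_metric: "Metric_space (H1 \<Omega>) (H1_dist \<Omega>)"
proof
  show "0 \<le> H1_dist \<Omega> z w" for z w by (simp add: H1_dist_def H1_norm_def)
  show "H1_dist \<Omega> z w = H1_dist \<Omega> w z" for z w by (rule H1_dist_commute)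
next
  fix z w assume zw: "z \<in> H1 \<Omega>" "w \<in> H1 \<Omega>"
  show "H1_dist \<Omega> z w = 0 \<longleftrightarrow> z = w"
  proof
    assume "H1_dist \<Omega> z w = 0"
    then have "(\<integral>x. (rep z x - rep w x)\<^sup>2 \<partial>M) + ((\<integral>x. (weak_partial \<Omega> 1 z x - weak_partial \<Omega> 1 w x)\<^sup>2 \<partial>M) +
      (\<integral>x. (weak_partial \<Omega> 2 z x - weak_partial \<Omega> 2 w x)\<^sup>2 \<partial>M)) = 0"
      unfolding H1_dist_eq[OF zw] by (simp add: add.assoc)
    then have "(\<integral>x. (rep z x - rep w x)\<^sup>2 \<partial>M) = 0"
      by (subst (asm) add_nonneg_eq_0_iff) auto
    then have "AE x in M. (rep z x - rep w x)\<^sup>2 = 0"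
      using L2_integrable_square[OF L2_diff[OF H1_D(1)[OF zw(1)] H1_D(1)[OF zw(2)]]]
      by (subst (asm) integral_nonneg_eq_0_iff_AE) auto
    then have "AE x in M. rep z x = rep w x" by eventually_elim simp
    from ae_class_cong[OF this] show "z = w" unfolding H1_D(2)[OF zw(1)] H1_D(2)[OF zw(2)] .
  next
    assume "z = w"
    then show "H1_dist \<Omega> z w = 0" unfolding H1_dist_eq[OF zw] by simp
  qed
next
  fix z w v assume zw: "z \<in> H1 \<Omega>" "w \<in> H1 \<Omega>" "v \<in> H1 \<Omega>"
  have L2: "(\<lambda>x. rep p x - rep q x) \<in> L2_funs \<Omega>" "(\<lambda>x. weak_partial \<Omega> i p x - weak_partial \<Omega> i q x) \<in> L2_funs \<Omega>"
    if "p \<in> H1 \<Omega>" "q \<in> H1 \<Omega>" for p q i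
    using that by (intro L2_diff H1_D; simp)+
  note pq = L2[OF zw(1,2)] and qr = L2[OF zw(2,3)]
  from L2_triangle3[OF pq(1) pq(2)[of 1] pq(2)[of 2] qr(1) qr(2)[of 1] qr(2)[of 2]]
  show "H1_dist \<Omega> z v \<le> H1_dist \<Omega> z w + H1_dist \<Omega> w v"
    unfolding H1_dist_eq[OF zw(1,2)] H1_dist_eq[OF zw(2,3)] H1_dist_eq[OF zw(1,3)] by simp
qed

lemma H1_dist_bounds:
  assumes "z \<in> H1 \<Omega>" "w \<in> H1 \<Omega>"
  shows "(\<integral>x. (rep w x - rep z x)\<^sup>2 \<partial>M) \<le> (H1_dist \<Omega> z w)\<^sup>2"
    "(\<integral>x. (weak_partial \<Omega> i w x - weak_partial \<Omega> i z x)\<^sup>2 \<partial>M) \<le> (H1_dist \<Omega> z w)\<^sup>2"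
proof -
  let ?a = "\<integral>x. (rep w x - rep z x)\<^sup>2 \<partial>M"
  let ?b = "\<lambda>i. \<integral>x. (weak_partial \<Omega> i w x - weak_partial \<Omega> i z x)\<^sup>2 \<partial>M"
  have nonneg: "0 \<le> ?a" "0 \<le> ?b i" for i by auto
  have "(H1_dist \<Omega> z w)\<^sup>2 = ?a + ?b 1 + ?b 2"
    unfolding H1_dist_commute[of z w] H1_dist_eq[OF assms(2,1)] by (subst real_sqrt_pow2) auto
  with nonneg(1) nonneg(2)[of 1] nonneg(2)[of 2] exhaust_2[of i]
  show "?a \<le> (H1_dist \<Omega> z w)\<^sup>2" "?b i \<le> (H1_dist \<Omega> z w)\<^sup>2" by auto
qed

section \<open>Borel sets of the metric and the total variation\<close>

lemma space_H1_borel: "space (H1_borel \<Omega>) = H1 \<Omega>"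
  and sets_H1_borel: "openin (Metric_space.mtopology (H1 \<Omega>) (H1_dist \<Omega>)) U \<Longrightarrow> U \<in> sets (H1_borel \<Omega>)"
proof -
  have "{U. openin (Metric_space.mtopology (H1 \<Omega>) (H1_dist \<Omega>)) U} \<subseteq> Pow (H1 \<Omega>)"
    using Metric_space.openin_mtopology[OF H1_metric] by auto
  then show "space (H1_borel \<Omega>) = H1 \<Omega>"
    "openin (Metric_space.mtopology (H1 \<Omega>) (H1_dist \<Omega>)) U \<Longrightarrow> U \<in> sets (H1_borel \<Omega>)"
    unfolding H1_borel_def by (auto simp: space_measure_of_conv sets_measure_of)
qed

lemma borel_measurable_H1_borelI:
  fixes f :: "ae_fun \<Rightarrow> real"
  assumes cont: "\<And>z e. z \<in> H1 \<Omega> \<Longrightarrow> e > 0 \<Longrightarrow> \<exists>d>0. \<forall>w\<in>H1 \<Omega>. H1_dist \<Omega> z w < d \<longrightarrow> \<bar>f w - f z\<bar> < e"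
  shows "f \<in> borel_measurable (H1_borel \<Omega>)"
  unfolding borel_measurable_iff_greater space_H1_borel
proof
  fix s
  show "{w \<in> H1 \<Omega>. s < f w} \<in> sets (H1_borel \<Omega>)"
  proof (rule sets_H1_borel, unfold Metric_space.openin_mtopology[OF H1_metric], intro conjI allI impI)
    fix z assume "z \<in> {w \<in> H1 \<Omega>. s < f w}"
    then have z: "z \<in> H1 \<Omega>" "0 < f z - s" by auto
    obtain d where d: "d > 0" "\<forall>w\<in>H1 \<Omega>. H1_dist \<Omega> z w < d \<longrightarrow> \<bar>f w - f z\<bar> < f z - s"
      using cont[OF z] by blast
    have "Metric_space.mball (H1 \<Omega>) (H1_dist \<Omega>) z d \<subseteq> {w \<in> H1 \<Omega>. s < f w}"
    proof
      fix w assume "w \<in> Metric_space.mball (H1 \<Omega>) (H1_dist \<Omega>) z d"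
      then have w: "w \<in> H1 \<Omega>" "H1_dist \<Omega> z w < d" by (simp_all add: Metric_space.in_mball[OF H1_metric])
      then have "\<bar>f w - f z\<bar> < f z - s" using d(2) by blast
      then show "w \<in> {w \<in> H1 \<Omega>. s < f w}" using w(1) by simp
    qed
    then show "\<exists>r>0. Metric_space.mball (H1 \<Omega>) (H1_dist \<Omega>) z r \<subseteq> {w \<in> H1 \<Omega>. s < f w}"
      using d(1) by blast
  qed auto
qed

lemma integral_abs_le_sqrt:
  assumes "f \<in> L2_funs \<Omega>"
  shows "(\<integral>x. \<bar>f x\<bar> \<partial>M) \<le> sqrt (measure M \<Omega>) * sqrt (\<integral>x. (f x)\<^sup>2 \<partial>M)"
proof -
  have f: "(\<lambda>x. \<bar>f x\<bar>) \<in> L2_funs \<Omega>" using assms by (auto simp: L2_funs_def)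
  have "(\<integral>x. \<bar>f x\<bar> * 1 \<partial>M)\<^sup>2 \<le> (\<integral>x. \<bar>f x\<bar>\<^sup>2 \<partial>M) * (\<integral>x. 1\<^sup>2 \<partial>M)"
    by (rule L2_Cauchy_Schwarz[OF f L2_const])
  then have "(\<integral>x. \<bar>f x\<bar> \<partial>M)\<^sup>2 \<le> measure M \<Omega> * (\<integral>x. (f x)\<^sup>2 \<partial>M)"
    by (simp add: mult.commute)
  from real_le_rsqrt[OF this] show ?thesis by (simp add: real_sqrt_mult)
qed

lemma TV_eq: "TV \<Omega> z = (\<integral>x. sqrt ((weak_partial \<Omega> 1 z x)\<^sup>2 + (weak_partial \<Omega> 2 z x)\<^sup>2) \<partial>M)"
  by (simp add: TV_def norm_vec_def L2_set_def UNIV_2)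

lemma TV_nonneg: "0 \<le> TV \<Omega> z"
  unfolding TV_def by simp

text \<open>Lengths of gradients differ by at most the sum of the component differences, and on a
  set of finite measure Cauchy-Schwarz against 1 bounds each L^1 norm by the L^2 norm. The factor 2
  counts the components.\<close>

lemma TV_Lipschitz:
  assumes "z \<in> H1 \<Omega>" "w \<in> H1 \<Omega>"
  shows "\<bar>TV \<Omega> w - TV \<Omega> z\<bar> \<le> 2 * sqrt (measure M \<Omega>) * H1_dist \<Omega> z w"
proof -
  define n where "n z x = sqrt ((weak_partial \<Omega> 1 z x)\<^sup>2 + (weak_partial \<Omega> 2 z x)\<^sup>2)" for z x
  define d where "d i x = weak_partial \<Omega> i w x - weak_partial \<Omega> i z x" for i x
  have dL2: "d i \<in> L2_funs \<Omega>" for i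
    unfolding d_def[abs_def] by (intro L2_diff H1_D assms)
  have n_int: "integrable M (n v)" if v: "v \<in> H1 \<Omega>" for v
  proof (rule Bochner_Integration.integrable_bound)
    show "integrable M (\<lambda>x. \<bar>weak_partial \<Omega> 1 v x\<bar> + \<bar>weak_partial \<Omega> 2 v x\<bar>)"
      using L2_integrable H1_D(3)[OF v] by auto
    show "n v \<in> borel_measurable M"
      unfolding n_def[abs_def] using L2_measurable[OF H1_D(3)[OF v, of 1]] L2_measurable[OF H1_D(3)[OF v, of 2]] by measurable
    show "AE x in M. norm (n v x) \<le> norm (\<bar>weak_partial \<Omega> 1 v x\<bar> + \<bar>weak_partial \<Omega> 2 v x\<bar>)"
      using sqrt_sum_squares_le_sum_abs by (auto simp: n_def)
  qed
  have "\<bar>n w x - n z x\<bar> \<le> \<bar>d 1 x\<bar> + \<bar>d 2 x\<bar>" for x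
  proof -
    have tri: "sqrt ((p + p')\<^sup>2 + (q + q')\<^sup>2) \<le> sqrt (p\<^sup>2 + q\<^sup>2) + \<bar>p'\<bar> + \<bar>q'\<bar>" for p p' q q' :: real
      using real_sqrt_sum_squares_triangle_ineq[of p p' q q'] sqrt_sum_squares_le_sum_abs[of p' q'] by linarith
    show ?thesis
      using tri[of "weak_partial \<Omega> 1 z x" "d 1 x" "weak_partial \<Omega> 2 z x" "d 2 x"]
        tri[of "weak_partial \<Omega> 1 w x" "- d 1 x" "weak_partial \<Omega> 2 w x" "- d 2 x"]
      by (simp add: n_def d_def abs_le_iff)
  qed
  then have "(\<integral>x. \<bar>n w x - n z x\<bar> \<partial>M) \<le> (\<integral>x. \<bar>d 1 x\<bar> + \<bar>d 2 x\<bar> \<partial>M)"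
    using n_int assms L2_integrable[OF dL2] by (intro integral_mono) auto
  also have "\<dots> = (\<integral>x. \<bar>d 1 x\<bar> \<partial>M) + (\<integral>x. \<bar>d 2 x\<bar> \<partial>M)"
    using L2_integrable[OF dL2] by simp
  also have "\<dots> \<le> sqrt (measure M \<Omega>) * H1_dist \<Omega> z w + sqrt (measure M \<Omega>) * H1_dist \<Omega> z w"
  proof -
    have "(\<integral>x. \<bar>d i x\<bar> \<partial>M) \<le> sqrt (measure M \<Omega>) * H1_dist \<Omega> z w" for i
    proof -
    have "0 \<le> H1_dist \<Omega> z w" by (simp add: H1_dist_def H1_norm_def)
    then have "sqrt (\<integral>x. (d i x)\<^sup>2 \<partial>M) \<le> H1_dist \<Omega> z w"
      using H1_dist_bounds(2)[OF assms, of i] unfolding d_def by (intro real_le_lsqrt) auto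
    then have "sqrt (measure M \<Omega>) * sqrt (\<integral>x. (d i x)\<^sup>2 \<partial>M) \<le> sqrt (measure M \<Omega>) * H1_dist \<Omega> z w"
      by (intro mult_left_mono) auto
    with integral_abs_le_sqrt[OF dL2[of i]]
    show ?thesis by linarith
    qed
    then show ?thesis by (intro add_mono)
  qed
  finally have le: "(\<integral>x. \<bar>n w x - n z x\<bar> \<partial>M) \<le> 2 * sqrt (measure M \<Omega>) * H1_dist \<Omega> z w"
    by linarith
  have eq: "TV \<Omega> w - TV \<Omega> z = (\<integral>x. n w x - n z x \<partial>M)"
    using n_int assms by (simp add: TV_eq n_def[abs_def])
  show ?thesis unfolding eq by (rule order_trans[OF integral_abs_bound le])
qed

lemma TV_measurable: "TV \<Omega> \<in> borel_measurable (H1_borel \<Omega>)"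
proof (rule borel_measurable_H1_borelI)
  fix z and e :: real assume z: "z \<in> H1 \<Omega>" and e: "e > 0"
  define K where "K = 2 * sqrt (measure M \<Omega>)"
  have K: "K \<ge> 0" by (simp add: K_def)
  show "\<exists>d>0. \<forall>w\<in>H1 \<Omega>. H1_dist \<Omega> z w < d \<longrightarrow> \<bar>TV \<Omega> w - TV \<Omega> z\<bar> < e"
  \<comment> \<open>K is 0 when \<Omega> is a null set, for example empty, so K + 1 is the
    divisor.\<close>
  proof (intro exI[of _ "e / (K + 1)"] conjI ballI impI)
    show "e / (K + 1) > 0" using e K by simp
    fix w assume w: "w \<in> H1 \<Omega>" "H1_dist \<Omega> z w < e / (K + 1)"
    have "0 \<le> H1_dist \<Omega> z w" by (simp add: H1_dist_def H1_norm_def)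
    then have "K * H1_dist \<Omega> z w \<le> (K + 1) * H1_dist \<Omega> z w" by (intro mult_right_mono) auto
    also have "\<dots> < e" using w(2) K by (simp add: field_simps)
    finally show "\<bar>TV \<Omega> w - TV \<Omega> z\<bar> < e" using TV_Lipschitz[OF z w(1)] by (simp add: K_def)
  qed
qed

end

section \<open>Gibbs measures and the Hellinger distance\<close>

lemma abs_exp_diff_le:
  fixes s t :: real
  assumes "s \<le> c" "t \<le> c"
  shows "\<bar>exp s - exp t\<bar> \<le> exp c * \<bar>s - t\<bar>"
proof -
  have *: "exp x - exp y \<le> exp c * \<bar>x - y\<bar>" if "x \<le> c" for x y :: real
  proof -
    have "exp x * (1 + (y - x)) \<le> exp x * exp (y - x)" by (intro mult_left_mono exp_ge_add_one_self) simp
    then have "exp x - exp y \<le> exp x * (x - y)" by (simp add: exp_diff algebra_simps)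
    also have "\<dots> \<le> exp x * \<bar>x - y\<bar>" by (intro mult_left_mono) auto
    also have "\<dots> \<le> exp c * \<bar>x - y\<bar>" using that by (intro mult_right_mono) auto
    finally show ?thesis .
  qed
  show ?thesis using *[OF assms(1), of t] *[OF assms(2), of s] by (simp add: abs_minus_commute abs_le_iff)
qed

locale bounded_potential = prob_space \<mu> for \<mu> :: "'a measure" +
  fixes V :: "'a \<Rightarrow> real" and m :: real
  assumes V_measurable [measurable]: "V \<in> borel_measurable \<mu>"
    and V_ge: "\<And>z. z \<in> space \<mu> \<Longrightarrow> m \<le> V z"
begin

definition Z :: real where "Z = (\<integral>z. exp (- V z) \<partial>\<mu>)"

lemma exp_integrable: "integrable \<mu> (\<lambda>z. exp (- V z))"
  by (rule integrable_const_bound[where B="exp (- m)"]) (use V_ge in \<open>auto intro!: AE_I2\<close>)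

lemma gibbs_const_eq: "gibbs_const \<mu> V = ennreal Z"
  unfolding gibbs_const_def Z_def by (rule nn_integral_eq_integral[OF exp_integrable]) simp

text \<open>A strictly positive function on a probability space cannot have integral 0; a lower
  bound for Z in terms of V is not asked for.\<close>

lemma Z_pos: "0 < Z"
proof -
  have "Z \<noteq> 0"
  proof
    assume "Z = 0"
    then have "AE z in \<mu>. exp (- V z) = 0"
      unfolding Z_def using exp_integrable by (subst (asm) integral_nonneg_eq_0_iff_AE) auto
    then have "AE z in \<mu>. False" by eventually_elim simp
    then show False by simp
  qed
  moreover have "0 \<le> Z" unfolding Z_def by simp
  ultimately show ?thesis by simp
qed

lemma gibbs_eq: "gibbs \<mu> V = density \<mu> (\<lambda>z. ennreal (exp (- V z) / Z))"
  unfolding gibbs_def gibbs_const_eq using Z_pos by (simp add: divide_ennreal)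

lemma prob_space_gibbs: "prob_space (gibbs \<mu> V)"
proof
  have "emeasure (gibbs \<mu> V) (space (gibbs \<mu> V)) = (\<integral>\<^sup>+z. ennreal (exp (- V z) / Z) \<partial>\<mu>)"
    unfolding gibbs_eq by (simp add: emeasure_density cong: nn_integral_cong)
  also have "\<dots> = ennreal (\<integral>z. exp (- V z) / Z \<partial>\<mu>)"
    using exp_integrable Z_pos by (intro nn_integral_eq_integral) auto
  also have "(\<integral>z. exp (- V z) / Z \<partial>\<mu>) = 1" using Z_pos by (simp add: Z_def)
  finally show "emeasure (gibbs \<mu> V) (space (gibbs \<mu> V)) = 1" by simp
qed

lemma RN_deriv_gibbs: "AE z in \<mu>. enn2real (RN_deriv \<mu> (gibbs \<mu> V) z) = exp (- V z) / Z"
proof -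
  have "AE z in \<mu>. ennreal (exp (- V z) / Z) = RN_deriv \<mu> (gibbs \<mu> V) z"
    by (rule RN_deriv_unique) (simp_all add: gibbs_eq)
  then show ?thesis
  proof eventually_elim
    case (elim z)
    then show ?case using Z_pos by (simp flip: elim)
  qed
qed

end

text \<open>The lower bound m is shared, because exp (- m) serves as a common Lipschitz constant of
  the exponential on the values of - V and - W.\<close>

locale two_potentials = V: bounded_potential \<mu> V m + W: bounded_potential \<mu> W m
  for \<mu> :: "'a measure" and V W :: "'a \<Rightarrow> real" and m :: real
begin

definition p where "p z = exp (- V z) / V.Z"
definition q where "q z = exp (- W z) / W.Z"

lemma p_q: "integrable \<mu> p" "integrable \<mu> q" "(\<integral>z. p z \<partial>\<mu>) = 1" "(\<integral>z. q z \<partial>\<mu>) = 1" "p z > 0" "q z > 0"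
  using V.exp_integrable W.exp_integrable V.Z_pos W.Z_pos
  by (simp_all add: p_def[abs_def] q_def[abs_def] flip: V.Z_def W.Z_def)

lemma p_q_measurable [measurable]: "p \<in> borel_measurable \<mu>" "q \<in> borel_measurable \<mu>"
  by (auto simp: p_def[abs_def] q_def[abs_def])

lemma hellinger_eq: "hellinger \<mu> (gibbs \<mu> V) (gibbs \<mu> W) = sqrt (1 / 2 * (\<integral>z. (sqrt (p z) - sqrt (q z))\<^sup>2 \<partial>\<mu>))"
proof -
  have "AE z in \<mu>. (sqrt (enn2real (RN_deriv \<mu> (gibbs \<mu> V) z)) - sqrt (enn2real (RN_deriv \<mu> (gibbs \<mu> W) z)))\<^sup>2
    = (sqrt (p z) - sqrt (q z))\<^sup>2"
    using V.RN_deriv_gibbs W.RN_deriv_gibbs by eventually_elim (simp add: p_def q_def)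
  then show ?thesis unfolding hellinger_def by (subst integral_cong_AE) auto
qed

lemma sqrt_diff_square_le: "(sqrt (p z) - sqrt (q z))\<^sup>2 \<le> \<bar>p z - q z\<bar>"
proof -
  have "\<bar>sqrt (p z) - sqrt (q z)\<bar> \<le> sqrt (p z) + sqrt (q z)"
    using p_q(5,6)[of z] by (simp add: abs_le_iff)
  then have "\<bar>sqrt (p z) - sqrt (q z)\<bar> * \<bar>sqrt (p z) - sqrt (q z)\<bar> \<le>
    \<bar>sqrt (p z) - sqrt (q z)\<bar> * \<bar>sqrt (p z) + sqrt (q z)\<bar>"
    by (intro mult_left_mono) auto
  also have "\<dots> = \<bar>(sqrt (p z))\<^sup>2 - (sqrt (q z))\<^sup>2\<bar>"
    by (simp add: abs_mult[symmetric] power2_eq_square algebra_simps)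
  finally show ?thesis using p_q(5,6)[of z] by (simp add: power2_eq_square)
qed

lemma integrable_sqrt_diff: "integrable \<mu> (\<lambda>z. (sqrt (p z) - sqrt (q z))\<^sup>2)"
  using p_q(1,2) by (rule Bochner_Integration.integrable_bound[OF Bochner_Integration.integrable_diff])
    (use sqrt_diff_square_le in auto)

text \<open>The logarithm of \<open>sqrt (p z)\<close> is - (V z + ln Z) / 2. V and ln Z each change
  by at most \<delta>, so the logarithms differ by at most \<delta>. Multiplying by the larger root
  density and integrating the square gives at most 2 \<delta>^2, as p and q have mass 1. The result
  does not involve m.\<close>

lemma hellinger_le_sup:
  assumes le: "\<And>z. z \<in> space \<mu> \<Longrightarrow> \<bar>V z - W z\<bar> \<le> \<delta>"
  shows "hellinger \<mu> (gibbs \<mu> V) (gibbs \<mu> W) \<le> \<delta>"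
proof -
  obtain z0 where "z0 \<in> space \<mu>" using V.not_empty by auto
  then have \<delta>: "0 \<le> \<delta>" using le[of z0] by linarith
  \<comment> \<open>Stated for arbitrary f and g so that it can be used in both directions.\<close>
  have ln_le: "ln (\<integral>z. exp (- g z) \<partial>\<mu>) - ln (\<integral>z. exp (- f z) \<partial>\<mu>) \<le> \<delta>"
    if int: "integrable \<mu> (\<lambda>z. exp (- f z))" "integrable \<mu> (\<lambda>z. exp (- g z))"
      and pos: "0 < (\<integral>z. exp (- f z) \<partial>\<mu>)" "0 < (\<integral>z. exp (- g z) \<partial>\<mu>)"
      and fg: "\<And>z. z \<in> space \<mu> \<Longrightarrow> f z - g z \<le> \<delta>" for f g :: "'a \<Rightarrow> real"
  proof -
    have "(\<integral>z. exp (- g z) \<partial>\<mu>) \<le> (\<integral>z. exp \<delta> * exp (- f z) \<partial>\<mu>)"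
    proof (rule integral_mono)
      show "exp (- g z) \<le> exp \<delta> * exp (- f z)" if "z \<in> space \<mu>" for z
        using fg[OF that] by (simp add: exp_add[symmetric])
    qed (use int in simp_all)
    then have "ln (\<integral>z. exp (- g z) \<partial>\<mu>) \<le> ln (exp \<delta> * (\<integral>z. exp (- f z) \<partial>\<mu>))"
      using pos by simp
    also have "\<dots> = \<delta> + ln (\<integral>z. exp (- f z) \<partial>\<mu>)" using pos by (simp add: ln_mult)
    finally show ?thesis by simp
  qed
  have "ln W.Z - ln V.Z \<le> \<delta>" "ln V.Z - ln W.Z \<le> \<delta>"
    unfolding V.Z_def W.Z_def using le V.exp_integrable W.exp_integrable V.Z_pos W.Z_pos
    by (auto intro!: ln_le simp: V.Z_def W.Z_def abs_le_iff)
  then have lnZ: "\<bar>ln V.Z - ln W.Z\<bar> \<le> \<delta>" by linarith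
  have sq: "sqrt (exp (- v) / z) = exp (- (v + ln z) / 2)" if "z > 0" for v z :: real
  proof -
    have "(exp (- (v + ln z) / 2))\<^sup>2 = exp (2 * (- (v + ln z) / 2))" by (simp only: exp_double)
    also have "2 * (- (v + ln z) / 2) = - v - ln z" by simp
    also have "exp (- v - ln z) = exp (- v) / z" using that by (simp add: exp_diff)
    finally have "exp (- v) / z = (exp (- (v + ln z) / 2))\<^sup>2" by (rule sym)
    then show ?thesis by simp
  qed
  have bound: "(sqrt (p z) - sqrt (q z))\<^sup>2 \<le> \<delta>\<^sup>2 * (p z + q z)" if z: "z \<in> space \<mu>" for z
  proof -
    define s t where "s = - (V z + ln V.Z) / 2" and "t = - (W z + ln W.Z) / 2"
    have st: "sqrt (p z) = exp s" "sqrt (q z) = exp t"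
      using sq[OF V.Z_pos] sq[OF W.Z_pos] by (simp_all add: p_def q_def s_def t_def)
    have "2 * s - 2 * t = (W z - V z) + (ln W.Z - ln V.Z)" by (simp add: s_def t_def field_simps)
    then have "\<bar>s - t\<bar> \<le> \<delta>" using le[OF z] lnZ by linarith
    then have "\<bar>exp s - exp t\<bar> \<le> exp (max s t) * \<delta>"
      by (intro order_trans[OF abs_exp_diff_le mult_left_mono]) auto
    then have "(exp s - exp t)\<^sup>2 \<le> (exp (max s t) * \<delta>)\<^sup>2" by (simp add: abs_le_square_iff[symmetric] abs_mult \<delta>)
    also have "\<dots> = \<delta>\<^sup>2 * (exp (max s t))\<^sup>2" by (simp add: power_mult_distrib mult.commute)
    \<comment> \<open>The maximum is one of s and t, so its squared exponential is one of the two
      summands p z and q z.\<close>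
    also have "\<dots> \<le> \<delta>\<^sup>2 * ((exp s)\<^sup>2 + (exp t)\<^sup>2)" by (intro mult_left_mono) (auto simp: max_def)
    finally show ?thesis unfolding st[symmetric] using p_q(5,6)[of z] by simp
  qed
  have "(\<integral>z. (sqrt (p z) - sqrt (q z))\<^sup>2 \<partial>\<mu>) \<le> (\<integral>z. \<delta>\<^sup>2 * (p z + q z) \<partial>\<mu>)"
    using bound integrable_sqrt_diff p_q(1,2) by (intro integral_mono) auto
  also have "\<dots> = 2 * \<delta>\<^sup>2" using p_q(1-4) by simp
  finally have "1 / 2 * (\<integral>z. (sqrt (p z) - sqrt (q z))\<^sup>2 \<partial>\<mu>) \<le> \<delta>\<^sup>2" by simp
  then show ?thesis unfolding hellinger_eq by (intro real_le_lsqrt \<delta>)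
qed

text \<open>The squared difference of roots is at most \<bar>p - q\<bar>. In p - q the change of the
  normalizing constant is put on q, which has mass 1, so that only the constant of V is divided by.
  The two terms contribute D / Z each, and the factor 1/2 of the Hellinger distance removes the
  2.\<close>

lemma hellinger_square_le: "(hellinger \<mu> (gibbs \<mu> V) (gibbs \<mu> W))\<^sup>2 \<le> (\<integral>z. \<bar>exp (- V z) - exp (- W z)\<bar> \<partial>\<mu>) / V.Z"
proof -
  define D where "D = (\<integral>z. \<bar>exp (- V z) - exp (- W z)\<bar> \<partial>\<mu>)"
  have ZD: "\<bar>V.Z - W.Z\<bar> \<le> D"
    unfolding V.Z_def W.Z_def D_def
    using integral_abs_bound[of \<mu> "\<lambda>z. exp (- V z) - exp (- W z)"] V.exp_integrable W.exp_integrable by simp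
  have "p z - q z = (exp (- V z) - exp (- W z)) / V.Z + q z * ((W.Z - V.Z) / V.Z)" for z
    using V.Z_pos W.Z_pos by (simp add: p_def q_def field_simps)
  then have "\<bar>p z - q z\<bar> \<le> \<bar>exp (- V z) - exp (- W z)\<bar> / V.Z + q z * (D / V.Z)" for z
    using V.Z_pos p_q(6)[of z] ZD
    by (auto simp: abs_mult intro!: order_trans[OF abs_triangle_ineq] add_mono mult_left_mono divide_right_mono)
  then have "(\<integral>z. \<bar>p z - q z\<bar> \<partial>\<mu>) \<le> (\<integral>z. \<bar>exp (- V z) - exp (- W z)\<bar> / V.Z + q z * (D / V.Z) \<partial>\<mu>)"
    using p_q(1,2) V.exp_integrable W.exp_integrable by (intro integral_mono) auto
  also have "\<dots> = 2 * (D / V.Z)"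
    using p_q(1-4) V.exp_integrable W.exp_integrable by (simp add: D_def)
  finally have 1: "(\<integral>z. \<bar>p z - q z\<bar> \<partial>\<mu>) \<le> 2 * (D / V.Z)" .
  have "(\<integral>z. (sqrt (p z) - sqrt (q z))\<^sup>2 \<partial>\<mu>) \<le> (\<integral>z. \<bar>p z - q z\<bar> \<partial>\<mu>)"
    using integrable_sqrt_diff p_q(1,2) sqrt_diff_square_le by (intro integral_mono) auto
  with 1 have "1 / 2 * (\<integral>z. (sqrt (p z) - sqrt (q z))\<^sup>2 \<partial>\<mu>) \<le> D / V.Z" by linarith
  then show ?thesis unfolding hellinger_eq D_def[symmetric] by (subst real_sqrt_pow2) auto
qed

text \<open>On E the exponential is Lipschitz with constant exp (- m); off E both exponentials lie
  between 0 and exp (- m), so their difference is at most exp (- m), on a set of measure at most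
  \<epsilon>.\<close>

lemma hellinger_square_le_event:
  assumes E: "E \<in> sets \<mu>" "measure \<mu> E \<ge> 1 - \<epsilon>" and \<eta>: "\<And>z. z \<in> E \<Longrightarrow> \<bar>V z - W z\<bar> \<le> \<eta>" "0 \<le> \<eta>"
  shows "(hellinger \<mu> (gibbs \<mu> V) (gibbs \<mu> W))\<^sup>2 \<le> exp (- m) * (\<eta> + \<epsilon>) / V.Z"
proof -
  have "\<bar>exp (- V z) - exp (- W z)\<bar> \<le> exp (- m) * (\<eta> + indicator (space \<mu> - E) z)" if z: "z \<in> space \<mu>" for z
  proof (cases "z \<in> E")
    case True
    have "\<bar>exp (- V z) - exp (- W z)\<bar> \<le> exp (- m) * \<bar>- V z - - W z\<bar>"
      by (rule abs_exp_diff_le) (use V.V_ge W.V_ge z in auto)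
    also have "\<bar>- V z - - W z\<bar> = \<bar>V z - W z\<bar>" by (simp add: abs_minus_commute)
    also have "exp (- m) * \<dots> \<le> exp (- m) * \<eta>" using \<eta>(1)[OF True] by simp
    finally show ?thesis using True by simp
  next
    case False
    have "0 < exp (- V z)" "exp (- V z) \<le> exp (- m)" "0 < exp (- W z)" "exp (- W z) \<le> exp (- m)"
      using V.V_ge[OF z] W.V_ge[OF z] by auto
    then have "\<bar>exp (- V z) - exp (- W z)\<bar> \<le> exp (- m) * 1" by linarith
    also have "\<dots> \<le> exp (- m) * (\<eta> + indicator (space \<mu> - E) z)"
      using False z \<eta>(2) by (intro mult_left_mono) auto
    finally show ?thesis .
  qed
  then have "(\<integral>z. \<bar>exp (- V z) - exp (- W z)\<bar> \<partial>\<mu>) \<le> (\<integral>z. exp (- m) * (\<eta> + indicator (space \<mu> - E) z) \<partial>\<mu>)"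
  proof (intro integral_mono)
    have "integrable \<mu> (indicator (space \<mu> - E) :: 'a \<Rightarrow> real)" using E(1) by (simp add: V.emeasure_eq_measure)
    then show "integrable \<mu> (\<lambda>z. exp (- m) * (\<eta> + indicator (space \<mu> - E) z))" by simp
  qed (use V.exp_integrable W.exp_integrable in auto)
  also have "\<dots> = exp (- m) * (\<eta> + measure \<mu> (space \<mu> - E))"
    using E(1) by (simp add: V.prob_space V.emeasure_eq_measure)
  also have "\<dots> \<le> exp (- m) * (\<eta> + \<epsilon>)"
    using E by (intro mult_left_mono) (auto simp: V.prob_compl)
  finally have "(\<integral>z. \<bar>exp (- V z) - exp (- W z)\<bar> \<partial>\<mu>) / V.Z \<le> exp (- m) * (\<eta> + \<epsilon>) / V.Z"
    using V.Z_pos by (simp add: divide_right_mono)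
  with hellinger_square_le show ?thesis by linarith
qed

lemma hellinger_nonneg: "0 \<le> hellinger \<mu> (gibbs \<mu> V) (gibbs \<mu> W)"
  unfolding hellinger_def by simp

end

section \<open>Composition with a function with Lipschitz derivative\<close>

locale C11_function =
  fixes F F' :: "real \<Rightarrow> real" and B L :: real
  assumes deriv: "\<And>s. (F has_real_derivative F' s) (at s)"
    and F_bound: "\<And>s. \<bar>F s\<bar> \<le> B" and F'_bound: "\<And>s. \<bar>F' s\<bar> \<le> B"
    and F'_Lipschitz: "\<And>s t. \<bar>F' s - F' t\<bar> \<le> L * \<bar>s - t\<bar>"
begin

lemma L_nonneg: "0 \<le> L" using F'_Lipschitz[of 1 0] by simp

text \<open>The position of x is expressed by its distance from t, which treats both orders of s and
  t alike.\<close>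

lemma mean_value:
  obtains x where "\<bar>x - t\<bar> \<le> \<bar>s - t\<bar>" "F s - F t = F' x * (s - t)"
proof (cases s t rule: linorder_cases)
  case less
  obtain x where "s < x" "x < t" "F t - F s = (t - s) * F' x" using MVT2[OF less] deriv by metis
  then show ?thesis by (intro that[of x]) (auto simp: algebra_simps)
next
  case equal then show ?thesis by (intro that[of t]) auto
next
  case greater
  obtain x where "t < x" "x < s" "F s - F t = (s - t) * F' x" using MVT2[OF greater] deriv by metis
  then show ?thesis by (intro that[of x]) (auto simp: algebra_simps)
qed

lemma F_Lipschitz: "\<bar>F s - F t\<bar> \<le> B * \<bar>s - t\<bar>"
proof -
  obtain x where "F s - F t = F' x * (s - t)" using mean_value by metis
  then show ?thesis using F'_bound[of x] by (simp add: abs_mult mult_right_mono)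
qed

text \<open>The mean value theorem combined with the Lipschitz bound gives L where an integral
  remainder would give L / 2.\<close>

lemma taylor: "\<bar>F s - F t - F' t * (s - t)\<bar> \<le> L * (s - t)\<^sup>2"
proof -
  obtain x where x: "\<bar>x - t\<bar> \<le> \<bar>s - t\<bar>" "F s - F t = F' x * (s - t)" by (rule mean_value)
  have "\<bar>F' x - F' t\<bar> \<le> L * \<bar>s - t\<bar>"
    using F'_Lipschitz[of x t] mult_left_mono[OF x(1) L_nonneg] by linarith
  then have "\<bar>F' x - F' t\<bar> * \<bar>s - t\<bar> \<le> L * \<bar>s - t\<bar> * \<bar>s - t\<bar>" by (rule mult_right_mono) simp
  also have "L * \<bar>s - t\<bar> * \<bar>s - t\<bar> = L * (s - t)\<^sup>2" by (simp add: power2_eq_square abs_mult[symmetric])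
  finally show ?thesis unfolding x(2) by (simp add: abs_mult[symmetric] left_diff_distrib)
qed

lemma F_measurable [measurable]: "F \<in> borel_measurable borel"
  using DERIV_isCont[OF deriv] by (intro borel_measurable_continuous_onI continuous_at_imp_continuous_on) auto

lemma F'_measurable [measurable]: "F' \<in> borel_measurable borel"
proof -
  have "L-lipschitz_on UNIV F'"
    by (rule lipschitz_onI) (simp_all add: dist_real_def F'_Lipschitz L_nonneg)
  then show ?thesis by (intro borel_measurable_continuous_onI lipschitz_on_continuous_on)
qed

end

locale H1_composition = bounded_open \<Omega> + C11_function F F' B L
  for \<Omega> :: "(real^2) set" and F F' :: "real \<Rightarrow> real" and B L :: real
begin

definition comp :: "ae_fun \<Rightarrow> ae_fun" where
  "comp z = ae_class \<Omega> (\<lambda>x. F (rep z x))"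

lemma comp_L2:
  assumes z: "z \<in> H1 \<Omega>"
  shows "(\<lambda>x. F (rep z x)) \<in> L2_funs \<Omega>" "(\<lambda>x. F' (rep z x) * weak_partial \<Omega> i z x) \<in> L2_funs \<Omega>"
proof -
  have [measurable]: "rep z \<in> borel_measurable M" using L2_measurable[OF H1_D(1)[OF z]] .
  show "(\<lambda>x. F (rep z x)) \<in> L2_funs \<Omega>"
    by (rule L2_bounded[where B=B]) (measurable, rule F_bound)
  show "(\<lambda>x. F' (rep z x) * weak_partial \<Omega> i z x) \<in> L2_funs \<Omega>"
    by (rule L2_bounded_mult[OF H1_D(3)[OF z], where B=B]) (measurable, rule F'_bound)
qed

lemma comp_weak_partial:
  assumes z: "z \<in> H1 \<Omega>"
  shows "is_weak_partial \<Omega> i (\<lambda>x. F (rep z x)) (\<lambda>x. F' (rep z x) * weak_partial \<Omega> i z x)"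
  unfolding is_weak_partial_def
proof
  fix \<phi> assume \<phi>: "\<phi> \<in> test_funs \<Omega>"
  note d\<phi> = test_funs_partial_d[OF \<phi>, of i]
  obtain u where u: "AE x in M. rep z x = u x" "integrable lborel u" "\<forall>x. x \<notin> \<Omega> \<longrightarrow> u x = 0"
    using L2_borel[OF H1_D(1)[OF z]] by blast
  obtain g where g: "AE x in M. weak_partial \<Omega> i z x = g x" "integrable lborel g"
    "integrable lborel (\<lambda>x. (g x)\<^sup>2)" "\<forall>x. x \<notin> \<Omega> \<longrightarrow> g x = 0"
    using L2_borel[OF H1_D(3)[OF z]] by blast
  have [measurable]: "u \<in> borel_measurable borel" "g \<in> borel_measurable borel"
    "\<phi> \<in> borel_measurable borel" "partial_d i \<phi> \<in> borel_measurable borel"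
    using u(2) g(2) test_funs_measurable[OF \<phi>] test_funs_measurable[OF d\<phi>] by auto
  have weak: "(\<integral>x. u x * partial_d i \<psi> x \<partial>lborel) = - (\<integral>x. g x * \<psi> x \<partial>lborel)" if "\<psi> \<in> test_funs \<Omega>" for \<psi>
    by (rule weak_partial_lborel[OF weak_partial_AE[OF H1_D(1,3)[OF z] u(1) g(1) H1_D(4)[OF z]] that u(2,3) g(2,4)])
  have zero: "\<psi> x = 0" if "\<psi> \<in> test_funs \<Omega>" "x \<notin> \<Omega>" for \<psi> x
    using test_funs_zero[OF that(1), of x] test_funsD(3)[OF that(1)] that(2) by blast
  \<comment> \<open>Although u vanishes outside \<Omega>, F(u) does not when F 0 is not 0; the test
    function confines the integrals to \<Omega>.\<close>
  have M_lborel: "(\<integral>x. h x * \<psi> x \<partial>M) = (\<integral>x. h x * \<psi> x \<partial>lborel)"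
    if "\<psi> \<in> test_funs \<Omega>" "h \<in> borel_measurable borel" for h \<psi> :: plane_fun
  proof -
    have "(\<lambda>x. indicator \<Omega> x * (h x * \<psi> x)) = (\<lambda>x. h x * \<psi> x)"
      using zero[OF that(1)] by (auto simp: indicator_def fun_eq_iff)
    then show ?thesis
      using integral_M_borel[of "\<lambda>x. h x * \<psi> x"] that(2) test_funs_measurable[OF that(1)] by simp
  qed
  have "(\<integral>x. F (rep z x) * partial_d i \<phi> x \<partial>M) = (\<integral>x. F (u x) * partial_d i \<phi> x \<partial>M)"
    by (rule integral_M_cong_AE) (use u(1) in eventually_elim, simp)
  also have "\<dots> = (\<integral>x. F (u x) * partial_d i \<phi> x \<partial>lborel)"
    by (rule M_lborel[OF d\<phi>]) measurable
  also have "\<dots> = - (\<integral>x. F' (u x) * g x * \<phi> x \<partial>lborel)"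
    by (rule weak_chain_rule[OF open_\<Omega> u(2) g(2,3) weak F_measurable F'_measurable F_bound F'_bound L_nonneg taylor \<phi>])
  also have "(\<integral>x. F' (u x) * g x * \<phi> x \<partial>lborel) = (\<integral>x. F' (u x) * g x * \<phi> x \<partial>M)"
    by (rule M_lborel[OF \<phi>, symmetric]) measurable
  also have "\<dots> = (\<integral>x. F' (rep z x) * weak_partial \<Omega> i z x * \<phi> x \<partial>M)"
    by (rule integral_M_cong_AE) (use u(1) g(1) in eventually_elim, simp)
  finally show "(\<integral>x. F (rep z x) * partial_d i \<phi> x \<partial>M) = - (\<integral>x. F' (rep z x) * weak_partial \<Omega> i z x * \<phi> x \<partial>M)" .
qed

lemma comp_H1:
  assumes z: "z \<in> H1 \<Omega>"
  shows "comp z \<in> H1 \<Omega>" "AE x in M. rep (comp z) x = F (rep z x)"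
    "AE x in M. weak_partial \<Omega> i (comp z) x = F' (rep z x) * weak_partial \<Omega> i z x"
  unfolding comp_def
  by (rule H1_I(1)[OF comp_L2(1)[OF z] comp_L2(2)[OF z] comp_weak_partial[OF z]],
      rule rep_ae_class,
      rule H1_I(2)[OF comp_L2(1)[OF z] comp_L2(2)[OF z] comp_weak_partial[OF z]])

section \<open>Continuity of the composition in the metric of \<open>H1\<close>\<close>

lemma truncated_square_tendsto:
  assumes g: "g \<in> L2_funs \<Omega>"
  shows "(\<lambda>n. \<integral>x. (if \<bar>g x\<bar> > real n then (g x)\<^sup>2 else 0) \<partial>M) \<longlonglongrightarrow> 0"
proof -
  note [measurable] = L2_measurable[OF g]
  have "(\<lambda>n. \<integral>x. (if \<bar>g x\<bar> > real n then (g x)\<^sup>2 else 0) \<partial>M) \<longlonglongrightarrow> (\<integral>x. 0 \<partial>M)"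
  proof (rule integral_dominated_convergence[where w="\<lambda>x. (g x)\<^sup>2"])
    show "AE x in M. (\<lambda>n. if \<bar>g x\<bar> > real n then (g x)\<^sup>2 else 0) \<longlonglongrightarrow> 0"
    proof (rule AE_I2)
      fix x
      obtain N :: nat where N: "\<bar>g x\<bar> \<le> real N" using real_arch_simple by blast
      have "eventually (\<lambda>n. (if \<bar>g x\<bar> > real n then (g x)\<^sup>2 else 0) = 0) sequentially"
        using eventually_ge_at_top[of N] by eventually_elim (use N in auto)
      then show "(\<lambda>n. if \<bar>g x\<bar> > real n then (g x)\<^sup>2 else 0) \<longlonglongrightarrow> 0" by (rule tendsto_eventually)
    qed
  qed (auto simp: L2_integrable_square[OF g])
  then show ?thesis by simp
qed

text \<open>A difference of derivatives of F(z) and F(w) splits into (F'(z) - F'(w)) p - F'(w) (q -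
  p), with p and q the derivatives of z and w. The first product is controlled by \<bar>z - w\<bar>
  where \<bar>p\<bar> \<le> K and by 2 B \<bar>p\<bar> in the tail. Splitting the square doubles
  each term: hence 8 = 2 * 2^2, and 4 as 2 for each of the two directions.\<close>

lemma comp_dist_le:
  assumes z: "z \<in> H1 \<Omega>" and w: "w \<in> H1 \<Omega>" and K: "0 \<le> K"
  shows "(H1_dist \<Omega> (comp z) (comp w))\<^sup>2 \<le> (B\<^sup>2 + 4 * (L\<^sup>2 * K\<^sup>2 + B\<^sup>2)) * (H1_dist \<Omega> z w)\<^sup>2 +
    8 * B\<^sup>2 * (\<Sum>i\<in>UNIV. \<integral>x. (if \<bar>weak_partial \<Omega> i z x\<bar> > K then (weak_partial \<Omega> i z x)\<^sup>2 else 0) \<partial>M)"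
proof -
  let ?D = "(H1_dist \<Omega> z w)\<^sup>2"
  let ?\<tau> = "\<lambda>i. \<integral>x. (if \<bar>weak_partial \<Omega> i z x\<bar> > K then (weak_partial \<Omega> i z x)\<^sup>2 else 0) \<partial>M"
  have D0: "(\<integral>x. (rep w x - rep z x)\<^sup>2 \<partial>M) \<le> ?D"
    and D1: "(\<integral>x. (weak_partial \<Omega> i w x - weak_partial \<Omega> i z x)\<^sup>2 \<partial>M) \<le> ?D" for i
    using H1_dist_bounds[OF z w] by auto
  have i0: "integrable M (\<lambda>x. (rep w x - rep z x)\<^sup>2)"
    by (intro L2_integrable_square L2_diff H1_D z w)
  have i1: "integrable M (\<lambda>x. (weak_partial \<Omega> i w x - weak_partial \<Omega> i z x)\<^sup>2)" for i
    by (intro L2_integrable_square L2_diff H1_D z w)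
  have i2: "integrable M (\<lambda>x. if \<bar>weak_partial \<Omega> i z x\<bar> > K then (weak_partial \<Omega> i z x)\<^sup>2 else 0)" for i
  proof (rule Bochner_Integration.integrable_bound[OF L2_integrable_square[OF H1_D(3)[OF z, of i]]])
    note [measurable] = L2_measurable[OF H1_D(3)[OF z, of i]]
    show "(\<lambda>x. if \<bar>weak_partial \<Omega> i z x\<bar> > K then (weak_partial \<Omega> i z x)\<^sup>2 else 0) \<in> borel_measurable M"
      by measurable
  qed auto
  have "(\<integral>x. (rep (comp z) x - rep (comp w) x)\<^sup>2 \<partial>M) = (\<integral>x. (F (rep z x) - F (rep w x))\<^sup>2 \<partial>M)"
    by (rule integral_M_cong_AE) (use comp_H1(2)[OF z] comp_H1(2)[OF w] in eventually_elim, simp)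
  also have "\<dots> \<le> (\<integral>x. B\<^sup>2 * (rep w x - rep z x)\<^sup>2 \<partial>M)"
  proof (rule integral_mono)
    show "integrable M (\<lambda>x. (F (rep z x) - F (rep w x))\<^sup>2)"
      by (intro L2_integrable_square L2_diff comp_L2 z w)
    show "(F (rep z x) - F (rep w x))\<^sup>2 \<le> B\<^sup>2 * (rep w x - rep z x)\<^sup>2" for x
      using power_mono[OF F_Lipschitz[of "rep w x" "rep z x"] abs_ge_zero, of 2]
      by (simp add: power_mult_distrib power2_commute)
  qed (use i0 in simp)
  also have "\<dots> \<le> B\<^sup>2 * ?D" using D0 by (simp add: mult_left_mono)
  finally have 0: "(\<integral>x. (rep (comp z) x - rep (comp w) x)\<^sup>2 \<partial>M) \<le> B\<^sup>2 * ?D" .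
  have 1: "(\<integral>x. (weak_partial \<Omega> i (comp z) x - weak_partial \<Omega> i (comp w) x)\<^sup>2 \<partial>M)
     \<le> 2 * (L\<^sup>2 * K\<^sup>2 + B\<^sup>2) * ?D + 8 * B\<^sup>2 * ?\<tau> i" for i
  proof -
    define r s p q where "r = rep z" and "s = rep w" and "p = weak_partial \<Omega> i z" and "q = weak_partial \<Omega> i w"
    define T where "T x = (if \<bar>p x\<bar> > K then (p x)\<^sup>2 else 0)" for x
    have pw: "(F' (r x) * p x - F' (s x) * q x)\<^sup>2 \<le>
      2 * (L\<^sup>2 * K\<^sup>2) * (s x - r x)\<^sup>2 + 8 * B\<^sup>2 * T x + 2 * B\<^sup>2 * (q x - p x)\<^sup>2" for x
    proof -
      have A: "(F' (r x) - F' (s x))\<^sup>2 * (p x)\<^sup>2 \<le> L\<^sup>2 * K\<^sup>2 * (s x - r x)\<^sup>2 + 4 * B\<^sup>2 * T x"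
      proof (cases "\<bar>p x\<bar> > K")
        case True
        have "\<bar>F' (r x) - F' (s x)\<bar> \<le> 2 * B" using F'_bound[of "r x"] F'_bound[of "s x"] by linarith
        from power_mono[OF this, of 2] have "(F' (r x) - F' (s x))\<^sup>2 \<le> 4 * B\<^sup>2" by (simp add: power_mult_distrib)
        then have "(F' (r x) - F' (s x))\<^sup>2 * (p x)\<^sup>2 \<le> 4 * B\<^sup>2 * (p x)\<^sup>2" by (rule mult_right_mono) simp
        moreover have "0 \<le> L\<^sup>2 * K\<^sup>2 * (s x - r x)\<^sup>2" by simp
        moreover have T: "T x = (p x)\<^sup>2" using True by (simp add: T_def)
        ultimately show ?thesis unfolding T by linarith
      next
        case False
        have "(F' (r x) - F' (s x))\<^sup>2 \<le> L\<^sup>2 * (s x - r x)\<^sup>2"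
          using power_mono[OF F'_Lipschitz[of "s x" "r x"] abs_ge_zero, of 2]
          by (simp add: power_mult_distrib power2_commute)
        moreover have "(p x)\<^sup>2 \<le> K\<^sup>2" using power_mono[of "\<bar>p x\<bar>" K 2] False by simp
        ultimately have "(F' (r x) - F' (s x))\<^sup>2 * (p x)\<^sup>2 \<le> L\<^sup>2 * (s x - r x)\<^sup>2 * K\<^sup>2"
          by (intro mult_mono) auto
        then show ?thesis using False by (simp add: T_def mult_ac)
      qed
      have C: "(F' (s x))\<^sup>2 * (q x - p x)\<^sup>2 \<le> B\<^sup>2 * (q x - p x)\<^sup>2"
        using power_mono[OF F'_bound[of "s x"] abs_ge_zero, of 2] by (intro mult_right_mono) auto
      have "(a + b)\<^sup>2 \<le> 2 * a\<^sup>2 + 2 * b\<^sup>2" for a b :: real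
        using sum_squares_bound[of a b] by (simp add: power2_sum)
      from this[of "(F' (r x) - F' (s x)) * p x" "- (F' (s x) * (q x - p x))"]
      have "((F' (r x) - F' (s x)) * p x + - (F' (s x) * (q x - p x)))\<^sup>2 \<le>
        2 * ((F' (r x) - F' (s x))\<^sup>2 * (p x)\<^sup>2) + 2 * ((F' (s x))\<^sup>2 * (q x - p x)\<^sup>2)"
        by (simp only: power_mult_distrib power2_minus)
      also have "(F' (r x) - F' (s x)) * p x + - (F' (s x) * (q x - p x)) = F' (r x) * p x - F' (s x) * q x"
        by (simp add: algebra_simps)
      finally have "(F' (r x) * p x - F' (s x) * q x)\<^sup>2 \<le>
        2 * ((F' (r x) - F' (s x))\<^sup>2 * (p x)\<^sup>2) + 2 * ((F' (s x))\<^sup>2 * (q x - p x)\<^sup>2)" .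
      with A C show ?thesis by linarith
    qed
    have ints: "integrable M (\<lambda>x. (s x - r x)\<^sup>2)" "integrable M (\<lambda>x. (q x - p x)\<^sup>2)" "integrable M T"
      unfolding T_def[abs_def] r_def s_def p_def q_def by (rule i0 i1 i2)+
    have "(\<integral>x. (weak_partial \<Omega> i (comp z) x - weak_partial \<Omega> i (comp w) x)\<^sup>2 \<partial>M) = (\<integral>x. (F' (r x) * p x - F' (s x) * q x)\<^sup>2 \<partial>M)"
      unfolding r_def s_def p_def q_def
      by (rule integral_M_cong_AE) (use comp_H1(3)[OF z, of i] comp_H1(3)[OF w, of i] in eventually_elim, simp)
    also have "\<dots> \<le> (\<integral>x. 2 * (L\<^sup>2 * K\<^sup>2) * (s x - r x)\<^sup>2 + 8 * B\<^sup>2 * T x + 2 * B\<^sup>2 * (q x - p x)\<^sup>2 \<partial>M)"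
    proof (rule integral_mono[OF _ _ pw])
      show "integrable M (\<lambda>x. (F' (r x) * p x - F' (s x) * q x)\<^sup>2)"
        unfolding r_def s_def p_def q_def by (intro L2_integrable_square L2_diff comp_L2 z w)
    qed (use ints in simp)
    also have "\<dots> = 2 * (L\<^sup>2 * K\<^sup>2) * (\<integral>x. (s x - r x)\<^sup>2 \<partial>M) + 8 * B\<^sup>2 * (\<integral>x. T x \<partial>M) + 2 * B\<^sup>2 * (\<integral>x. (q x - p x)\<^sup>2 \<partial>M)"
      using ints by simp
    also have "\<dots> \<le> 2 * (L\<^sup>2 * K\<^sup>2) * ?D + 8 * B\<^sup>2 * (\<integral>x. T x \<partial>M) + 2 * B\<^sup>2 * ?D"
      using D0 D1[of i] by (intro add_mono mult_left_mono order_refl) (auto simp: r_def s_def p_def q_def)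
    finally show ?thesis unfolding T_def p_def by (simp only: algebra_simps)
  qed
  have eq: "(H1_dist \<Omega> (comp z) (comp w))\<^sup>2 = (\<integral>x. (rep (comp z) x - rep (comp w) x)\<^sup>2 \<partial>M) +
    (\<integral>x. (weak_partial \<Omega> 1 (comp z) x - weak_partial \<Omega> 1 (comp w) x)\<^sup>2 \<partial>M) +
    (\<integral>x. (weak_partial \<Omega> 2 (comp z) x - weak_partial \<Omega> 2 (comp w) x)\<^sup>2 \<partial>M)"
    unfolding H1_dist_eq[OF comp_H1(1)[OF z] comp_H1(1)[OF w]] by (subst real_sqrt_pow2) auto
  have "(H1_dist \<Omega> (comp z) (comp w))\<^sup>2 \<le> B\<^sup>2 * ?D +
    (2 * (L\<^sup>2 * K\<^sup>2 + B\<^sup>2) * ?D + 8 * B\<^sup>2 * ?\<tau> 1) + (2 * (L\<^sup>2 * K\<^sup>2 + B\<^sup>2) * ?D + 8 * B\<^sup>2 * ?\<tau> 2)"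
    unfolding eq using 0 1[of 1] 1[of 2] by (intro add_mono)
  then show ?thesis by (simp add: UNIV_2 algebra_simps)
qed

text \<open>The truncation level n is fixed first and makes the tail smaller than e^2 / 2; it
  depends on z alone, so d can be chosen afterwards.\<close>

lemma comp_continuous:
  assumes z: "z \<in> H1 \<Omega>" and e: "e > 0"
  shows "\<exists>d>0. \<forall>w\<in>H1 \<Omega>. H1_dist \<Omega> z w < d \<longrightarrow> H1_dist \<Omega> (comp z) (comp w) < e"
proof -
  let ?\<tau> = "\<lambda>n. 8 * B\<^sup>2 * (\<Sum>i\<in>UNIV. \<integral>x. (if \<bar>weak_partial \<Omega> i z x\<bar> > real n then (weak_partial \<Omega> i z x)\<^sup>2 else 0) \<partial>M)"
  have "?\<tau> \<longlonglongrightarrow> 8 * B\<^sup>2 * (\<Sum>i\<in>(UNIV :: 2 set). 0)"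
    by (intro tendsto_mult_left tendsto_sum truncated_square_tendsto H1_D z)
  then have "eventually (\<lambda>n. ?\<tau> n < e\<^sup>2 / 2) sequentially"
    using e by (intro order_tendstoD(2)) auto
  then obtain n where n: "?\<tau> n < e\<^sup>2 / 2" by (auto simp: eventually_sequentially)
  define C where "C = B\<^sup>2 + 4 * (L\<^sup>2 * (real n)\<^sup>2 + B\<^sup>2)"
  have C: "C \<ge> 0" by (simp add: C_def)
  \<comment> \<open>Chosen so that (C + 1) d^2 is the remaining e^2 / 2; the summand 1 keeps the
    divisor positive.\<close>
  define d where "d = e / sqrt (2 * (C + 1))"
  have "d\<^sup>2 = e\<^sup>2 / (2 * (C + 1))"
    unfolding d_def power_divide using C by (subst real_sqrt_pow2) auto
  then have d: "d > 0" "(C + 1) * d\<^sup>2 = e\<^sup>2 / 2"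
    using C e by (simp_all add: d_def field_simps)
  show ?thesis
  proof (intro exI[of _ d] conjI ballI impI d(1))
    fix w assume w: "w \<in> H1 \<Omega>" "H1_dist \<Omega> z w < d"
    have D0: "0 \<le> H1_dist \<Omega> z w" by (simp add: H1_dist_def H1_norm_def)
    have "C * (H1_dist \<Omega> z w)\<^sup>2 \<le> (C + 1) * d\<^sup>2"
      using C D0 w(2) by (intro mult_mono power_mono) auto
    then have "(H1_dist \<Omega> (comp z) (comp w))\<^sup>2 < e\<^sup>2"
      using comp_dist_le[OF z w(1), of "real n"] n unfolding C_def[symmetric] d(2) by simp
    then show "H1_dist \<Omega> (comp z) (comp w) < e" using e by (intro power_less_imp_less_base[of _ 2 e]) auto
  qed
qed

end

section \<open>The error function\<close>

lemma erf_has_derivative: "(erf has_real_derivative 2 / sqrt pi * exp (- (s\<^sup>2))) (at s)"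
proof -
  \<comment> \<open>An interval with 0 and s in its interior lets the fundamental theorem apply
    whatever the sign of s, and as a two-sided derivative.\<close>
  define l u where "l = min 0 s - 1" and "u = max 0 s + 1"
  have lu: "l < 0" "0 < u" "l < s" "s < u" by (auto simp: l_def u_def)
  have "((\<lambda>u. LBINT t=ereal 0..ereal u. exp (- (t\<^sup>2))) has_vector_derivative exp (- (s\<^sup>2))) (at s within {l..u})"
    using lu by (intro interval_integral_FTC2) (auto intro!: continuous_intros)
  then have "((\<lambda>u. LBINT t=ereal 0..ereal u. exp (- (t\<^sup>2))) has_real_derivative exp (- (s\<^sup>2))) (at s)"
    using lu by (simp add: has_real_derivative_iff_has_vector_derivative at_within_Icc_at)
  from DERIV_cmult[OF this, of "2 / sqrt pi"] show ?thesis unfolding erf_def[abs_def] .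
qed

lemma erf_minus: "erf (- s) = - erf s"
proof -
  have "(LBINT t=ereal 0..ereal (- s). exp (- (t\<^sup>2))) = (LBINT t=ereal s..ereal 0. exp (- (t\<^sup>2)))"
    by (subst interval_integral_reflect) (simp add: zero_ereal_def)
  also have "\<dots> = - (LBINT t=ereal 0..ereal s. exp (- (t\<^sup>2)))"
    by (rule interval_integral_endpoints_reverse)
  finally show ?thesis by (simp add: erf_def)
qed

text \<open>For s \<ge> 0 the integral is part of the half-line Gaussian integral, equal to sqrt pi
  / 2; oddness gives the rest.\<close>

lemma abs_erf_le_1: "\<bar>erf s\<bar> \<le> 1"
proof -
  have *: "\<bar>erf s\<bar> \<le> 1" if s: "0 \<le> s" for s
  proof -
    have i: "integrable lborel (\<lambda>x. indicator {0..} x *\<^sub>R exp (- x\<^sup>2) :: real)"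
      and I: "(\<integral>x. indicator {0..} x *\<^sub>R exp (- x\<^sup>2) \<partial>lborel) = sqrt pi / 2"
      using gaussian_moment_0 by (auto simp: has_bochner_integral_iff)
    have eq: "(LBINT t=ereal 0..ereal s. exp (- (t\<^sup>2))) = (\<integral>x. indicator {0..s} x *\<^sub>R exp (- x\<^sup>2) \<partial>lborel)"
      using s by (subst interval_integral_Icc) (auto simp: set_lebesgue_integral_def)
    have "0 \<le> (LBINT t=ereal 0..ereal s. exp (- (t\<^sup>2)))" unfolding eq by (intro Bochner_Integration.integral_nonneg) auto
    moreover have "(LBINT t=ereal 0..ereal s. exp (- (t\<^sup>2))) \<le> sqrt pi / 2"
      unfolding eq I[symmetric]
    proof (rule integral_mono_AE'[OF i])
      show "AE x in lborel. indicator {0..s} x *\<^sub>R exp (- x\<^sup>2) \<le> indicator {0..} x *\<^sub>R exp (- x\<^sup>2)"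
        by (auto simp: indicator_def)
    qed auto
    ultimately show ?thesis by (simp add: erf_def field_simps)
  qed
  show ?thesis using *[of s] *[of "- s"] by (cases "0 \<le> s") (auto simp: erf_minus)
qed

lemma mult_exp_minus_square_le: "\<bar>s\<bar> * exp (- (s\<^sup>2)) \<le> 1" for s :: real
proof -
  have "0 \<le> (\<bar>s\<bar> - 1)\<^sup>2" by simp
  then have "2 * \<bar>s\<bar> \<le> 1 + s\<^sup>2" by (simp add: power2_diff)
  then have "\<bar>s\<bar> \<le> 1 + s\<^sup>2" using abs_ge_zero[of s] by linarith
  also have "\<dots> \<le> exp (s\<^sup>2)" by (rule exp_ge_add_one_self)
  finally have "\<bar>s\<bar> * exp (- (s\<^sup>2)) \<le> exp (s\<^sup>2) * exp (- (s\<^sup>2))" by (rule mult_right_mono) simp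
  then show ?thesis by (simp add: exp_add[symmetric])
qed

lemma exp_minus_square_Lipschitz: "\<bar>exp (- (s\<^sup>2)) - exp (- (t\<^sup>2))\<bar> \<le> 2 * \<bar>s - t\<bar>" for s t :: real
proof -
  have "norm (exp (- (s\<^sup>2)) - exp (- (t\<^sup>2))) \<le> 2 * norm (s - t)"
  proof (rule field_differentiable_bound[of UNIV])
    show "((\<lambda>s. exp (- (s\<^sup>2))) has_field_derivative - (2 * x) * exp (- (x\<^sup>2))) (at x within UNIV)" for x :: real
      by (auto intro!: derivative_eq_intros)
    show "norm (- (2 * x) * exp (- (x\<^sup>2))) \<le> 2" for x :: real
      using mult_exp_minus_square_le[of x] by (simp add: abs_mult)
  qed auto
  then show ?thesis by simp
qed

definition reparam_fun :: "real \<Rightarrow> real \<Rightarrow> real \<Rightarrow> real \<Rightarrow> real" where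
  "reparam_fun a b c s = a / 2 * (erf (s / c) + b)"

lemma reparam_fun_bounds:
  assumes "a > 0"
  shows "a / 2 * (b - 1) \<le> reparam_fun a b c s" "reparam_fun a b c s \<le> a / 2 * (b + 1)"
  unfolding reparam_fun_def using abs_erf_le_1[of "s / c"] assms
  by (intro mult_left_mono; simp add: abs_le_iff)+

text \<open>The derivative is the Gaussian a / (c sqrt pi) exp (- (s/c)^2). Its Lipschitz constant
  is that prefactor times 2 / c, with 2 the constant for exp (- s^2). The locale has one bound for
  function and derivative, hence the maximum.\<close>

lemma C11_reparam:
  fixes a b c :: real
  assumes a: "a > 0" and b: "b > 1" and c: "c > 0"
  shows "C11_function (reparam_fun a b c) (\<lambda>s. a / (c * sqrt pi) * exp (- ((s / c)\<^sup>2)))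
    (max (a / 2 * (1 + b)) (a / (c * sqrt pi))) (2 * a / (c\<^sup>2 * sqrt pi))"
proof
  fix s t :: real
  have "((\<lambda>s. erf (s / c)) has_real_derivative 2 / sqrt pi * exp (- ((s / c)\<^sup>2)) * (1 / c)) (at s)"
    by (rule DERIV_chain2[OF erf_has_derivative]) (use c in \<open>auto intro!: derivative_eq_intros\<close>)
  then show "(reparam_fun a b c has_real_derivative a / (c * sqrt pi) * exp (- ((s / c)\<^sup>2))) (at s)"
    unfolding reparam_fun_def[abs_def] using c by (auto intro!: derivative_eq_intros simp: mult_ac)
  have "\<bar>erf (s / c) + b\<bar> \<le> 1 + b" using abs_erf_le_1[of "s / c"] b by linarith
  then have "a / 2 * \<bar>erf (s / c) + b\<bar> \<le> a / 2 * (1 + b)" using a by (intro mult_left_mono) auto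
  then have "\<bar>reparam_fun a b c s\<bar> \<le> a / 2 * (1 + b)"
    using a by (simp add: reparam_fun_def abs_mult)
  then show "\<bar>reparam_fun a b c s\<bar> \<le> max (a / 2 * (1 + b)) (a / (c * sqrt pi))"
    by (rule order_trans) simp
  have "a / (c * sqrt pi) * exp (- ((s / c)\<^sup>2)) \<le> a / (c * sqrt pi) * 1"
    using a c by (intro mult_left_mono) auto
  then show "\<bar>a / (c * sqrt pi) * exp (- ((s / c)\<^sup>2))\<bar> \<le> max (a / 2 * (1 + b)) (a / (c * sqrt pi))"
    using a c by (simp add: abs_mult)
  have scale: "\<bar>k * p - k * q\<bar> = k * \<bar>p - q\<bar>" if "0 \<le> k" for k p q :: real
    using that by (simp add: right_diff_distrib[symmetric] abs_mult)
  have "\<bar>a / (c * sqrt pi) * exp (- ((s / c)\<^sup>2)) - a / (c * sqrt pi) * exp (- ((t / c)\<^sup>2))\<bar>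
    = a / (c * sqrt pi) * \<bar>exp (- ((s / c)\<^sup>2)) - exp (- ((t / c)\<^sup>2))\<bar>"
    by (rule scale) (use a c in simp)
  also have "\<dots> \<le> a / (c * sqrt pi) * (2 * \<bar>s / c - t / c\<bar>)"
    using a c by (intro mult_left_mono exp_minus_square_Lipschitz) auto
  also have "\<bar>s / c - t / c\<bar> = \<bar>s - t\<bar> / c" using c by (simp add: diff_divide_distrib[symmetric])
  finally show "\<bar>a / (c * sqrt pi) * exp (- ((s / c)\<^sup>2)) - a / (c * sqrt pi) * exp (- ((t / c)\<^sup>2))\<bar>
    \<le> 2 * a / (c\<^sup>2 * sqrt pi) * \<bar>s - t\<bar>"
    by (simp add: power2_eq_square mult_ac)
qed

section \<open>The forward map\<close>

context bounded_open
begin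

text \<open>That a constant has weak derivative 0 means that derivatives of test functions integrate
  to 0. This is obtained from the chain rule with constant F, applied to the zero class.\<close>

lemma one_H1: "ae_class \<Omega> (\<lambda>x. 1) \<in> H1 \<Omega>"
proof -
  interpret C: H1_composition \<Omega> "\<lambda>_. 1" "\<lambda>_. 0" 1 0
    by unfold_locales auto
  have weak0: "is_weak_partial \<Omega> i (\<lambda>x. 0) (\<lambda>x. 0)" for i by (simp add: is_weak_partial_def)
  have "ae_class \<Omega> (\<lambda>x. 0) \<in> H1 \<Omega>" by (rule H1_I(1)[OF L2_const L2_const weak0])
  from C.comp_H1(1)[OF this] show ?thesis by (simp add: C.comp_def)
qed

end

locale forward_map = bounded_open \<Omega> for \<Omega> +
  fixes A :: "ae_fun \<Rightarrow> real^'d"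
  assumes A_linear: "H1_bounded_linear \<Omega> A" and A_positive: "H1_positive \<Omega> A"
begin

lemma A_diff:
  assumes "z \<in> H1 \<Omega>" "w \<in> H1 \<Omega>"
  shows "A (H1_diff \<Omega> z w) = A z - A w"
proof -
  have "A (H1_diff \<Omega> z w) = A z + A (H1_scale \<Omega> (- 1) w)"
    using A_linear assms H1_scale[OF assms(2), of "- 1"] unfolding H1_diff_eq H1_bounded_linear_def by blast
  also have "A (H1_scale \<Omega> (- 1) w) = (- 1) *\<^sub>R A w"
    using A_linear assms unfolding H1_bounded_linear_def by blast
  finally show ?thesis by simp
qed

lemma A_mono:
  assumes zw: "z \<in> H1 \<Omega>" "w \<in> H1 \<Omega>" and le: "AE x in M. rep z x \<le> rep w x"
  shows "A z $ i \<le> A w $ i"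
proof -
  have "AE x in M. 0 \<le> rep (H1_diff \<Omega> w z) x"
    using le H1_diff(2)[OF zw(2,1)] by eventually_elim simp
  then have "0 \<le> A (H1_diff \<Omega> w z) $ i"
    using A_positive H1_diff(1)[OF zw(2,1)] unfolding H1_positive_def by blast
  then show ?thesis by (simp add: A_diff[OF zw(2,1)])
qed

lemma A_Lipschitz:
  obtains K where "K > 0" "\<And>z w. z \<in> H1 \<Omega> \<Longrightarrow> w \<in> H1 \<Omega> \<Longrightarrow> norm (A z - A w) \<le> K * H1_dist \<Omega> z w"
proof -
  obtain K where K: "\<forall>z\<in>H1 \<Omega>. norm (A z) \<le> K * H1_norm \<Omega> z"
    using A_linear unfolding H1_bounded_linear_def by blast
  show ?thesis
  \<comment> \<open>The given constant may be 0 or negative; a positive one is needed for the later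
    division by it.\<close>
  proof (rule that[of "\<bar>K\<bar> + 1"])
    fix z w assume zw: "z \<in> H1 \<Omega>" "w \<in> H1 \<Omega>"
    have "norm (A z - A w) \<le> K * H1_dist \<Omega> z w"
      using K H1_diff(1)[OF zw] unfolding A_diff[OF zw, symmetric] H1_dist_def by blast
    also have "\<dots> \<le> (\<bar>K\<bar> + 1) * H1_dist \<Omega> z w"
      by (intro mult_right_mono) (auto simp: H1_dist_def H1_norm_def)
    finally show "norm (A z - A w) \<le> (\<bar>K\<bar> + 1) * H1_dist \<Omega> z w" .
  qed simp
qed

lemma A_const:
  "ae_class \<Omega> (\<lambda>x. s) \<in> H1 \<Omega>" "A (ae_class \<Omega> (\<lambda>x. s)) = s *\<^sub>R A (ae_class \<Omega> (\<lambda>x. 1))"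
proof -
  have "AE x in M. s * rep (ae_class \<Omega> (\<lambda>x. 1)) x = s"
    using rep_ae_class[of "\<lambda>x. 1"] by eventually_elim simp
  then have eq: "ae_class \<Omega> (\<lambda>x. s) = H1_scale \<Omega> s (ae_class \<Omega> (\<lambda>x. 1))"
    unfolding H1_scale_def by (rule ae_class_cong[symmetric])
  show "ae_class \<Omega> (\<lambda>x. s) \<in> H1 \<Omega>" unfolding eq by (rule H1_scale[OF one_H1])
  show "A (ae_class \<Omega> (\<lambda>x. s)) = s *\<^sub>R A (ae_class \<Omega> (\<lambda>x. 1))"
    unfolding eq using A_linear one_H1 unfolding H1_bounded_linear_def by blast
qed

end

locale poisson_model = forward_map \<Omega> A for \<Omega> and A :: "ae_fun \<Rightarrow> real^'d" +
  fixes a b c :: real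
  assumes abc: "a > 0" "b > 1" "c > 0"
begin

abbreviation "f \<equiv> reparam \<Omega> a b c"
abbreviation "A1 i \<equiv> A (ae_class \<Omega> (\<lambda>x. 1)) $ i"

sublocale C: H1_composition \<Omega> "reparam_fun a b c" "\<lambda>s. a / (c * sqrt pi) * exp (- ((s / c)\<^sup>2))"
    "max (a / 2 * (1 + b)) (a / (c * sqrt pi))" "2 * a / (c\<^sup>2 * sqrt pi)"
  using C11_reparam[OF abc] by (intro H1_composition.intro bounded_open_axioms)

lemma f_eq: "f = C.comp"
  by (simp add: fun_eq_iff reparam_def C.comp_def reparam_fun_def)

lemma Af_bounds:
  assumes z: "z \<in> H1 \<Omega>"
  shows "0 < a / 2 * (b - 1) * A1 i" "a / 2 * (b - 1) * A1 i \<le> A (f z) $ i" "A (f z) $ i \<le> a / 2 * (b + 1) * A1 i"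
proof -
  have A1: "0 < A1 i" using A_positive by (simp add: H1_positive_def)
  then show "0 < a / 2 * (b - 1) * A1 i" using abc by simp
  have "AE x in M. rep (ae_class \<Omega> (\<lambda>x. a / 2 * (b - 1))) x \<le> rep (f z) x"
    using rep_ae_class[of "\<lambda>x. a / 2 * (b - 1)"] C.comp_H1(2)[OF z] unfolding f_eq
    by eventually_elim (simp only: reparam_fun_bounds(1)[OF abc(1)])
  from A_mono[OF A_const(1) C.comp_H1(1)[OF z, folded f_eq] this, of i]
  show "a / 2 * (b - 1) * A1 i \<le> A (f z) $ i" 
    unfolding A_const(2)[of "a / 2 * (b - 1)"] by (simp only: vector_scaleR_component real_scaleR_def)
  have "AE x in M. rep (f z) x \<le> rep (ae_class \<Omega> (\<lambda>x. a / 2 * (b + 1))) x"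
    using rep_ae_class[of "\<lambda>x. a / 2 * (b + 1)"] C.comp_H1(2)[OF z] unfolding f_eq
    by eventually_elim (simp only: reparam_fun_bounds(2)[OF abc(1)])
  from A_mono[OF C.comp_H1(1)[OF z, folded f_eq] A_const(1) this, of i]
  show "A (f z) $ i \<le> a / 2 * (b + 1) * A1 i" 
    unfolding A_const(2)[of "a / 2 * (b + 1)"] by (simp only: vector_scaleR_component real_scaleR_def)
qed

lemma Af_measurable: "(\<lambda>z. A (f z) $ i) \<in> borel_measurable (H1_borel \<Omega>)"
proof (rule borel_measurable_H1_borelI)
  fix z and e :: real assume z: "z \<in> H1 \<Omega>" and e: "e > 0"
  obtain K where K: "K > 0" "\<And>z w. z \<in> H1 \<Omega> \<Longrightarrow> w \<in> H1 \<Omega> \<Longrightarrow> norm (A z - A w) \<le> K * H1_dist \<Omega> z w"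
    using A_Lipschitz by blast
  obtain d where d: "d > 0" "\<forall>w\<in>H1 \<Omega>. H1_dist \<Omega> z w < d \<longrightarrow> H1_dist \<Omega> (f z) (f w) < e / K"
    using C.comp_continuous[OF z, of "e / K"] e K(1) unfolding f_eq by auto
  have "\<bar>A (f w) $ i - A (f z) $ i\<bar> < e" if w: "w \<in> H1 \<Omega>" "H1_dist \<Omega> z w < d" for w
  proof -
    have "\<bar>A (f w) $ i - A (f z) $ i\<bar> = \<bar>(A (f z) - A (f w)) $ i\<bar>" by (simp add: abs_minus_commute)
    also have "\<dots> \<le> norm (A (f z) - A (f w))" by (rule component_le_norm_cart)
    also have "\<dots> \<le> K * H1_dist \<Omega> (f z) (f w)"
      unfolding f_eq by (intro K(2) C.comp_H1 z w)
    also have "\<dots> < e" using d(2) w K(1) by (simp add: field_simps)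
    finally show ?thesis .
  qed
  then show "\<exists>d>0. \<forall>w\<in>H1 \<Omega>. H1_dist \<Omega> z w < d \<longrightarrow> \<bar>A (f w) $ i - A (f z) $ i\<bar> < e"
    using d(1) by blast
qed

lemma potential_measurable: "(\<lambda>z. poisson_potential A f z y) \<in> borel_measurable (H1_borel \<Omega>)"
  unfolding poisson_potential_def using Af_measurable by measurable

text \<open>The sum over all i and over the logarithms of both endpoints dominates each \<bar>ln (A
  f(z))\<bar> componentwise, whatever the signs of these logarithms.\<close>

definition \<Lambda> :: real where
  "\<Lambda> = (\<Sum>i\<in>UNIV. \<bar>ln (a / 2 * (b - 1) * A1 i)\<bar> + \<bar>ln (a / 2 * (b + 1) * A1 i)\<bar>)"

lemma abs_ln_Af_le:
  assumes z: "z \<in> H1 \<Omega>"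
  shows "\<bar>ln (A (f z) $ i)\<bar> \<le> \<Lambda>"
proof -
  have "ln (a / 2 * (b - 1) * A1 i) \<le> ln (A (f z) $ i)" "ln (A (f z) $ i) \<le> ln (a / 2 * (b + 1) * A1 i)"
    using Af_bounds[OF z, of i] by simp_all
  then have "\<bar>ln (A (f z) $ i)\<bar> \<le> \<bar>ln (a / 2 * (b - 1) * A1 i)\<bar> + \<bar>ln (a / 2 * (b + 1) * A1 i)\<bar>" by linarith
  also have "\<dots> \<le> \<Lambda>" unfolding \<Lambda>_def by (rule member_le_sum) auto
  finally show ?thesis .
qed

text \<open>For fixed z the potential is affine in y, with coefficients - ln (A f(z)) bounded by
  \<open>\<Lambda>\<close>. Estimating each component of y - y' by the norm produces the dimension
  as a factor.\<close>

lemma potential_Lipschitz: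
  assumes z: "z \<in> H1 \<Omega>"
  shows "\<bar>poisson_potential A f z y - poisson_potential A f z y'\<bar> \<le> real CARD('d) * \<Lambda> * norm (y - y')"
proof -
  have "poisson_potential A f z y - poisson_potential A f z y' = (\<Sum>i\<in>UNIV. - ((y - y') $ i * ln (A (f z) $ i)))"
    unfolding poisson_potential_def sum_subtractf[symmetric] by (simp add: algebra_simps)
  also have "\<bar>\<dots>\<bar> \<le> (\<Sum>i\<in>(UNIV :: 'd set). norm (y - y') * \<Lambda>)"
    by (rule order_trans[OF sum_abs], rule sum_mono)
       (auto simp: abs_mult intro!: mult_mono abs_ln_Af_le[OF z] component_le_norm_cart[of "y - y'", simplified])
  finally show ?thesis by (simp add: mult_ac)
qed

text \<open>At y = 0 only the positive terms A f(z) remain; the Lipschitz estimate does the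
  rest.\<close>

lemma potential_ge:
  assumes z: "z \<in> H1 \<Omega>"
  shows "- (real CARD('d) * \<Lambda> * norm y) \<le> poisson_potential A f z y"
proof -
  have "0 \<le> A (f z) $ i" for i using Af_bounds(1,2)[OF z, of i] by linarith
  then have "0 \<le> poisson_potential A f z 0"
    by (auto simp: poisson_potential_def intro: sum_nonneg)
  then show ?thesis using potential_Lipschitz[OF z, of y 0] by simp
qed

end


text \<open>The event E may vary with j and k; only its measure is controlled uniformly. The
  tolerances depend on one index each, which gives convergence along the product filter, with no
  relation between the indices.\<close>

lemma tendsto_gibbs_hellinger:
  fixes V :: "'a \<Rightarrow> real" and W :: "nat \<Rightarrow> nat \<Rightarrow> 'a \<Rightarrow> real"
  assumes V: "bounded_potential \<mu> V m" and W: "\<And>j k. bounded_potential \<mu> (W j k) m"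
    and close: "\<And>\<epsilon>. \<epsilon> > 0 \<Longrightarrow> \<exists>\<alpha> \<beta> :: nat \<Rightarrow> real. (\<forall>n. \<alpha> n > 0) \<and> (\<forall>n. \<beta> n > 0) \<and> \<alpha> \<longlonglongrightarrow> 0 \<and> \<beta> \<longlonglongrightarrow> 0 \<and>
      (\<forall>j k. \<exists>E\<in>sets \<mu>. measure \<mu> E \<ge> 1 - \<epsilon> \<and> (\<forall>z\<in>E. \<bar>V z - W j k z\<bar> \<le> \<alpha> j + \<beta> k))"
  shows "((\<lambda>(j, k). hellinger \<mu> (gibbs \<mu> V) (gibbs \<mu> (W j k))) \<longlongrightarrow> 0) (sequentially \<times>\<^sub>F sequentially)"
proof (rule tendstoI)
  interpret V: bounded_potential \<mu> V m by (rule V)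
  fix e :: real assume e: "e > 0"
  \<comment> \<open>Both tolerances and the exceptional measure are bounded by this \<epsilon>;
    three of them times exp (- m) / Z make e^2 / 2.\<close>
  define \<epsilon> where "\<epsilon> = e\<^sup>2 * V.Z * exp m / 6"
  have \<epsilon>: "\<epsilon> > 0" using e V.Z_pos by (simp add: \<epsilon>_def)
  obtain \<alpha> \<beta> :: "nat \<Rightarrow> real" where ab: "\<forall>n. \<alpha> n > 0" "\<forall>n. \<beta> n > 0" "\<alpha> \<longlonglongrightarrow> 0" "\<beta> \<longlonglongrightarrow> 0"
    and E: "\<forall>j k. \<exists>E\<in>sets \<mu>. measure \<mu> E \<ge> 1 - \<epsilon> \<and> (\<forall>z\<in>E. \<bar>V z - W j k z\<bar> \<le> \<alpha> j + \<beta> k)"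
    using close[OF \<epsilon>] by blast
  have "eventually (\<lambda>x. \<alpha> (fst x) < \<epsilon> \<and> \<beta> (snd x) < \<epsilon>) (sequentially \<times>\<^sub>F sequentially)"
    using eventually_prodI[OF order_tendstoD(2)[OF ab(3) \<epsilon>] order_tendstoD(2)[OF ab(4) \<epsilon>]] .
  then show "eventually (\<lambda>x. dist (case x of (j, k) \<Rightarrow> hellinger \<mu> (gibbs \<mu> V) (gibbs \<mu> (W j k))) 0 < e)
    (sequentially \<times>\<^sub>F sequentially)"
  proof eventually_elim
    case (elim x)
    obtain j k where x: "x = (j, k)" by (cases x)
    then have jk: "\<alpha> j < \<epsilon>" "\<beta> k < \<epsilon>" using elim by auto
    interpret W: bounded_potential \<mu> "W j k" m by (rule W)
    interpret two_potentials \<mu> V "W j k" m by unfold_locales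
    obtain E' where E': "E' \<in> sets \<mu>" "measure \<mu> E' \<ge> 1 - \<epsilon>" "\<And>z. z \<in> E' \<Longrightarrow> \<bar>V z - W j k z\<bar> \<le> \<alpha> j + \<beta> k"
      using E by metis
    let ?h = "hellinger \<mu> (gibbs \<mu> V) (gibbs \<mu> (W j k))"
    have "?h\<^sup>2 \<le> exp (- m) * (\<alpha> j + \<beta> k + \<epsilon>) / V.Z"
      by (rule hellinger_square_le_event[OF E'(1,2,3)]) (use ab(1,2) in \<open>auto intro: add_nonneg_nonneg less_imp_le\<close>)
    also have "\<dots> \<le> exp (- m) * (3 * \<epsilon>) / V.Z"
      using jk V.Z_pos by (intro divide_right_mono mult_left_mono) auto
    also have "\<dots> = e\<^sup>2 / 2" using V.Z_pos by (simp add: \<epsilon>_def exp_minus)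
    also have "\<dots> < e\<^sup>2" using e by simp
    finally have "?h < e" using e by (intro power_less_imp_less_base[of ?h 2 e]) auto
    then show ?case using hellinger_nonneg x by simp
  qed
qed

theorem theorem2p2:
  fixes \<Omega> :: "(real^2) set" and Y :: "(real^'d) set"
    and A :: "ae_fun \<Rightarrow> real^'d" and a b c lam :: real
    and \<mu>0 :: "ae_fun measure" and \<xi> :: ae_fun and C0 :: "ae_fun \<Rightarrow> ae_fun"
    and X :: "ae_fun set" and \<Phi> :: "ae_fun \<Rightarrow> real^'d \<Rightarrow> real" and R :: "ae_fun \<Rightarrow> real"
    and post :: "real^'d \<Rightarrow> ae_fun measure"
  assumes "open \<Omega>" and "bounded \<Omega>"
    and "a > 0" and "b > 1" and "c > 0" and "lam > 0"
    and "H1_bounded_linear \<Omega> A" and "H1_positive \<Omega> A"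
    and "H1_gaussian \<Omega> \<mu>0 \<xi> C0"
  defines "X \<equiv> H1 \<Omega>"
    and "\<Phi> \<equiv> poisson_potential A (reparam \<Omega> a b c)"
    and "R \<equiv> (\<lambda>z. lam * TV \<Omega> z)"
    and "post \<equiv> (\<lambda>y. gibbs \<mu>0 (\<lambda>z. \<Phi> z y + R z))"
  shows
    "(\<forall>y\<in>Y. (\<lambda>z. \<Phi> z y + R z) \<in> borel_measurable \<mu>0 \<and>
        0 < gibbs_const \<mu>0 (\<lambda>z. \<Phi> z y + R z) \<and> gibbs_const \<mu>0 (\<lambda>z. \<Phi> z y + R z) < \<infinity> \<and>
        prob_space (post y))
     \<and> (\<forall>r>0. \<exists>C. \<forall>y\<in>Y. \<forall>y'\<in>Y. max (norm y) (norm y') < r \<longrightarrow>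
        hellinger \<mu>0 (post y) (post y') \<le> C * norm (y - y'))
     \<and> (\<forall>(\<Phi>N :: nat \<Rightarrow> ae_fun \<Rightarrow> real^'d \<Rightarrow> real) (RN :: nat \<Rightarrow> ae_fun \<Rightarrow> real).
        (\<forall>n. \<forall>y\<in>Y. (\<lambda>z. \<Phi>N n z y) \<in> borel_measurable \<mu>0) \<longrightarrow>
        (\<forall>n. RN n \<in> borel_measurable \<mu>0) \<longrightarrow>
        (\<forall>r>0. \<exists>M N. N > 0 \<and> (\<forall>n. \<forall>z\<in>X. \<forall>y\<in>Y. norm y < r \<longrightarrow> M \<le> \<Phi>N n z y \<and> \<Phi>N n z y \<le> N)) \<longrightarrow>
        (\<forall>y\<in>Y. \<forall>r>0. \<exists>M>0. \<forall>n. \<forall>z\<in>X. \<forall>v\<in>X. max (H1_norm \<Omega> z) (H1_norm \<Omega> v) < r \<longrightarrow>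
           \<bar>\<Phi>N n z y - \<Phi>N n v y\<bar> \<le> M * H1_norm \<Omega> (H1_diff \<Omega> z v)) \<longrightarrow>
        (\<exists>M>0. \<forall>n. \<forall>z\<in>X. \<forall>y\<in>Y. \<forall>y'\<in>Y. \<bar>\<Phi>N n z y - \<Phi>N n z y'\<bar> \<le> M * norm (y - y')) \<longrightarrow>
        (\<exists>m. \<forall>n. \<forall>z\<in>X. m \<le> RN n z) \<longrightarrow>
        (\<forall>r>0. \<exists>K>0. \<forall>n. \<forall>z\<in>X. H1_norm \<Omega> z < r \<longrightarrow> RN n z \<le> K) \<longrightarrow>
        (\<forall>y\<in>Y.
          (\<forall>\<epsilon>>0. \<exists>\<alpha> \<beta> :: nat \<Rightarrow> real. (\<forall>n. \<alpha> n > 0) \<and> (\<forall>n. \<beta> n > 0) \<and>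
             \<alpha> \<longlonglongrightarrow> 0 \<and> \<beta> \<longlonglongrightarrow> 0 \<and>
             (\<forall>N1 N2. measure \<mu>0 {z\<in>X. \<bar>\<Phi> z y - \<Phi>N N1 z y\<bar> \<le> \<alpha> N1 \<and> \<bar>R z - RN N2 z\<bar> \<le> \<beta> N2}
                \<ge> 1 - \<epsilon>)) \<longrightarrow>
          ((\<lambda>(N1, N2). hellinger \<mu>0 (post y) (gibbs \<mu>0 (\<lambda>z. \<Phi>N N1 z y + RN N2 z))) \<longlongrightarrow> 0)
            (sequentially \<times>\<^sub>F sequentially)))"
proof -
  interpret bounded_open \<Omega> by unfold_locales fact+
  interpret poisson_model \<Omega> A a b c by unfold_locales fact+
  have \<mu>0: "space \<mu>0 = H1 \<Omega>" "sets \<mu>0 = sets (H1_borel \<Omega>)" "prob_space \<mu>0"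
    using \<open>H1_gaussian \<Omega> \<mu>0 \<xi> C0\<close> by (auto simp: H1_gaussian_def)
  interpret \<mu>0: prob_space \<mu>0 by (rule \<mu>0(3))
  \<comment> \<open>Measurability sees only the sigma-algebra, so results for
    \<open>H1_borel\<close> transfer to the Gaussian measure.\<close>
  have meas: "borel_measurable \<mu>0 = (borel_measurable (H1_borel \<Omega>) :: (ae_fun \<Rightarrow> real) set)"
    by (rule measurable_cong_sets[OF \<mu>0(2) refl])
  have \<Phi>_meas [measurable]: "(\<lambda>z. \<Phi> z y) \<in> borel_measurable \<mu>0" for y
    unfolding meas \<Phi>_def by (rule potential_measurable)
  have R_meas [measurable]: "R \<in> borel_measurable \<mu>0"
    unfolding meas R_def using TV_measurable by measurable
  have R_nonneg: "0 \<le> R z" for z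
    using TV_nonneg[of z] \<open>lam > 0\<close> by (simp add: R_def)
  define m where "m y = - (real CARD('d) * \<Lambda> * norm y)" for y :: "real^'d"
  have V_ge: "m y \<le> \<Phi> z y + R z" if "z \<in> H1 \<Omega>" for z y
    using potential_ge[OF that, of y] R_nonneg[of z] unfolding m_def \<Phi>_def by linarith
  \<comment> \<open>The bound may be lowered, so that potentials for different data, or a potential
    and its approximations, can share one.\<close>
  have pot: "bounded_potential \<mu>0 (\<lambda>z. \<Phi> z y + R z) m'" if "m' \<le> m y" for y m'
    by unfold_locales (measurable, use V_ge that \<mu>0(1) in \<open>auto intro: order_trans\<close>)
  have part1: "(\<lambda>z. \<Phi> z y + R z) \<in> borel_measurable \<mu>0 \<and>
        0 < gibbs_const \<mu>0 (\<lambda>z. \<Phi> z y + R z) \<and> gibbs_const \<mu>0 (\<lambda>z. \<Phi> z y + R z) < \<infinity> \<and>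
        prob_space (post y)" for y
  proof -
    interpret V: bounded_potential \<mu>0 "\<lambda>z. \<Phi> z y + R z" "m y" by (rule pot) simp
    show ?thesis
      using V.V_measurable V.Z_pos V.prob_space_gibbs by (simp add: V.gibbs_const_eq post_def)
  qed
  \<comment> \<open>One constant serves all pairs of data, and hence every radius r.\<close>
  have part2: "hellinger \<mu>0 (post y) (post y') \<le> real CARD('d) * \<Lambda> * norm (y - y')" for y y'
  proof -
    interpret V: bounded_potential \<mu>0 "\<lambda>z. \<Phi> z y + R z" "min (m y) (m y')" by (rule pot) simp
    interpret W: bounded_potential \<mu>0 "\<lambda>z. \<Phi> z y' + R z" "min (m y) (m y')" by (rule pot) simp
    interpret two_potentials \<mu>0 "\<lambda>z. \<Phi> z y + R z" "\<lambda>z. \<Phi> z y' + R z" "min (m y) (m y')" by unfold_locales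
    show ?thesis unfolding post_def
    proof (rule hellinger_le_sup)
      fix z assume "z \<in> space \<mu>0"
      then show "\<bar>\<Phi> z y + R z - (\<Phi> z y' + R z)\<bar> \<le> real CARD('d) * \<Lambda> * norm (y - y')"
        using potential_Lipschitz[of z y y'] \<mu>0(1) by (simp add: \<Phi>_def)
    qed
  qed
  have part3: "((\<lambda>(N1, N2). hellinger \<mu>0 (post y) (gibbs \<mu>0 (\<lambda>z. \<Phi>N N1 z y + RN N2 z))) \<longlongrightarrow> 0)
            (sequentially \<times>\<^sub>F sequentially)"
    if y: "y \<in> Y"
      and \<Phi>N_meas: "\<forall>n. \<forall>y\<in>Y. (\<lambda>z. \<Phi>N n z y) \<in> borel_measurable \<mu>0"
      and RN_meas: "\<forall>n. RN n \<in> borel_measurable \<mu>0"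
      and \<Phi>N_bound: "\<forall>r>0. \<exists>M N. N > 0 \<and> (\<forall>n. \<forall>z\<in>X. \<forall>y\<in>Y. norm y < r \<longrightarrow> M \<le> \<Phi>N n z y \<and> \<Phi>N n z y \<le> N)"
      and RN_bound: "\<exists>m. \<forall>n. \<forall>z\<in>X. m \<le> RN n z"
      and close: "\<forall>\<epsilon>>0. \<exists>\<alpha> \<beta> :: nat \<Rightarrow> real. (\<forall>n. \<alpha> n > 0) \<and> (\<forall>n. \<beta> n > 0) \<and>
             \<alpha> \<longlonglongrightarrow> 0 \<and> \<beta> \<longlonglongrightarrow> 0 \<and>
             (\<forall>N1 N2. measure \<mu>0 {z\<in>X. \<bar>\<Phi> z y - \<Phi>N N1 z y\<bar> \<le> \<alpha> N1 \<and> \<bar>R z - RN N2 z\<bar> \<le> \<beta> N2}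
                \<ge> 1 - \<epsilon>)"
    for y and \<Phi>N :: "nat \<Rightarrow> ae_fun \<Rightarrow> real^'d \<Rightarrow> real" and RN :: "nat \<Rightarrow> ae_fun \<Rightarrow> real"
  proof -
    have [measurable]: "(\<lambda>z. \<Phi>N n z y) \<in> borel_measurable \<mu>0" "RN n \<in> borel_measurable \<mu>0" for n
      using \<Phi>N_meas RN_meas y by auto
    \<comment> \<open>The bounds on the approximations concern data of norm strictly below r; r =
      norm y + 1 is such a radius for the given y.\<close>
    have "norm y + 1 > 0" by (simp add: add_nonneg_pos)
    then obtain M where M: "\<And>n z. z \<in> X \<Longrightarrow> M \<le> \<Phi>N n z y"
      using \<Phi>N_bound y by (metis less_add_one)
    obtain mR where mR: "\<And>n z. z \<in> X \<Longrightarrow> mR \<le> RN n z" using RN_bound by blast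
    define m' where "m' = min (m y) (M + mR)"
    show ?thesis unfolding post_def
    proof (rule tendsto_gibbs_hellinger)
      show "bounded_potential \<mu>0 (\<lambda>z. \<Phi> z y + R z) m'" by (rule pot) (simp add: m'_def)
      show "bounded_potential \<mu>0 (\<lambda>z. \<Phi>N j z y + RN k z) m'" for j k
      proof unfold_locales
        fix z assume "z \<in> space \<mu>0"
        then have "z \<in> X" by (simp add: X_def \<mu>0(1))
        from M[OF this, of j] mR[OF this, of k] show "m' \<le> \<Phi>N j z y + RN k z" by (simp add: m'_def)
      qed measurable
      fix \<epsilon> :: real assume "\<epsilon> > 0"
      from close[rule_format, OF this] obtain \<alpha> \<beta> :: "nat \<Rightarrow> real" where ab: "\<forall>n. \<alpha> n > 0" "\<forall>n. \<beta> n > 0" "\<alpha> \<longlonglongrightarrow> 0" "\<beta> \<longlonglongrightarrow> 0"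
        and E: "\<forall>N1 N2. measure \<mu>0 {z\<in>X. \<bar>\<Phi> z y - \<Phi>N N1 z y\<bar> \<le> \<alpha> N1 \<and> \<bar>R z - RN N2 z\<bar> \<le> \<beta> N2} \<ge> 1 - \<epsilon>"
        by (elim exE conjE) (rule that)
      have "\<exists>E\<in>sets \<mu>0. measure \<mu>0 E \<ge> 1 - \<epsilon> \<and> (\<forall>z\<in>E. \<bar>\<Phi> z y + R z - (\<Phi>N j z y + RN k z)\<bar> \<le> \<alpha> j + \<beta> k)" for j k
      proof
        \<comment> \<open>The set of the hypothesis itself, measurable because all the functionals
          are; on it the triangle inequality adds the two tolerances.\<close>
        let ?E = "{z\<in>space \<mu>0. \<bar>\<Phi> z y - \<Phi>N j z y\<bar> \<le> \<alpha> j \<and> \<bar>R z - RN k z\<bar> \<le> \<beta> k}"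
        show "?E \<in> sets \<mu>0" by measurable
        show "measure \<mu>0 ?E \<ge> 1 - \<epsilon> \<and> (\<forall>z\<in>?E. \<bar>\<Phi> z y + R z - (\<Phi>N j z y + RN k z)\<bar> \<le> \<alpha> j + \<beta> k)"
          using E unfolding X_def \<mu>0(1) by auto
      qed
      then show "\<exists>\<alpha> \<beta> :: nat \<Rightarrow> real. (\<forall>n. \<alpha> n > 0) \<and> (\<forall>n. \<beta> n > 0) \<and> \<alpha> \<longlonglongrightarrow> 0 \<and> \<beta> \<longlonglongrightarrow> 0 \<and>
        (\<forall>j k. \<exists>E\<in>sets \<mu>0. measure \<mu>0 E \<ge> 1 - \<epsilon> \<and> (\<forall>z\<in>E. \<bar>\<Phi> z y + R z - (\<Phi>N j z y + RN k z)\<bar> \<le> \<alpha> j + \<beta> k))"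
        by (intro exI[of _ \<alpha>] exI[of _ \<beta>] conjI ab allI)
    qed
  qed
  show ?thesis
  proof (intro conjI, goal_cases)
    case 1 show ?case using part1 by (intro ballI)
  next
    case 2 show ?case using part2 by (intro allI impI exI ballI)
  next
    case 3 show ?case by (intro allI impI ballI) (rule part3; assumption)
  qed
qed

end
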